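(* Let $(G,w)$ be a combinatorial type of tropical curves and let $d,r$ be non-negative integers. Then the universal Brill-Noether locus $W_d^r(G,w)$ is closed in the universal Picard space $\mathrm{Pic}_d(G,w)$.
   Context: Tropical curves. A tropical curve is a triple $\Gamma=(G,w,\ell)$ where $G$ is a finite connected graph (loops and multiple edges allowed), $\ell:E(G)\to\mathbb{R}_{>0}$ is a length function and $w:V(G)\to\mathbb{Z}_{\ge 0}$ is a weight function. It is identified with the compact metric space of the metric graph $(G,\ell)$. It is pure if $w=0$; the underlying pure tropical curve is $\Gamma^0=(G,0,\ell)$. The combinatorial type of $\Gamma$ is $(G,w)$. Divisors. A divisor on $\Gamma$ is a finite integer combination of points of $\Gamma^0$; effective means all coefficients are non-negative; the degree is the sum of the coefficients; $D$ contains $E$ if $D-E$ is effective. A rational function is a continuous piecewise linear function with integer slopes, $\mathrm{div}(f)(p)$ is the sum of the incoming slopes of $f$ at $p$, and two divisors are linearly equivalent if they differ by some $\mathrm{div}(f)$. $\mathrm{Pic}_d(\Gamma)$ is the set of linear equivalence classes of divisors of degree $d$, and the Jacobian is the group $J(\Gamma)=\mathrm{Pic}_0(\Gamma)$. On a pure tropical curve, the rank of $D$ is $-1$ if $D$ is not linearly equivalent to an effective divisor, and otherwise is the largest $r$ such that for every effective $E$ of degree $r$, $D$ is linearly equivalent to an effective divisor containing $E$. For general $\Gamma$, the rank of $D$ is its rank on the pure tropical curve $\Gamma_\epsilon^w$ obtained from $\Gamma^0$ by attaching $w(v)$ loops of length $\epsilon>0$ at every vertex $v$ (independent of $\epsilon$).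 Jacobian as a torus. $J(\Gamma)$ is identified with the torus $H_1(\Gamma^0,\mathbb{R})/H_1(\Gamma^0,\mathbb{Z})$ by the standard (tropical Abel-Jacobi) identification: if a degree zero divisor is written as $\partial c$ with $c$ an integral 1-chain, its class goes to the class of the unique $z\in H_1(\Gamma^0,\mathbb{R})$ with $\langle z,z'\rangle=\langle c,z'\rangle$ for all $z'\in H_1(\Gamma^0,\mathbb{R})$, where $\langle\cdot,\cdot\rangle$ is the bilinear form on 1-chains given by signed length of overlap. The family of curves. Let $E(G)=\{e_1,\dots,e_n\}$ and $\sigma=\mathbb{R}_{\ge0}^n$. For $s=(s_1,\dots,s_n)\in\sigma$ let $\Gamma_s$ be the tropical curve obtained by contracting each edge $e_k$ with $s_k=0$, giving each edge $e_i$ with $s_i>0$ length $s_i$, and giving each vertex $v$ of the contracted graph weight equal to the genus (first Betti number plus sum of weights) of the connected subgraph $H_v$ of $(G,w)$ collapsed to $v$. There is a natural rescaling map $\alpha_s:\Gamma_{(1,\dots,1)}\to\Gamma_s$ (linear on each edge, collapsing $e_k$ if $s_k=0$). It induces a surjection $H_1(\Gamma_{(1,\dots,1)},\mathbb{R})\to H_1(\Gamma_s,\mathbb{R})$ (sending $\sum_j a_je_j$ to $\sum_{s_j>0}a_je_j$) mapping integral homology to integral homology, hence a surjection $\alpha_{s*}:J(\Gamma_{(1,\dots,1)})\to J(\Gamma_s)$ of tori. Universal spaces. The universal Jacobian is $J(G,w)=\coprod_{s\in\sigma}\{s\}\times J(\Gamma_s)$ with the quotient topology induced by the map $\alpha:\sigma\times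 J(\Gamma_{(1,\dots,1)})\to J(G,w)$, $\alpha(s,x)=(s,\alpha_{s*}(x))$ (the largest topology making $\alpha$ continuous). Fix a point $p\in\Gamma_{(1,\dots,1)}$. The universal Picard space is $\mathrm{Pic}_d(G,w)=\coprod_{s\in\sigma}\{s\}\times\mathrm{Pic}_d(\Gamma_s)$, with the topology transported from $J(G,w)$ by the bijection $(s,[D])\mapsto(s,[D-d\cdot\alpha_s(p)])$. The universal Brill-Noether locus $W_d^r(G,w)\subseteq\mathrm{Pic}_d(G,w)$ is the set of pairs $(s,[D])$ such that the rank of $D$ on $\Gamma_s$ is at least $r$. *)

theory Defs
  imports
    "HOL-Analysis.Analysis"
    "HOL-Library.Poly_Mapping"
    "HOL-Library.Function_Algebras"
    "Graph_Theory.Digraph"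
    "Graph_Theory.Digraph_Component"
begin

section \<open>Tropical curves and their points\<close>

text \<open>
  Every edge of the (undirected) graph is represented by exactly one arc, whose direction is
  only a reference orientation, needed for coordinates on edges and for chains.
\<close>

record ('v, 'e) tropical_curve =
  curve_graph :: "('v, 'e) pre_digraph"
  curve_weight :: "'v \<Rightarrow> nat"
  edge_length :: "'e \<Rightarrow> real"

text \<open>\<open>Interior e t\<close> is the point of the edge \<open>e\<close> at distance \<open>t\<close> from its tail,
  \<open>0 < t < edge_length \<Gamma> e\<close>.\<close>

datatype ('v, 'e) point = Vertex 'v | Interior 'e real

definition points :: "('v, 'e) tropical_curve \<Rightarrow> ('v, 'e) point set" where
  "points \<Gamma> = Vertex ` verts (curve_graph \<Gamma>) \<union>
     {Interior e t | e t. e \<in> arcs (curve_graph \<Gamma>) \<and> 0 < t \<and> t < edge_length \<Gamma> e}"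

definition edge_point :: "('v, 'e) tropical_curve \<Rightarrow> 'e \<Rightarrow> real \<Rightarrow> ('v, 'e) point" where
  "edge_point \<Gamma> e t =
    (if t \<le> 0 then Vertex (tail (curve_graph \<Gamma>) e)
     else if t \<ge> edge_length \<Gamma> e then Vertex (head (curve_graph \<Gamma>) e)
     else Interior e t)"


section \<open>Divisors, rational functions and rank\<close>

type_synonym ('v, 'e) divisor = "('v, 'e) point \<Rightarrow>\<^sub>0 int"

definition divisors :: "('v, 'e) tropical_curve \<Rightarrow> ('v, 'e) divisor set" where
  "divisors \<Gamma> = {D. Poly_Mapping.keys D \<subseteq> points \<Gamma>}"

definition divisor_degree :: "('v, 'e) divisor \<Rightarrow> int" where
  "divisor_degree D = (\<Sum>p\<in>Poly_Mapping.keys D. Poly_Mapping.lookup D p)"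

definition effective :: "('v, 'e) divisor \<Rightarrow> bool" where
  "effective D \<longleftrightarrow> (\<forall>p. 0 \<le> Poly_Mapping.lookup D p)"

definition divisor_contains :: "('v, 'e) divisor \<Rightarrow> ('v, 'e) divisor \<Rightarrow> bool" where
  "divisor_contains D E \<longleftrightarrow> effective (D - E)"

text \<open>\<open>S\<close> is a finite set of breakpoints.\<close>

definition integral_pl_on :: "real \<Rightarrow> (real \<Rightarrow> real) \<Rightarrow> bool" where
  "integral_pl_on L g \<longleftrightarrow> continuous_on {0..L} g \<and>
     (\<exists>S. finite S \<and>
       (\<forall>a b. a < b \<and> {a<..<b} \<subseteq> {0..L} - S \<longrightarrow>
         (\<exists>(m::int) c. \<forall>t\<in>{a<..<b}. g t = of_int m * t + c)))"

text \<open>A function on the metric graph is continuous iff its restriction to each closed edge is.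
  Values of \<open>f\<close> off \<open>points \<Gamma>\<close> are irrelevant.\<close>

definition rational_function :: "('v, 'e) tropical_curve \<Rightarrow> (('v, 'e) point \<Rightarrow> real) \<Rightarrow> bool" where
  "rational_function \<Gamma> f \<longleftrightarrow>
     (\<forall>e\<in>arcs (curve_graph \<Gamma>). integral_pl_on (edge_length \<Gamma> e) (\<lambda>t. f (edge_point \<Gamma> e t)))"

text \<open>\<open>div_at \<Gamma> f p\<close> is \<open>div(f)(p)\<close>, the sum of the incoming slopes; a slope coming in
  against the reference orientation is minus a right derivative.\<close>

definition div_at :: "('v, 'e) tropical_curve \<Rightarrow> (('v, 'e) point \<Rightarrow> real) \<Rightarrow> ('v, 'e) point \<Rightarrow> real" where
  "div_at \<Gamma> f p =
    (let lslope = (\<lambda>e t. vector_derivative (\<lambda>u. f (edge_point \<Gamma> e u)) (at_left t));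
         rslope = (\<lambda>e t. vector_derivative (\<lambda>u. f (edge_point \<Gamma> e u)) (at_right t))
     in case p of
          Vertex v \<Rightarrow> (\<Sum>e\<in>in_arcs (curve_graph \<Gamma>) v. lslope e (edge_length \<Gamma> e)) +
                      (\<Sum>e\<in>out_arcs (curve_graph \<Gamma>) v. - rslope e 0)
        | Interior e t \<Rightarrow> lslope e t - rslope e t)"

definition lin_equiv :: "('v, 'e) tropical_curve \<Rightarrow> ('v, 'e) divisor rel" where
  "lin_equiv \<Gamma> = {(D, D'). D \<in> divisors \<Gamma> \<and> D' \<in> divisors \<Gamma> \<and>
     (\<exists>f. rational_function \<Gamma> f \<and>
       (\<forall>p\<in>points \<Gamma>. of_int (Poly_Mapping.lookup (D' - D) p) = div_at \<Gamma> f p))}"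

definition Pic :: "('v, 'e) tropical_curve \<Rightarrow> int \<Rightarrow> ('v, 'e) divisor set set" where
  "Pic \<Gamma> d = {D \<in> divisors \<Gamma>. divisor_degree D = d} // lin_equiv \<Gamma>"

definition pure_rank :: "('v, 'e) tropical_curve \<Rightarrow> ('v, 'e) divisor \<Rightarrow> int" where
  "pure_rank \<Gamma> D =
    (if \<exists>D'. (D, D') \<in> lin_equiv \<Gamma> \<and> effective D'
     then int (GREATEST r. \<forall>E\<in>divisors \<Gamma>. effective E \<and> divisor_degree E = int r \<longrightarrow>
                 (\<exists>D'. (D, D') \<in> lin_equiv \<Gamma> \<and> effective D' \<and> divisor_contains D' E))
     else - 1)"

text \<open>The pure curve \<open>\<Gamma>\<^sub>\<epsilon>\<^sup>w\<close>: the loops at \<open>v\<close> are \<open>Inr (v, i)\<close> for \<open>i < w v\<close>.\<close>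

definition attach_loops ::
  "real \<Rightarrow> ('v, 'e) tropical_curve \<Rightarrow> ('v, 'e + 'v \<times> nat) tropical_curve" where
  "attach_loops \<epsilon> \<Gamma> = \<lparr>
     curve_graph = \<lparr>
       verts = verts (curve_graph \<Gamma>),
       arcs = Inl ` arcs (curve_graph \<Gamma>) \<union>
              Inr ` (SIGMA v : verts (curve_graph \<Gamma>). {..<curve_weight \<Gamma> v}),
       tail = case_sum (tail (curve_graph \<Gamma>)) fst,
       head = case_sum (head (curve_graph \<Gamma>)) fst\<rparr>,
     curve_weight = (\<lambda>_. 0),
     edge_length = case_sum (edge_length \<Gamma>) (\<lambda>_. \<epsilon>)\<rparr>"

text \<open>The rank does not depend on \<open>\<epsilon> > 0\<close>; we keep \<open>\<epsilon>\<close> as a parameter.\<close>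

definition divisor_rank :: "real \<Rightarrow> ('v, 'e) tropical_curve \<Rightarrow> ('v, 'e) divisor \<Rightarrow> int" where
  "divisor_rank \<epsilon> \<Gamma> D =
     pure_rank (attach_loops \<epsilon> \<Gamma>) (frag_extend (\<lambda>p. frag_of (map_point id Inl p)) D)"


section \<open>Homology and the Jacobian torus\<close>

text \<open>A real 1-cycle is given by its coefficients on the edges, zero off the edge set.\<close>

definition H1R :: "('v, 'e) pre_digraph \<Rightarrow> ('e \<Rightarrow> real) set" where
  "H1R G = {z. (\<forall>e. e \<notin> arcs G \<longrightarrow> z e = 0) \<and>
               (\<forall>v\<in>verts G. (\<Sum>e\<in>in_arcs G v. z e) = (\<Sum>e\<in>out_arcs G v. z e))}"

definition H1Z :: "('v, 'e) pre_digraph \<Rightarrow> ('e \<Rightarrow> real) set" where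
  "H1Z G = {z \<in> H1R G. \<forall>e. z e \<in> \<int>}"

definition betti1 :: "('v, 'e) pre_digraph \<Rightarrow> nat" where
  "betti1 G = vector_space.dim (\<lambda>(c::real) z e. c * z e) (H1R G)"

definition H1_class :: "('v, 'e) pre_digraph \<Rightarrow> ('e \<Rightarrow> real) \<Rightarrow> ('e \<Rightarrow> real) set" where
  "H1_class G z = (\<lambda>h. z + h) ` H1Z G"

definition torus :: "('v, 'e) pre_digraph \<Rightarrow> ('e \<Rightarrow> real) set set" where
  "torus G = H1_class G ` H1R G"

text \<open>An integral 1-chain is an integer combination of oriented segments; \<open>(e, a, b)\<close> is the
  segment of the edge \<open>e\<close> from coordinate \<open>a\<close> to coordinate \<open>b\<close>.\<close>

type_synonym 'e chain = "('e \<times> real \<times> real) \<Rightarrow>\<^sub>0 int"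

definition int_chains :: "('v, 'e) tropical_curve \<Rightarrow> 'e chain set" where
  "int_chains \<Gamma> = {c. Poly_Mapping.keys c \<subseteq>
     {(e, a, b). e \<in> arcs (curve_graph \<Gamma>) \<and> 0 \<le> a \<and> a \<le> b \<and> b \<le> edge_length \<Gamma> e}}"

definition boundary :: "('v, 'e) tropical_curve \<Rightarrow> 'e chain \<Rightarrow> ('v, 'e) divisor" where
  "boundary \<Gamma> =
     frag_extend (\<lambda>(e, a, b). frag_of (edge_point \<Gamma> e b) - frag_of (edge_point \<Gamma> e a))"

text \<open>The signed length of overlap, for two cycles and for a chain and a cycle: the segment
  \<open>(e, a, b)\<close> overlaps the full edge \<open>e\<close> in length \<open>b - a\<close> and every other edge in length
  \<open>0\<close>.\<close>

definition cycle_pairing :: "('v, 'e) tropical_curve \<Rightarrow> ('e \<Rightarrow> real) \<Rightarrow> ('e \<Rightarrow> real) \<Rightarrow> real" where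
  "cycle_pairing \<Gamma> z z' = (\<Sum>e\<in>arcs (curve_graph \<Gamma>). edge_length \<Gamma> e * z e * z' e)"

definition chain_pairing :: "'e chain \<Rightarrow> ('e \<Rightarrow> real) \<Rightarrow> real" where
  "chain_pairing c z' =
     (\<Sum>(e, a, b)\<in>Poly_Mapping.keys c. of_int (Poly_Mapping.lookup c (e, a, b)) * (b - a) * z' e)"

text \<open>The identification of \<open>Pic \<Gamma> 0\<close> with the torus; the result depends neither on the divisor
  in the class nor on the chain bounding it.\<close>

definition abel_jacobi :: "('v, 'e) tropical_curve \<Rightarrow> ('v, 'e) divisor set \<Rightarrow> ('e \<Rightarrow> real) set" where
  "abel_jacobi \<Gamma> X = (THE x. \<exists>c\<in>int_chains \<Gamma>. \<exists>z\<in>H1R (curve_graph \<Gamma>).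
     boundary \<Gamma> c \<in> X \<and>
     (\<forall>z'\<in>H1R (curve_graph \<Gamma>). cycle_pairing \<Gamma> z z' = chain_pairing c z') \<and>
     x = H1_class (curve_graph \<Gamma>) z)"


section \<open>The family of curves of a combinatorial type\<close>

definition length_cone :: "('v, 'e) pre_digraph \<Rightarrow> ('e \<Rightarrow> real) set" where
  "length_cone G = {s. (\<forall>e\<in>arcs G. 0 \<le> s e) \<and> (\<forall>e. e \<notin> arcs G \<longrightarrow> s e = 0)}"

definition collapsed_graph :: "('v, 'e) pre_digraph \<Rightarrow> ('e \<Rightarrow> real) \<Rightarrow> ('v, 'e) pre_digraph" where
  "collapsed_graph G s =
     \<lparr>verts = verts G, arcs = {e \<in> arcs G. s e = 0}, tail = tail G, head = head G\<rparr>"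

definition collapsed_rel :: "('v, 'e) pre_digraph \<Rightarrow> ('e \<Rightarrow> real) \<Rightarrow> 'v rel" where
  "collapsed_rel G s = {(u, v). u \<rightarrow>\<^sup>*\<^bsub>with_proj (mk_symmetric (collapsed_graph G s))\<^esub> v}"

text \<open>The vertices of the contracted graph are the classes of vertices of \<open>G\<close> that get
  identified; the subgraph \<open>H\<^sub>V\<close> collapsed to the vertex \<open>V\<close> has vertex set \<open>V\<close> itself.\<close>

definition contracted_graph :: "('v, 'e) pre_digraph \<Rightarrow> ('e \<Rightarrow> real) \<Rightarrow> ('v set, 'e) pre_digraph" where
  "contracted_graph G s = \<lparr>
     verts = verts G // collapsed_rel G s,
     arcs = {e \<in> arcs G. s e > 0},
     tail = (\<lambda>e. collapsed_rel G s `` {tail G e}),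
     head = (\<lambda>e. collapsed_rel G s `` {head G e})\<rparr>"

definition collapsed_subgraph ::
  "('v, 'e) pre_digraph \<Rightarrow> ('e \<Rightarrow> real) \<Rightarrow> 'v set \<Rightarrow> ('v, 'e) pre_digraph" where
  "collapsed_subgraph G s V = \<lparr>
     verts = V,
     arcs = {e \<in> arcs G. s e = 0 \<and> tail G e \<in> V \<and> head G e \<in> V},
     tail = tail G, head = head G\<rparr>"

definition curve_at ::
  "('v, 'e) pre_digraph \<Rightarrow> ('v \<Rightarrow> nat) \<Rightarrow> ('e \<Rightarrow> real) \<Rightarrow> ('v set, 'e) tropical_curve" where
  "curve_at G w s = \<lparr>
     curve_graph = contracted_graph G s,
     curve_weight = (\<lambda>V. betti1 (collapsed_subgraph G s V) + (\<Sum>v\<in>V. w v)),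
     edge_length = s\<rparr>"

text \<open>The parameter \<open>(1, \<dots>, 1)\<close>; the vertices of the corresponding curve are the singletons
  \<open>{v}\<close>.\<close>

definition ones :: "('v, 'e) pre_digraph \<Rightarrow> 'e \<Rightarrow> real" where
  "ones G = indicator (arcs G)"

definition rescale ::
  "('v, 'e) pre_digraph \<Rightarrow> ('e \<Rightarrow> real) \<Rightarrow> ('v set, 'e) point \<Rightarrow> ('v set, 'e) point" where
  "rescale G s p = (case p of
       Vertex V \<Rightarrow> Vertex (collapsed_rel G s `` V)
     | Interior e t \<Rightarrow>
         if s e = 0 then Vertex (collapsed_rel G s `` {tail G e}) else Interior e (s e * t))"

definition rescale_H1 :: "('e \<Rightarrow> real) \<Rightarrow> ('e \<Rightarrow> real) \<Rightarrow> ('e \<Rightarrow> real)" where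
  "rescale_H1 s z = (\<lambda>e. if s e > 0 then z e else 0)"

text \<open>The map induced by \<open>rescale_H1 s\<close> on classes modulo integral homology.\<close>

definition rescale_torus ::
  "('v, 'e) pre_digraph \<Rightarrow> ('e \<Rightarrow> real) \<Rightarrow> ('e \<Rightarrow> real) set \<Rightarrow> ('e \<Rightarrow> real) set" where
  "rescale_torus G s x = (\<Union>z\<in>x. H1_class (contracted_graph G s) (rescale_H1 s z))"


section \<open>The universal spaces\<close>

definition final_topology :: "'a topology \<Rightarrow> ('a \<Rightarrow> 'b) \<Rightarrow> 'b set \<Rightarrow> 'b topology" where
  "final_topology X f Y = topology (\<lambda>U. U \<subseteq> Y \<and> openin X {x \<in> topspace X. f x \<in> U})"

lemma openin_final_topology:
  "openin (final_topology X f Y) U \<longleftrightarrow> U \<subseteq> Y \<and> openin X {x \<in> topspace X. f x \<in> U}"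
proof -
  have "istopology (\<lambda>U. U \<subseteq> Y \<and> openin X {x \<in> topspace X. f x \<in> U})"
    unfolding istopology_def
  proof (intro conjI allI impI)
    fix S T
    assume "S \<subseteq> Y \<and> openin X {x \<in> topspace X. f x \<in> S}"
      and "T \<subseteq> Y \<and> openin X {x \<in> topspace X. f x \<in> T}"
    moreover have "{x \<in> topspace X. f x \<in> S \<inter> T} =
        {x \<in> topspace X. f x \<in> S} \<inter> {x \<in> topspace X. f x \<in> T}" by auto
    ultimately show "S \<inter> T \<subseteq> Y" "openin X {x \<in> topspace X. f x \<in> S \<inter> T}"
      by auto
  next
    fix K
    assume K: "\<forall>U\<in>K. U \<subseteq> Y \<and> openin X {x \<in> topspace X. f x \<in> U}"
    then show "\<Union>K \<subseteq> Y" by auto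
    have "{x \<in> topspace X. f x \<in> \<Union>K} = (\<Union>U\<in>K. {x \<in> topspace X. f x \<in> U})" by auto
    then show "openin X {x \<in> topspace X. f x \<in> \<Union>K}"
      using K by (auto intro!: openin_Union)
  qed
  then show ?thesis
    by (simp add: final_topology_def)
qed

text \<open>Here \<open>top_of_set (H1R _)\<close> is the Euclidean topology: the product topology on functions,
  restricted to functions supported on the finite edge set; likewise for the cone.\<close>

definition torus_topology :: "('v, 'e) pre_digraph \<Rightarrow> ('e \<Rightarrow> real) set topology" where
  "torus_topology G = final_topology (top_of_set (H1R G)) (H1_class G) (torus G)"

definition universal_jacobian ::
  "('v, 'e) pre_digraph \<Rightarrow> (('e \<Rightarrow> real) \<times> ('e \<Rightarrow> real) set) topology" where
  "universal_jacobian G =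
     final_topology
       (prod_topology (top_of_set (length_cone G)) (torus_topology (contracted_graph G (ones G))))
       (\<lambda>(s, x). (s, rescale_torus G s x))
       (SIGMA s : length_cone G. torus (contracted_graph G s))"

definition universal_Pic_set ::
  "('v, 'e) pre_digraph \<Rightarrow> ('v \<Rightarrow> nat) \<Rightarrow> int \<Rightarrow>
     (('e \<Rightarrow> real) \<times> ('v set, 'e) divisor set) set" where
  "universal_Pic_set G w d = (SIGMA s : length_cone G. Pic (curve_at G w s) d)"

text \<open>The bijection \<open>(s, [D]) \<mapsto> (s, [D - d \<cdot> \<alpha>\<^sub>s(p)])\<close>.  Translating a linear equivalence
  class elementwise gives a linear equivalence class.\<close>

definition Pic_to_jacobian ::
  "('v, 'e) pre_digraph \<Rightarrow> ('v \<Rightarrow> nat) \<Rightarrow> ('v set, 'e) point \<Rightarrow> int \<Rightarrow>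
     ('e \<Rightarrow> real) \<times> ('v set, 'e) divisor set \<Rightarrow> ('e \<Rightarrow> real) \<times> ('e \<Rightarrow> real) set" where
  "Pic_to_jacobian G w p d = (\<lambda>(s, X).
     (s, abel_jacobi (curve_at G w s) ((\<lambda>D. D - frag_cmul d (frag_of (rescale G s p))) ` X)))"

definition universal_Pic ::
  "('v, 'e) pre_digraph \<Rightarrow> ('v \<Rightarrow> nat) \<Rightarrow> ('v set, 'e) point \<Rightarrow> int \<Rightarrow>
     (('e \<Rightarrow> real) \<times> ('v set, 'e) divisor set) topology" where
  "universal_Pic G w p d =
     pullback_topology (universal_Pic_set G w d) (Pic_to_jacobian G w p d) (universal_jacobian G)"

definition brill_noether_locus ::
  "real \<Rightarrow> ('v, 'e) pre_digraph \<Rightarrow> ('v \<Rightarrow> nat) \<Rightarrow> int \<Rightarrow> int \<Rightarrow>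
     (('e \<Rightarrow> real) \<times> ('v set, 'e) divisor set) set" where
  "brill_noether_locus \<epsilon> G w d r =
     {(s, lin_equiv (curve_at G w s) `` {D}) | s D.
        s \<in> length_cone G \<and> D \<in> divisors (curve_at G w s) \<and> divisor_degree D = d \<and>
        r \<le> divisor_rank \<epsilon> (curve_at G w s) D}"

end

theory Submission
  imports Defs
begin

text \<open>
  A linear equivalence on a metric graph is described by integer slopes \<open>m\<close> at the tails of the
  edges and a potential \<open>\<phi>\<close> on the vertices.  The same data with an additional term
  \<open>edge_length \<cdot> z\<close> in the equation for \<open>d\<phi>\<close> describe the divisors with Abel--Jacobi image
  \<open>[z]\<close>, and these equations still make sense on the uncontracted graph when some lengths are \<open>0\<close>.
  An energy estimate shows that effective representatives of convergent classes, as the lengths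
  converge in the cone, subconverge to effective representatives of the limit class.

  It remains to see what the condition on the rank gives in the limit.  On a weighted curve, the rank
  is at least \<open>r\<close> as soon as for all \<open>k V \<le> weight V\<close> and all effective \<open>E\<close> of degree
  \<open>r - \<Sum> k V\<close> there is an effective representative containing \<open>E + \<Sum> 2 (k V) V\<close>: a loop
  carrying \<open>a > 0\<close> prescribed points is served by \<open>a + 1\<close> chips at its base point.  Conversely, let a
  subgraph of genus \<open>g\<close> (attached loops included) shrink to the vertex \<open>V\<close>, and let \<open>k \<le> g\<close>.  Put
  \<open>k\<close> chips in general position on edges dual to \<open>k\<close> independent cycles of the subgraph.  A
  representative containing them must contain at least \<open>k\<close> further chips on the subgraph, for otherwise
  some combination of the cycles would pair to zero with the rest and would fix a linear combination of
  the positions up to countably many values.  In the limit these \<open>2 k\<close> chips all arrive at \<open>V\<close>.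
\<close>


section \<open>Weighted sums over divisors\<close>

text \<open>The curves \<open>curve_at G w s\<close> change shape with \<open>s\<close>, so their
  divisors have no common home in which limits could be taken. On the fixed graph \<open>G\<close>,
  with chips at coordinates in {0..1} even on edges of length 0, the equations of
  \<open>abel_rel\<close> depend continuously on the lengths and on the chips. The factor
  \<open>s e\<close> in front of \<open>z e\<close> lets one \<open>z\<close> in
  \<open>H1R G\<close> serve as coordinate for every member of the family. The weight of a limit
  vertex comes partly from edges that have shrunk and partly from old weights, that is, from
  attached loops of fixed length. The rank therefore has to be rephrased in terms of chips on the
  curve itself, without loops, before a limit can be taken; the doubled chips at \<open>V\<close>
  are this common form. General position is essential for the doubling: a chip in special position
  on a cycle may well be completed to a representative with no further chip on that cycle. The
  special positions are excluded by a cardinality argument, since the slopes range over a countable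
  set while the positions range over intervals.\<close>

definition wsum :: "('a \<Rightarrow> real) \<Rightarrow> ('a \<Rightarrow>\<^sub>0 int) \<Rightarrow> real" where
  "wsum w D = (\<Sum>p\<in>Poly_Mapping.keys D. w p * of_int (Poly_Mapping.lookup D p))"

abbreviation push :: "('a \<Rightarrow> 'b) \<Rightarrow> ('a \<Rightarrow>\<^sub>0 int) \<Rightarrow> ('b \<Rightarrow>\<^sub>0 int)" where
  "push g \<equiv> frag_extend (\<lambda>p. frag_of (g p))"

lemma wsum_superset:
  assumes "finite S" "Poly_Mapping.keys D \<subseteq> S"
  shows "wsum w D = (\<Sum>p\<in>S. w p * of_int (Poly_Mapping.lookup D p))"
  unfolding wsum_def using assms
  by (intro sum.mono_neutral_left) (auto simp: in_keys_iff)

lemma wsum_0 [simp]: "wsum w 0 = 0"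
  by (simp add: wsum_def)

lemma wsum_frag_of [simp]: "wsum w (frag_of p) = w p"
  by (simp add: wsum_def)

lemma wsum_cmul [simp]: "wsum w (frag_cmul c D) = of_int c * wsum w D"
  by (subst wsum_superset[of "Poly_Mapping.keys D"])
     (auto simp: wsum_def sum_distrib_left algebra_simps)

lemma wsum_add [simp]: "wsum w (D + E) = wsum w D + wsum w E"
proof -
  let ?S = "Poly_Mapping.keys D \<union> Poly_Mapping.keys E"
  have "wsum w (D + E) = (\<Sum>p\<in>?S. w p * of_int (Poly_Mapping.lookup (D + E) p))"
    using Poly_Mapping.keys_add[of D E] by (intro wsum_superset) auto
  also have "\<dots> = (\<Sum>p\<in>?S. w p * of_int (Poly_Mapping.lookup D p)) +
      (\<Sum>p\<in>?S. w p * of_int (Poly_Mapping.lookup E p))"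
    by (simp add: lookup_add algebra_simps sum.distrib)
  also have "\<dots> = wsum w D + wsum w E"
    by (subst (1 2) wsum_superset[of ?S]) auto
  finally show ?thesis .
qed

lemma wsum_minus [simp]: "wsum w (- D) = - wsum w D"
  using wsum_cmul[of w "- 1" D] by simp

lemma wsum_diff [simp]: "wsum w (D - E) = wsum w D - wsum w E"
  using wsum_add[of w D "- E"] by simp

lemma wsum_sum [simp]: "wsum w (\<Sum>i\<in>I. f i) = (\<Sum>i\<in>I. wsum w (f i))"
  by (induction I rule: infinite_finite_induct) auto

text \<open>Degrees, \<open>head_degree\<close>, \<open>edge_moment\<close> and counts of chips in a
  region are all sums of this kind, so their behaviour under maps of points reduces to a change of
  weights.\<close>

lemma wsum_push [simp]: "wsum w (push g D) = wsum (\<lambda>p. w (g p)) D"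
  by (simp add: frag_extend_def) (simp add: wsum_def mult.commute)

lemma wsum_cong: "(\<And>p. p \<in> Poly_Mapping.keys D \<Longrightarrow> w p = w' p) \<Longrightarrow> wsum w D = wsum w' D"
  by (simp add: wsum_def)

lemma wsum_weight_add: "wsum (\<lambda>p. a p + b p) D = wsum a D + wsum b D"
  by (simp add: wsum_def algebra_simps sum.distrib)

lemma wsum_weight_mult: "wsum (\<lambda>p. c * a p) D = c * wsum a D"
  by (simp add: wsum_def algebra_simps sum_distrib_left)

lemma wsum_weight_sum: "wsum (\<lambda>p. \<Sum>i\<in>I. a i p) D = (\<Sum>i\<in>I. wsum (a i) D)"
  unfolding wsum_def by (simp add: sum_distrib_right) (rule sum.swap)

lemma wsum_indicator: "wsum (\<lambda>p. if p = q then c else 0) D = c * of_int (Poly_Mapping.lookup D q)"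
  by (subst wsum_superset[of "insert q (Poly_Mapping.keys D)"])
     (auto simp: if_distrib[of "\<lambda>x. x * _"] cong: if_cong)

lemma effective_wsum_nonneg:
  assumes "effective D" "\<And>p. 0 \<le> a p"
  shows "0 \<le> wsum a D"
  unfolding wsum_def using assms by (intro sum_nonneg mult_nonneg_nonneg) (auto simp: effective_def)

lemma divisor_degree_wsum: "of_int (divisor_degree D) = wsum (\<lambda>_. 1) D"
  by (simp add: divisor_degree_def wsum_def)

lemma lookup_frag_extend:
  "Poly_Mapping.lookup (push g D) q = (\<Sum>p\<in>Poly_Mapping.keys D. if g p = q then Poly_Mapping.lookup D p else 0)"
  by (auto simp: frag_extend_def lookup_sum intro!: sum.cong)

lemma of_int_lookup_push:
  "real_of_int (Poly_Mapping.lookup (push g D) q) = wsum (\<lambda>p. if g p = q then 1 else 0) D"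
  by (auto simp: lookup_frag_extend wsum_def intro!: sum.cong)

lemma push_push: "push f (push g D) = push (\<lambda>p. f (g p)) D"
  using frag_extend_compose[of "\<lambda>p. frag_of (f p)" g D] by (simp add: comp_def)

lemma push_id: "(\<And>p. p \<in> Poly_Mapping.keys D \<Longrightarrow> g p = p) \<Longrightarrow> push g D = D"
proof -
  assume *: "\<And>p. p \<in> Poly_Mapping.keys D \<Longrightarrow> g p = p"
  have "push g D = push (\<lambda>p. p) D"
    by (rule frag_extend_eq) (simp add: *)
  also have "\<dots> = D"
    by (rule poly_mapping_eqI) (auto simp: lookup_frag_extend in_keys_iff)
  finally show ?thesis .
qed

lemma keys_push: "Poly_Mapping.keys (push g D) \<subseteq> g ` Poly_Mapping.keys D"
  using keys_frag_extend[of "\<lambda>p. frag_of (g p)" D] by auto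

lemma effective_push: "effective D \<Longrightarrow> effective (push g D)"
  by (auto simp: effective_def lookup_frag_extend intro!: sum_nonneg)

lemma effective_add: "effective D \<Longrightarrow> effective E \<Longrightarrow> effective (D + E)"
  by (auto simp: effective_def lookup_add)

lemma effective_sum: "(\<And>i. i \<in> I \<Longrightarrow> effective (f i)) \<Longrightarrow> effective (\<Sum>i\<in>I. f i)"
  by (auto simp: effective_def lookup_sum intro!: sum_nonneg)

lemma effective_frag_of [simp]: "effective (frag_of p)"
  by (simp add: effective_def)

lemma effective_cmul: "0 \<le> c \<Longrightarrow> effective D \<Longrightarrow> effective (frag_cmul c D)"
  by (simp add: effective_def)

lemma effective_0 [simp]: "effective 0"
  by (simp add: effective_def)

lemma divisors_add: "D \<in> divisors \<Gamma> \<Longrightarrow> E \<in> divisors \<Gamma> \<Longrightarrow> D + E \<in> divisors \<Gamma>"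
  using Poly_Mapping.keys_add[of D E] by (auto simp: divisors_def)

lemma divisors_diff: "D \<in> divisors \<Gamma> \<Longrightarrow> E \<in> divisors \<Gamma> \<Longrightarrow> D - E \<in> divisors \<Gamma>"
  using keys_diff[of D E] by (auto simp: divisors_def)

lemma divisors_0: "0 \<in> divisors \<Gamma>"
  by (simp add: divisors_def)

lemma divisors_sum: "(\<And>i. i \<in> I \<Longrightarrow> f i \<in> divisors \<Gamma>) \<Longrightarrow> (\<Sum>i\<in>I. f i) \<in> divisors \<Gamma>"
  by (induction I rule: infinite_finite_induct) (auto intro: divisors_add simp: divisors_0)

lemma divisors_frag_of [simp]: "frag_of p \<in> divisors \<Gamma> \<longleftrightarrow> p \<in> points \<Gamma>"
  by (simp add: divisors_def)

lemma divisors_cmul: "D \<in> divisors \<Gamma> \<Longrightarrow> frag_cmul c D \<in> divisors \<Gamma>"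
  by (auto simp: divisors_def)

text \<open>Listing the chips with repetition makes compactness applicable: a sequence of divisors
  of degree \<open>N\<close> becomes \<open>N\<close> sequences of points.\<close>

lemma effective_eq_sum_points:
  assumes "effective D" "divisor_degree D = int N"
  shows "\<exists>c. (\<forall>i<N. c i \<in> Poly_Mapping.keys D) \<and> D = (\<Sum>i<N. frag_of (c i))"
  using assms
proof (induction N arbitrary: D)
  case 0
  have "D = 0"
  proof (rule ccontr)
    assume "D \<noteq> 0"
    then obtain q where q: "q \<in> Poly_Mapping.keys D" by (meson ex_in_conv keys_eq_empty)
    have "0 < divisor_degree D"
      unfolding divisor_degree_def
      using 0 q by (intro sum_pos) (auto simp: effective_def in_keys_iff order.strict_iff_order)
    then show False using 0 by simp
  qed
  then show ?case by simp
next
  case (Suc N)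
  then have "D \<noteq> 0" by (auto simp: divisor_degree_def)
  then obtain q where q: "q \<in> Poly_Mapping.keys D" by (meson ex_in_conv keys_eq_empty)
  then have q': "Poly_Mapping.lookup D q > 0" 
    using Suc.prems by (auto simp: effective_def in_keys_iff order.strict_iff_order)
  have eff: "effective (D - frag_of q)"
    using Suc.prems q' by (auto simp: effective_def lookup_minus)
  have "real_of_int (divisor_degree (D - frag_of q)) = of_int (int N)"
    using Suc.prems(2) divisor_degree_wsum[of D] by (simp add: divisor_degree_wsum)
  then have "divisor_degree (D - frag_of q) = int N" by linarith
  from Suc.IH[OF eff this] obtain c where
    c: "\<forall>i<N. c i \<in> Poly_Mapping.keys (D - frag_of q)" "D - frag_of q = (\<Sum>i<N. frag_of (c i))" by blast
  have sub: "Poly_Mapping.keys (D - frag_of q) \<subseteq> Poly_Mapping.keys D"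
    using q' by (auto simp: in_keys_iff lookup_minus split: if_splits)
  have "D = (\<Sum>i<Suc N. frag_of ((c(N := q)) i))"
    using c(2) by (simp add: algebra_simps)
  moreover have "\<forall>i<Suc N. (c(N := q)) i \<in> Poly_Mapping.keys D"
    using c(1) sub q by (auto simp: less_Suc_eq)
  ultimately show ?case by blast
qed


section \<open>Flows and potentials on finite graphs\<close>

text \<open>The coefficient at \<open>v\<close> of the boundary of the 1-chain \<open>m\<close>. The
  values are integers for slopes and reals for homology.\<close>

definition net_inflow :: "('v, 'e) pre_digraph \<Rightarrow> ('e \<Rightarrow> 'a::ab_group_add) \<Rightarrow> 'v \<Rightarrow> 'a" where
  "net_inflow G m v = (\<Sum>e\<in>in_arcs G v. m e) - (\<Sum>e\<in>out_arcs G v. m e)"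

lemma net_inflow_add: "net_inflow G (\<lambda>e. a e + b e) v = net_inflow G a v + net_inflow G b v"
  by (simp add: net_inflow_def sum.distrib)

lemma net_inflow_diff: "net_inflow G (\<lambda>e. a e - b e) v = net_inflow G a v - net_inflow G b v"
  by (simp add: net_inflow_def sum_subtractf)

lemma net_inflow_0 [simp]: "net_inflow G (\<lambda>e. 0) v = 0"
  by (simp add: net_inflow_def)

lemma net_inflow_mult: "net_inflow G (\<lambda>e. c * a e) v = (c::'a::ring) * net_inflow G a v"
  by (simp add: net_inflow_def sum_distrib_left[symmetric] algebra_simps)

lemma net_inflow_sum: "net_inflow G (\<lambda>e. \<Sum>i\<in>I. f i e) v = (\<Sum>i\<in>I. net_inflow G (f i) v)"
  unfolding net_inflow_def by (subst (1 2) sum.swap) (simp add: sum_subtractf)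

lemma net_inflow_of_int: "net_inflow G (\<lambda>e. of_int (a e)) v = (of_int (net_inflow G a v) :: 'a::ring_1)"
  by (simp add: net_inflow_def)

lemma net_inflow_cong: "(\<And>e. e \<in> arcs G \<Longrightarrow> a e = b e) \<Longrightarrow> net_inflow G a v = net_inflow G b v"
  by (simp add: net_inflow_def)

lemma H1R_iff: "z \<in> H1R G \<longleftrightarrow> (\<forall>e. e \<notin> arcs G \<longrightarrow> z e = 0) \<and> (\<forall>v\<in>verts G. net_inflow G z v = 0)"
  by (auto simp: H1R_def net_inflow_def)

lemma H1R_add: "a \<in> H1R G \<Longrightarrow> b \<in> H1R G \<Longrightarrow> a + b \<in> H1R G"
  by (auto simp: H1R_iff net_inflow_add plus_fun_def)

lemma H1R_diff: "a \<in> H1R G \<Longrightarrow> b \<in> H1R G \<Longrightarrow> a - b \<in> H1R G"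
  by (auto simp: H1R_iff net_inflow_diff fun_diff_def)

lemma H1Z_0: "0 \<in> H1Z G"
  by (auto simp: H1Z_def H1R_iff zero_fun_def)

lemma H1Z_add: "a \<in> H1Z G \<Longrightarrow> b \<in> H1Z G \<Longrightarrow> a + b \<in> H1Z G"
  by (auto simp: H1Z_def H1R_add)

lemma H1Z_minus: "a \<in> H1Z G \<Longrightarrow> - a \<in> H1Z G"
  using H1R_diff[of 0 G a] H1Z_0[of G] by (auto simp: H1Z_def)

lemma H1_class_eq_iff: "H1_class G a = H1_class G b \<longleftrightarrow> a - b \<in> H1Z G"
proof
  assume "H1_class G a = H1_class G b"
  moreover have "a \<in> H1_class G a" using H1Z_0[of G] by (force simp: H1_class_def)
  ultimately show "a - b \<in> H1Z G" by (auto simp: H1_class_def)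
next
  have *: "H1_class G a \<subseteq> H1_class G b" if "a - b \<in> H1Z G" for a b
  proof
    fix x assume "x \<in> H1_class G a"
    then obtain h where h: "h \<in> H1Z G" "x = a + h" by (auto simp: H1_class_def)
    have "x = b + ((a - b) + h)" using h by simp
    then show "x \<in> H1_class G b"
      unfolding H1_class_def using H1Z_add[OF that h(1)] by blast
  qed
  assume "a - b \<in> H1Z G"
  then show "H1_class G a = H1_class G b"
    using *[of a b] *[of b a] H1Z_minus[of "a - b" G] by auto
qed

context fin_digraph
begin

lemma sum_head_arcs:
  fixes x :: "'b \<Rightarrow> 'c::comm_ring"
  shows "(\<Sum>e\<in>arcs G. \<psi> (head G e) * x e) = (\<Sum>v\<in>verts G. \<psi> v * (\<Sum>e\<in>in_arcs G v. x e))"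
proof -
  have "(\<Sum>e\<in>arcs G. \<psi> (head G e) * x e) =
      (\<Sum>v\<in>verts G. \<Sum>e\<in>{e \<in> arcs G. head G e = v}. \<psi> (head G e) * x e)"
    by (rule sum.group[symmetric]) auto
  also have "\<dots> = (\<Sum>v\<in>verts G. \<psi> v * (\<Sum>e\<in>in_arcs G v. x e))"
    by (intro sum.cong refl) (auto simp: sum_distrib_left in_arcs_def intro!: sum.cong)
  finally show ?thesis .
qed

lemma sum_tail_arcs:
  fixes x :: "'b \<Rightarrow> 'c::comm_ring"
  shows "(\<Sum>e\<in>arcs G. \<psi> (tail G e) * x e) = (\<Sum>v\<in>verts G. \<psi> v * (\<Sum>e\<in>out_arcs G v. x e))"
proof -
  have "(\<Sum>e\<in>arcs G. \<psi> (tail G e) * x e) =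
      (\<Sum>v\<in>verts G. \<Sum>e\<in>{e \<in> arcs G. tail G e = v}. \<psi> (tail G e) * x e)"
    by (rule sum.group[symmetric]) auto
  also have "\<dots> = (\<Sum>v\<in>verts G. \<psi> v * (\<Sum>e\<in>out_arcs G v. x e))"
    by (intro sum.cong refl) (auto simp: sum_distrib_left out_arcs_def intro!: sum.cong)
  finally show ?thesis .
qed

text \<open>Taking gradients is adjoint to taking boundaries; the orthogonality of gradients and
  cycles is the case of zero boundary.\<close>

lemma summation_by_parts:
  fixes x :: "'b \<Rightarrow> 'c::comm_ring"
  shows "(\<Sum>e\<in>arcs G. (\<psi> (head G e) - \<psi> (tail G e)) * x e) = (\<Sum>v\<in>verts G. \<psi> v * net_inflow G x v)"
  by (simp add: left_diff_distrib right_diff_distrib sum_subtractf sum_head_arcs sum_tail_arcs net_inflow_def)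

lemma sum_net_inflow: "(\<Sum>v\<in>verts G. net_inflow G (x :: 'b \<Rightarrow> 'c::comm_ring_1) v) = 0"
  using summation_by_parts[of "\<lambda>_. 1" x] by simp

lemma potential_cycle_orthogonal:
  "z \<in> H1R G \<Longrightarrow> (\<Sum>e\<in>arcs G. (\<psi> (head G e) - \<psi> (tail G e)) * z e) = 0"
  by (subst summation_by_parts) (auto simp: H1R_iff)

end

section \<open>Orthogonal projection and the Hodge decomposition of a graph\<close>

lemma orthogonal_projection_finite_family:
  fixes W :: "'e \<Rightarrow> real" and u :: "'i \<Rightarrow> 'e \<Rightarrow> real"
  assumes "finite I" and "finite A" and W: "\<And>e. e \<in> A \<Longrightarrow> 0 < W e"
  shows "\<exists>c. \<forall>i\<in>I. (\<Sum>e\<in>A. W e * (h e - (\<Sum>k\<in>I. c k * u k e)) * u i e) = 0"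
  using \<open>finite I\<close>
proof (induction I arbitrary: h rule: finite_induct)
  case empty
  then show ?case by simp
next
  case (insert k I)
  define ip where "ip = (\<lambda>a b. \<Sum>e\<in>A. W e * a e * b e)"
  have ip_diff: "ip (\<lambda>e. a e - b e) c = ip a c - ip b c" for a b c
    by (simp add: ip_def algebra_simps sum_subtractf)
  have ip_scale: "ip (\<lambda>e. t * a e) c = t * ip a c" for t a c
    by (simp add: ip_def sum_distrib_left algebra_simps)
  have ip_sum: "ip a (\<lambda>e. \<Sum>i\<in>I. d i * u i e) = (\<Sum>i\<in>I. d i * ip a (u i))" for a d
    unfolding ip_def sum_distrib_left by (subst sum.swap) (simp add: sum_distrib_left algebra_simps)
  from insert.IH[of h] obtain c where c: "\<forall>i\<in>I. ip (\<lambda>e. h e - (\<Sum>k\<in>I. c k * u k e)) (u i) = 0"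
    unfolding ip_def by blast
  from insert.IH[of "u k"] obtain d where d: "\<forall>i\<in>I. ip (\<lambda>e. u k e - (\<Sum>k\<in>I. d k * u k e)) (u i) = 0"
    unfolding ip_def by blast
  define h' where "h' = (\<lambda>e. h e - (\<Sum>k\<in>I. c k * u k e))"
  define u' where "u' = (\<lambda>e. u k e - (\<Sum>k\<in>I. d k * u k e))"
  have h': "ip h' (u i) = 0" if "i \<in> I" for i using c that by (simp add: h'_def)
  have u': "ip u' (u i) = 0" if "i \<in> I" for i using d that by (simp add: u'_def)
  have comm: "ip a b = ip b a" for a b by (simp add: ip_def mult.assoc mult.commute[of "a _"])
  have uk: "ip a (u k) = ip a u'" if "\<And>i. i \<in> I \<Longrightarrow> ip a (u i) = 0" for a
  proof -
    have "ip a u' = ip a (u k) - ip a (\<lambda>e. \<Sum>i\<in>I. d i * u i e)"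
      unfolding u'_def by (subst (1 2 3) comm) (rule ip_diff)
    then show ?thesis using that by (simp add: ip_sum)
  qed
  \<comment> \<open>If \<open>u k\<close> already lies in the span of the others on
    \<open>A\<close>, then \<open>u'\<close> has norm 0 there. This does happen: the gradients of
    the vertex indicators, to which the lemma is applied, add up to 0.\<close>
  define t where "t = (if ip u' u' = 0 then 0 else ip h' u' / ip u' u')"
  define c' where "c' = (\<lambda>i. if i = k then t else c i - t * d i)"
  have eq: "h e - (\<Sum>i\<in>insert k I. c' i * u i e) = h' e - t * u' e" for e
  proof -
    have "(\<Sum>i\<in>I. c' i * u i e) = (\<Sum>i\<in>I. c i * u i e) - t * (\<Sum>i\<in>I. d i * u i e)"
      unfolding sum_distrib_left sum_subtractf[symmetric] using insert.hyps
      by (intro sum.cong) (auto simp: c'_def algebra_simps)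
    then show ?thesis
      using insert.hyps by (simp add: c'_def h'_def u'_def algebra_simps)
  qed
  have 0: "ip h' u' = 0" if "ip u' u' = 0"
  proof -
    have "\<forall>e\<in>A. W e * u' e * u' e = 0"
      using that assms(2) unfolding ip_def
      by (subst (asm) sum_nonneg_eq_0_iff) (auto simp: mult.assoc less_imp_le[OF W])
    then have "\<forall>e\<in>A. u' e = 0" using W by force
    then show ?thesis by (simp add: ip_def)
  qed
  have "ip (\<lambda>e. h' e - t * u' e) (u i) = 0" if "i \<in> insert k I" for i
  proof (cases "i = k")
    case True
    have "ip (\<lambda>e. h' e - t * u' e) (u k) = ip h' u' - t * ip u' u'"
      by (simp add: ip_diff ip_scale uk h' u')
    then show ?thesis using True 0 by (auto simp: t_def)
  next
    case False
    then show ?thesis using that by (simp add: ip_diff ip_scale h' u')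
  qed
  then show ?case
    unfolding eq[symmetric] ip_def by blast
qed

context fin_digraph
begin

text \<open>In the inner product with weights \<open>1 / L e\<close>, \<open>h\<close> is projected
  onto the span of the gradients of vertex indicators. That the remainder is orthogonal to the
  gradient at \<open>v\<close> says exactly that the remainder divided by \<open>L\<close> has no
  net inflow at \<open>v\<close>.\<close>

lemma hodge_decomposition:
  assumes L: "\<And>e. e \<in> arcs G \<Longrightarrow> 0 < L e"
  obtains z \<psi> where "z \<in> H1R G" "\<And>e. e \<in> arcs G \<Longrightarrow> h e = L e * z e + (\<psi> (head G e) - \<psi> (tail G e))"
proof -
  define u where "u = (\<lambda>v e. (if head G e = v then 1 else 0) - (if tail G e = v then 1 else (0::real)))"
  obtain c where c: "\<forall>v\<in>verts G. (\<Sum>e\<in>arcs G. inverse (L e) * (h e - (\<Sum>k\<in>verts G. c k * u k e)) * u v e) = 0"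
    using orthogonal_projection_finite_family[of "verts G" "arcs G" "\<lambda>e. inverse (L e)" h u] L by auto
  have grad: "(\<Sum>k\<in>verts G. c k * u k e) = c (head G e) - c (tail G e)" if "e \<in> arcs G" for e
    using that by (simp add: u_def right_diff_distrib sum_subtractf if_distrib[of "\<lambda>x. _ * x"] cong: if_cong)
  define z where "z = (\<lambda>e. if e \<in> arcs G then inverse (L e) * (h e - (c (head G e) - c (tail G e))) else 0)"
  have "net_inflow G z v = 0" if v: "v \<in> verts G" for v
  proof -
    have "net_inflow G z v = (\<Sum>e\<in>arcs G. z e * u v e)"
      unfolding net_inflow_def in_arcs_def out_arcs_def u_def
      by (simp add: right_diff_distrib sum_subtractf if_distrib[of "\<lambda>x. _ * x"] sum.If_cases Int_def cong: if_cong)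
    also have "\<dots> = 0"
      using c v grad by (simp add: z_def cong: sum.cong)
    finally show ?thesis .
  qed
  then have "z \<in> H1R G" by (auto simp: H1R_iff z_def)
  moreover have "h e = L e * z e + (c (head G e) - c (tail G e))" if "e \<in> arcs G" for e
    using L[OF that] that by (simp add: z_def field_simps)
  ultimately show thesis by (rule that)
qed

text \<open>In the decomposition with unit lengths the cycle part of \<open>h\<close> is orthogonal
  to itself.\<close>

lemma orthogonal_to_cycles_potential:
  assumes "\<And>z. z \<in> H1R G \<Longrightarrow> (\<Sum>e\<in>arcs G. h e * z e) = 0"
  shows "\<exists>\<psi>::'a \<Rightarrow> real. \<forall>e\<in>arcs G. h e = \<psi> (head G e) - \<psi> (tail G e)"
proof -
  obtain z \<psi> where z: "z \<in> H1R G" and h: "\<And>e. e \<in> arcs G \<Longrightarrow> h e = 1 * z e + (\<psi> (head G e) - \<psi> (tail G e))"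
    using hodge_decomposition[of "\<lambda>_. 1" h] by auto
  have "0 = (\<Sum>e\<in>arcs G. z e * z e) + (\<Sum>e\<in>arcs G. (\<psi> (head G e) - \<psi> (tail G e)) * z e)"
    using assms[OF z] h by (simp add: sum.distrib[symmetric] algebra_simps cong: sum.cong)
  then have "(\<Sum>e\<in>arcs G. z e * z e) = 0"
    using potential_cycle_orthogonal[OF z] by simp
  then have "\<forall>e\<in>arcs G. z e * z e = 0"
    by (subst (asm) sum_nonneg_eq_0_iff) auto
  then show ?thesis using h by auto
qed

section \<open>Integral flows with prescribed boundary\<close>

lemma unit_flow:
  assumes "u \<rightarrow>\<^sup>*\<^bsub>with_proj (mk_symmetric G)\<^esub> v"
  shows "\<exists>m::'b \<Rightarrow> int. (\<forall>e. e \<notin> arcs G \<longrightarrow> m e = 0) \<and>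
    (\<forall>x\<in>verts G. net_inflow G m x = (if x = v then 1 else 0) - (if x = u then 1 else 0))"
  using assms unfolding reachable_def
proof (induction rule: rtrancl_on.induct)
  case (rtrancl_on_refl a)
  then show ?case by (intro exI[of _ "\<lambda>_. 0"]) auto
next
  case (rtrancl_on_into_rtrancl_on a b c)
  then obtain m :: "'b \<Rightarrow> int" where m: "\<And>e. e \<notin> arcs G \<Longrightarrow> m e = 0"
    "\<And>x. x \<in> verts G \<Longrightarrow> net_inflow G m x = (if x = b then 1 else 0) - (if x = a then 1 else 0)" by blast
  from rtrancl_on_into_rtrancl_on(2) obtain e where e: "e \<in> arcs G"
    "(b = tail G e \<and> c = head G e) \<or> (b = head G e \<and> c = tail G e)"
    by (auto simp: parcs_mk_symmetric)
  \<comment> \<open>The walk may use an arc against its reference orientation; the sign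
    \<open>s\<close> covers both directions.\<close>
  have "\<exists>s::int. (s = 1 \<and> b = tail G e \<and> c = head G e) \<or> (s = - 1 \<and> b = head G e \<and> c = tail G e)"
    using e(2) by auto
  then obtain s :: int where
    s: "(s = 1 \<and> b = tail G e \<and> c = head G e) \<or> (s = - 1 \<and> b = head G e \<and> c = tail G e)" ..
  define m' where "m' = (\<lambda>e'. m e' + s * (if e' = e then 1 else 0))"
  have 1: "net_inflow G (\<lambda>e'. if e' = e then 1 else 0) x =
      (if x = head G e then 1 else 0) - (if x = tail G e then 1 else (0::int))" for x
    using e(1) by (auto simp: net_inflow_def sum.delta[OF finite_in_arcs] sum.delta[OF finite_out_arcs])
  have "net_inflow G m' x = (if x = c then 1 else 0) - (if x = a then 1 else 0)" if "x \<in> verts G" for x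
    using s unfolding m'_def net_inflow_add net_inflow_mult 1 m(2)[OF that] by (elim disjE) simp_all
  moreover have "m' e' = 0" if "e' \<notin> arcs G" for e'
    using that m(1) e(1) by (auto simp: m'_def)
  ultimately show ?case by blast
qed

text \<open>For each unit of \<open>g v\<close> one unit is sent from \<open>rep v\<close> to
  \<open>v\<close>. What leaves a root \<open>x\<close> adds up to the sum of \<open>g\<close> over
  the fibre of \<open>x\<close>, which vanishes. A constant \<open>rep\<close> serves connected
  graphs; one representative per class serves the graph of collapsed edges.\<close>

lemma integral_flow_exists:
  fixes g :: "'a \<Rightarrow> int" and rep :: "'a \<Rightarrow> 'a"
  assumes rep: "\<And>v. v \<in> verts G \<Longrightarrow> rep v \<rightarrow>\<^sup>*\<^bsub>with_proj (mk_symmetric G)\<^esub> v"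
    and g: "\<And>x. x \<in> verts G \<Longrightarrow> (\<Sum>v\<in>{v\<in>verts G. rep v = x}. g v) = 0"
  shows "\<exists>m::'b \<Rightarrow> int. (\<forall>e. e \<notin> arcs G \<longrightarrow> m e = 0) \<and> (\<forall>x\<in>verts G. net_inflow G m x = g x)"
proof -
  have "\<forall>v\<in>verts G. \<exists>m::'b \<Rightarrow> int. (\<forall>e. e \<notin> arcs G \<longrightarrow> m e = 0) \<and>
      (\<forall>x\<in>verts G. net_inflow G m x = (if x = v then 1 else 0) - (if x = rep v then 1 else 0))"
    using unit_flow[OF rep] by blast
  then obtain f :: "'a \<Rightarrow> 'b \<Rightarrow> int" where
    f0: "\<And>v e. v \<in> verts G \<Longrightarrow> e \<notin> arcs G \<Longrightarrow> f v e = 0" and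
    f: "\<And>v x. v \<in> verts G \<Longrightarrow> x \<in> verts G \<Longrightarrow>
        net_inflow G (f v) x = (if x = v then 1 else 0) - (if x = rep v then 1 else 0)"
    by metis
  define m where "m = (\<lambda>e. \<Sum>v\<in>verts G. g v * f v e)"
  have "net_inflow G m x = g x" if x: "x \<in> verts G" for x
  proof -
    have "net_inflow G m x = (\<Sum>v\<in>verts G. g v * ((if x = v then 1 else 0) - (if x = rep v then 1 else 0)))"
      unfolding m_def net_inflow_sum by (intro sum.cong refl) (simp add: net_inflow_mult f x)
    also have "\<dots> = g x - (\<Sum>v\<in>verts G. if rep v = x then g v else 0)"
      using x by (simp add: right_diff_distrib sum_subtractf if_distrib[of "\<lambda>t. _ * t"] eq_commute[of x] cong: if_cong)
    also have "(\<Sum>v\<in>verts G. if rep v = x then g v else 0) = 0"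
      using g[OF x] by (simp add: sum.If_cases Int_def)
    finally show ?thesis by simp
  qed
  moreover have "m e = 0" if "e \<notin> arcs G" for e
    using that by (simp add: m_def f0)
  ultimately show ?thesis by blast
qed

end


section \<open>Linear equivalence in terms of slopes\<close>

text \<open>Chips in the interior of an edge are moved to its head; \<open>m e\<close> in \<open>abel_rel\<close> is the slope
  of a function at the tail of \<open>e\<close>, and \<open>edge_moment\<close> measures how far the chips of \<open>e\<close> are
  moved.\<close>

definition head_point :: "('v, 'e) pre_digraph \<Rightarrow> ('v, 'e) point \<Rightarrow> 'v" where
  "head_point G p = (case p of Vertex v \<Rightarrow> v | Interior e t \<Rightarrow> head G e)"

definition edge_moment :: "('e \<Rightarrow> real \<Rightarrow> real) \<Rightarrow> 'e \<Rightarrow> ('v, 'e) divisor \<Rightarrow> real" where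
  "edge_moment \<kappa> e = wsum (\<lambda>p. case p of Vertex _ \<Rightarrow> 0 | Interior e' t \<Rightarrow> if e' = e then \<kappa> e t else 0)"

definition head_degree :: "('v, 'e) pre_digraph \<Rightarrow> 'v \<Rightarrow> ('v, 'e) divisor \<Rightarrow> real" where
  "head_degree G v = wsum (\<lambda>p. if head_point G p = v then 1 else 0)"

definition abel_rel :: "('v, 'e) pre_digraph \<Rightarrow> ('e \<Rightarrow> real) \<Rightarrow> ('e \<Rightarrow> real \<Rightarrow> real) \<Rightarrow>
    ('v, 'e) divisor \<Rightarrow> ('e \<Rightarrow> real) \<Rightarrow> bool" where
  "abel_rel G L \<kappa> D y \<longleftrightarrow> (\<exists>\<phi> (m :: 'e \<Rightarrow> int).
     (\<forall>e\<in>arcs G. \<phi> (head G e) - \<phi> (tail G e) = of_int (m e) * L e - edge_moment \<kappa> e D - y e) \<and>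
     (\<forall>v\<in>verts G. head_degree G v D = of_int (net_inflow G m v)))"

text \<open>\<open>\<kappa> e t\<close> is the distance from a chip at coordinate \<open>t\<close>
  to the head of \<open>e\<close>. It is a parameter of \<open>abel_rel\<close> because the same
  equations are also used with coordinates in {0..1}, where this distance is
  \<open>s e * (1 - t)\<close>.\<close>

abbreviation curve_rel :: "('v, 'e) tropical_curve \<Rightarrow> ('v, 'e) divisor \<Rightarrow> ('e \<Rightarrow> real) \<Rightarrow> bool" where
  "curve_rel \<Gamma> \<equiv> abel_rel (curve_graph \<Gamma>) (edge_length \<Gamma>) (\<lambda>e t. edge_length \<Gamma> e - t)"

lemma edge_moment_linear [simp]:
  "edge_moment \<kappa> e 0 = 0" "edge_moment \<kappa> e (D + E) = edge_moment \<kappa> e D + edge_moment \<kappa> e E"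
  "edge_moment \<kappa> e (D - E) = edge_moment \<kappa> e D - edge_moment \<kappa> e E"
  "edge_moment \<kappa> e (- D) = - edge_moment \<kappa> e D"
  "edge_moment \<kappa> e (frag_cmul c D) = of_int c * edge_moment \<kappa> e D"
  "edge_moment \<kappa> e (\<Sum>i\<in>I. f i) = (\<Sum>i\<in>I. edge_moment \<kappa> e (f i))"
  by (simp_all add: edge_moment_def)

lemma edge_moment_frag_of [simp]:
  "edge_moment \<kappa> e (frag_of (Vertex v)) = 0"
  "edge_moment \<kappa> e (frag_of (Interior e' t)) = (if e' = e then \<kappa> e t else 0)"
  by (simp_all add: edge_moment_def)

lemma head_degree_linear [simp]:
  "head_degree G v 0 = 0" "head_degree G v (D + E) = head_degree G v D + head_degree G v E"
  "head_degree G v (D - E) = head_degree G v D - head_degree G v E"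
  "head_degree G v (- D) = - head_degree G v D"
  "head_degree G v (frag_cmul c D) = of_int c * head_degree G v D"
  "head_degree G v (\<Sum>i\<in>I. f i) = (\<Sum>i\<in>I. head_degree G v (f i))"
  by (simp_all add: head_degree_def)

lemma head_degree_frag_of [simp]:
  "head_degree G v (frag_of p) = (if head_point G p = v then 1 else 0)"
  by (simp add: head_degree_def)

lemma head_point_simps [simp]:
  "head_point G (Vertex v) = v" "head_point G (Interior e t) = head G e"
  by (simp_all add: head_point_def)

lemma abel_relI:
  assumes "\<And>e. e \<in> arcs G \<Longrightarrow> \<phi> (head G e) - \<phi> (tail G e) = of_int (m e) * L e - edge_moment \<kappa> e D - y e"
    and "\<And>v. v \<in> verts G \<Longrightarrow> head_degree G v D = of_int (net_inflow G m v)"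
  shows "abel_rel G L \<kappa> D y"
  unfolding abel_rel_def using assms by blast

lemma abel_relE:
  assumes "abel_rel G L \<kappa> D y"
  obtains \<phi> m where
    "\<And>e. e \<in> arcs G \<Longrightarrow> \<phi> (head G e) - \<phi> (tail G e) = of_int (m e) * L e - edge_moment \<kappa> e D - y e"
    "\<And>v. v \<in> verts G \<Longrightarrow> head_degree G v D = of_int (net_inflow G m v)"
  using assms unfolding abel_rel_def by blast

lemma abel_rel_0: "abel_rel G L \<kappa> 0 (\<lambda>_. 0)"
  by (rule abel_relI[of _ "\<lambda>_. 0" "\<lambda>_. 0"]) auto

lemma abel_rel_diff:
  assumes "abel_rel G L \<kappa> D y" "abel_rel G L \<kappa> E z"
  shows "abel_rel G L \<kappa> (D - E) (\<lambda>e. y e - z e)"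
proof -
  obtain \<phi> m where 1:
    "\<And>e. e \<in> arcs G \<Longrightarrow> \<phi> (head G e) - \<phi> (tail G e) = of_int (m e) * L e - edge_moment \<kappa> e D - y e"
    "\<And>v. v \<in> verts G \<Longrightarrow> head_degree G v D = of_int (net_inflow G m v)"
    using assms(1) by (rule abel_relE) blast
  obtain \<psi> n where 2:
    "\<And>e. e \<in> arcs G \<Longrightarrow> \<psi> (head G e) - \<psi> (tail G e) = of_int (n e) * L e - edge_moment \<kappa> e E - z e"
    "\<And>v. v \<in> verts G \<Longrightarrow> head_degree G v E = of_int (net_inflow G n v)"
    using assms(2) by (rule abel_relE) blast
  show ?thesis
  proof (rule abel_relI[of _ "\<lambda>v. \<phi> v - \<psi> v" "\<lambda>e. m e - n e"])
    fix e assume "e \<in> arcs G"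
    from 1(1)[OF this] 2(1)[OF this]
    show "\<phi> (head G e) - \<psi> (head G e) - (\<phi> (tail G e) - \<psi> (tail G e)) =
        of_int (m e - n e) * L e - edge_moment \<kappa> e (D - E) - (y e - z e)"
      by (simp add: algebra_simps)
  qed (simp add: 1 2 net_inflow_diff)
qed

lemma abel_rel_add:
  assumes "abel_rel G L \<kappa> D y" "abel_rel G L \<kappa> E z"
  shows "abel_rel G L \<kappa> (D + E) (\<lambda>e. y e + z e)"
  using abel_rel_diff[OF assms(1) abel_rel_diff[OF abel_rel_0 assms(2)]] by simp

lemma abel_rel_cong:
  assumes "\<And>e. e \<in> arcs G \<Longrightarrow> y e = z e"
  shows "abel_rel G L \<kappa> D y \<longleftrightarrow> abel_rel G L \<kappa> D z"
  unfolding abel_rel_def using assms by simp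

lemma abel_rel_cmul:
  assumes "abel_rel G L \<kappa> D y"
  shows "abel_rel G L \<kappa> (frag_cmul c D) (\<lambda>e. of_int c * y e)"
proof -
  obtain \<phi> m where 1:
    "\<And>e. e \<in> arcs G \<Longrightarrow> \<phi> (head G e) - \<phi> (tail G e) = of_int (m e) * L e - edge_moment \<kappa> e D - y e"
    "\<And>v. v \<in> verts G \<Longrightarrow> head_degree G v D = of_int (net_inflow G m v)"
    using assms(1) by (rule abel_relE) blast
  show ?thesis
  proof (rule abel_relI[of _ "\<lambda>v. of_int c * \<phi> v" "\<lambda>e. c * m e"])
    fix e assume "e \<in> arcs G"
    from arg_cong[OF 1(1)[OF this], of "\<lambda>x. of_int c * x"]
    show "of_int c * \<phi> (head G e) - of_int c * \<phi> (tail G e) =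
        of_int (c * m e) * L e - edge_moment \<kappa> e (frag_cmul c D) - of_int c * y e"
      by (simp add: algebra_simps)
  qed (simp add: 1 net_inflow_mult)
qed

lemma abel_rel_sum:
  assumes "\<And>i. i \<in> I \<Longrightarrow> abel_rel G L \<kappa> (D i) (y i)"
  shows "abel_rel G L \<kappa> (\<Sum>i\<in>I. D i) (\<lambda>e. \<Sum>i\<in>I. y i e)"
  using assms by (induction I rule: infinite_finite_induct) (auto intro: abel_rel_0 abel_rel_add)

lemma abel_rel_frag_extend:
  assumes "\<And>p. p \<in> Poly_Mapping.keys D \<Longrightarrow> abel_rel G L \<kappa> (f p) (y p)"
  shows "abel_rel G L \<kappa> (frag_extend f D)
    (\<lambda>e. \<Sum>p\<in>Poly_Mapping.keys D. of_int (Poly_Mapping.lookup D p) * y p e)"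
  unfolding frag_extend_def using assms by (intro abel_rel_sum abel_rel_cmul) auto

text \<open>Every arc enters one vertex and leaves one vertex, so the total net inflow of the slopes
  vanishes.\<close>

lemma (in fin_digraph) abel_rel_degree:
  assumes "abel_rel G L \<kappa> D y" "\<And>p. p \<in> Poly_Mapping.keys D \<Longrightarrow> head_point G p \<in> verts G"
  shows "divisor_degree D = 0"
proof -
  obtain m where m: "\<And>v. v \<in> verts G \<Longrightarrow> head_degree G v D = of_int (net_inflow G m v)"
    using assms(1) by (rule abel_relE) blast
  have "real_of_int (divisor_degree D) = (\<Sum>v\<in>verts G. head_degree G v D)"
    unfolding divisor_degree_wsum head_degree_def wsum_weight_sum[symmetric]
    by (intro wsum_cong) (simp add: assms(2))
  also have "\<dots> = of_int (\<Sum>v\<in>verts G. net_inflow G m v)"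
    by (simp add: m)
  finally show ?thesis by (simp add: sum_net_inflow)
qed

section \<open>Piecewise linear functions of one variable\<close>

lemma affine_on_closed_interval:
  fixes g :: "real \<Rightarrow> real"
  assumes "a < b" "continuous_on {a..b} g" "\<And>t. t \<in> {a<..<b} \<Longrightarrow> g t = m * t + k" "t \<in> {a..b}"
  shows "g t = g a + m * (t - a)"
proof -
  have "g t - m * t = k" if "t \<in> {a..b}" for t
  proof (rule continuous_constant_on_closure[of "{a<..<b}" "\<lambda>t. g t - m * t"])
    show "continuous_on (closure {a<..<b}) (\<lambda>t. g t - m * t)"
      using assms(1,2) by (auto intro!: continuous_intros)
    show "t \<in> closure {a<..<b}" using that assms(1) by simp
  qed (simp add: assms(3))
  from this[OF assms(4)] this[of a] assms(1) show ?thesis by (simp add: algebra_simps)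
qed

text \<open>Each hinge \<open>max 0 (t - u)\<close> carries the loss of slope at one breakpoint, so
  \<open>\<delta> u\<close> is what \<open>div(f)\<close> will have at the corresponding interior
  point. The induction removes the largest breakpoint \<open>c\<close>: before \<open>c\<close> the
  other hinges suffice, and after \<open>c\<close> one more hinge corrects the slope.\<close>

lemma integral_pl_representation:
  fixes g :: "real \<Rightarrow> real"
  assumes "finite S" "a < b" "S \<subseteq> {a<..<b}" "continuous_on {a..b} g"
    and "\<And>c d. c < d \<Longrightarrow> {c<..<d} \<subseteq> {a..b} - S \<Longrightarrow> \<exists>(m::int) k. \<forall>t\<in>{c<..<d}. g t = of_int m * t + k"
  shows "\<exists>(m::int) (\<delta>::real \<Rightarrow> int). \<forall>t\<in>{a..b}.
    g t = g a + of_int m * (t - a) - (\<Sum>u\<in>S. of_int (\<delta> u) * max 0 (t - u))"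
  using assms
proof (induction S arbitrary: b rule: finite_linorder_max_induct)
  case empty
  have "{a<..<b} \<subseteq> {a..b}" by auto
  then obtain m :: int and k where "\<forall>t\<in>{a<..<b}. g t = of_int m * t + k"
    using empty.prems(4)[OF empty.prems(1)] by auto
  then have *: "g t = g a + of_int m * (t - a)" if "t \<in> {a..b}" for t
    using affine_on_closed_interval[OF empty.prems(1,3) _ that] by blast
  show ?case
  proof (intro exI ballI)
    fix t assume "t \<in> {a..b}"
    from *[OF this] show "g t = g a + of_int m * (t - a) - (\<Sum>u\<in>{}. of_int ((\<lambda>_. 0) u) * max 0 (t - u))"
      by simp
  qed
next
  case (insert c A)
  have c: "a < c" "c < b" using insert.prems by auto
  have "\<exists>(m::int) (\<delta>::real \<Rightarrow> int). \<forall>t\<in>{a..c}.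
    g t = g a + of_int m * (t - a) - (\<Sum>u\<in>A. of_int (\<delta> u) * max 0 (t - u))"
  proof (rule insert.IH)
    show "A \<subseteq> {a<..<c}" using insert.hyps insert.prems by auto
    show "continuous_on {a..c} g" using c by (intro continuous_on_subset[OF insert.prems(3)]) auto
    fix x y :: real assume xy: "x < y" "{x<..<y} \<subseteq> {a..c} - A"
    \<comment> \<open>\<open>c\<close> is the right end of the shorter domain, so an open interval
      through \<open>c\<close> would leave \<open>{a..c}\<close>.\<close>
    have "c \<notin> {x<..<y}"
    proof
      assume "c \<in> {x<..<y}"
      then have "(c + y) / 2 \<in> {x<..<y}" by auto
      with xy have "(c + y) / 2 \<in> {a..c} - A" by blast
      then have "(c + y) / 2 \<le> c" by simp
      with \<open>c \<in> {x<..<y}\<close> show False by auto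
    qed
    then have "{x<..<y} \<subseteq> {a..b} - insert c A" using xy c by auto
    then show "\<exists>(m::int) k. \<forall>t\<in>{x<..<y}. g t = of_int m * t + k"
      by (rule insert.prems(4)[OF xy(1)])
  qed (use c in auto)
  then obtain m :: int and \<delta> :: "real \<Rightarrow> int" where
    m: "\<And>t. t \<in> {a..c} \<Longrightarrow> g t = g a + of_int m * (t - a) - (\<Sum>u\<in>A. of_int (\<delta> u) * max 0 (t - u))"
    by blast
  have "{c<..<b} \<subseteq> {a..b} - insert c A" using insert.hyps c by auto
  then obtain m' :: int and k where "\<forall>t\<in>{c<..<b}. g t = of_int m' * t + k"
    using insert.prems(4)[of c b] c by blast
  moreover have "continuous_on {c..b} g" using c by (intro continuous_on_subset[OF insert.prems(3)]) auto
  ultimately have m': "g t = g c + of_int m' * (t - c)" if "t \<in> {c..b}" for t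
    using affine_on_closed_interval[of c b g "of_int m'" k t] c that by auto
  \<comment> \<open>The new coefficient is the slope just before \<open>c\<close> minus the slope
    \<open>m'\<close> after \<open>c\<close>.\<close>
  define \<delta>' where "\<delta>' = \<delta>(c := m - (\<Sum>u\<in>A. \<delta> u) - m')"
  have cA: "c \<notin> A" using insert.hyps by auto
  have eq: "(\<Sum>u\<in>insert c A. of_int (\<delta>' u) * max 0 (t - u)) =
      of_int (m - (\<Sum>u\<in>A. \<delta> u) - m') * max 0 (t - c) + (\<Sum>u\<in>A. of_int (\<delta> u) * max 0 (t - u))" for t
    using insert.hyps cA by (simp add: \<delta>'_def) (intro sum.cong, auto)
  have "g t = g a + of_int m * (t - a) - (\<Sum>u\<in>insert c A. of_int (\<delta>' u) * max 0 (t - u))"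
    if t: "t \<in> {a..b}" for t
  proof (cases "t \<le> c")
    case True
    then show ?thesis unfolding eq using m[of t] t by simp
  next
    case False
    have "(\<Sum>u\<in>A. of_int (\<delta> u) * max 0 (t - u)) =
        (\<Sum>u\<in>A. of_int (\<delta> u) * max 0 (c - u)) + of_int (\<Sum>u\<in>A. \<delta> u) * (t - c)"
      unfolding of_int_sum sum_distrib_right sum.distrib[symmetric]
      using False insert.hyps(2) by (intro sum.cong refl) (force simp: max_def algebra_simps)
    then show ?thesis
      unfolding eq using m[of c] m'[of t] t False c by (simp add: max_def algebra_simps)
  qed
  then show ?case by blast
qed

text \<open>Up to the next breakpoint \<open>t'\<close> the function is affine, with exactly the
  hinges \<open>u \<le> t\<close> active. The non-strict inequality here, against the strict one for
  the left derivative, is what leaves \<open>\<delta> t\<close> as the divisor coefficient at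
  \<open>t\<close>.\<close>

lemma pl_right_derivative:
  fixes g :: "real \<Rightarrow> real"
  assumes S: "finite S" and t: "0 \<le> t" "t < L"
    and g: "\<And>t. t \<in> {0..L} \<Longrightarrow> g t = c + m * t - (\<Sum>u\<in>S. \<delta> u * max 0 (t - u))"
  shows "vector_derivative g (at_right t) = m - (\<Sum>u\<in>{u\<in>S. u \<le> t}. \<delta> u)"
proof -
  define \<sigma> where "\<sigma> = m - (\<Sum>u\<in>{u\<in>S. u \<le> t}. \<delta> u)"
  define t' where "t' = Min (insert L {u\<in>S. t < u})"
  have fin: "finite (insert L {u\<in>S. t < u})" using S by simp
  have "t' \<in> insert L {u\<in>S. t < u}" unfolding t'_def using fin by (rule Min_in) simp
  then have t': "t < t'" "t' \<le> L" "\<And>u. u \<in> S \<Longrightarrow> u \<le> t \<or> t' \<le> u"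
    using t Min_le[OF fin] unfolding t'_def[symmetric] by (auto simp: not_le intro: leI)
  have eq: "g x = g t + \<sigma> * (x - t)" if x: "x \<in> {t..t'}" for x
  proof -
    have "(\<Sum>u\<in>S. \<delta> u * max 0 (x - u)) = (\<Sum>u\<in>S. \<delta> u * max 0 (t - u) + (if u \<le> t then \<delta> u else 0) * (x - t))"
      using t'(3) x by (intro sum.cong refl) (force simp: max_def algebra_simps)
    also have "\<dots> = (\<Sum>u\<in>S. \<delta> u * max 0 (t - u)) + (\<Sum>u\<in>{u\<in>S. u \<le> t}. \<delta> u) * (x - t)"
      using S by (simp add: sum.distrib sum_distrib_right[symmetric] sum.If_cases Int_def)
    finally show ?thesis
      using g[of x] g[of t] t t' x by (simp add: \<sigma>_def algebra_simps)
  qed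
  have 1: "((\<lambda>x. g t + \<sigma> * (x - t)) has_vector_derivative \<sigma>) (at t within {t..t'})"
    by (auto intro!: derivative_eq_intros simp: has_real_derivative_iff_has_vector_derivative[symmetric])
  have "(g has_vector_derivative \<sigma>) (at t within {t..t'})"
    by (rule has_vector_derivative_transform[OF _ eq 1]) (use t' in simp_all)
  then have "(g has_vector_derivative \<sigma>) (at_right t)"
    using t' by (simp add: at_within_Icc_at_right)
  then show ?thesis
    unfolding \<sigma>_def by (rule vector_derivative_within[rotated]) simp
qed

lemma pl_left_derivative:
  fixes g :: "real \<Rightarrow> real"
  assumes S: "finite S" and t: "0 < t" "t \<le> L"
    and g: "\<And>t. t \<in> {0..L} \<Longrightarrow> g t = c + m * t - (\<Sum>u\<in>S. \<delta> u * max 0 (t - u))"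
  shows "vector_derivative g (at_left t) = m - (\<Sum>u\<in>{u\<in>S. u < t}. \<delta> u)"
proof -
  define \<sigma> where "\<sigma> = m - (\<Sum>u\<in>{u\<in>S. u < t}. \<delta> u)"
  define t' where "t' = Max (insert 0 {u\<in>S. u < t})"
  have fin: "finite (insert 0 {u\<in>S. u < t})" using S by simp
  have "t' \<in> insert 0 {u\<in>S. u < t}" unfolding t'_def using fin by (rule Max_in) simp
  then have t': "t' < t" "0 \<le> t'" "\<And>u. u \<in> S \<Longrightarrow> t \<le> u \<or> u \<le> t'"
    using t Max_ge[OF fin] unfolding t'_def[symmetric] by (auto simp: not_le intro: leI)
  have eq: "g x = g t + \<sigma> * (x - t)" if x: "x \<in> {t'..t}" for x
  proof -
    have "(\<Sum>u\<in>S. \<delta> u * max 0 (x - u)) = (\<Sum>u\<in>S. \<delta> u * max 0 (t - u) + (if u < t then \<delta> u else 0) * (x - t))"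
      using t'(3) x by (intro sum.cong refl) (force simp: max_def algebra_simps)
    also have "\<dots> = (\<Sum>u\<in>S. \<delta> u * max 0 (t - u)) + (\<Sum>u\<in>{u\<in>S. u < t}. \<delta> u) * (x - t)"
      using S by (simp add: sum.distrib sum_distrib_right[symmetric] sum.If_cases Int_def)
    finally show ?thesis
      using g[of x] g[of t] t t' x by (simp add: \<sigma>_def algebra_simps)
  qed
  have 1: "((\<lambda>x. g t + \<sigma> * (x - t)) has_vector_derivative \<sigma>) (at t within {t'..t})"
    by (auto intro!: derivative_eq_intros simp: has_real_derivative_iff_has_vector_derivative[symmetric])
  have "(g has_vector_derivative \<sigma>) (at t within {t'..t})"
    by (rule has_vector_derivative_transform[OF _ eq 1]) (use t' in simp_all)
  then have "(g has_vector_derivative \<sigma>) (at_left t)"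
    using t' by (simp add: at_within_Icc_at_left)
  then show ?thesis
    unfolding \<sigma>_def by (rule vector_derivative_within[rotated]) simp
qed

lemma integral_pl_on_representation:
  assumes S: "finite S"
    and g: "\<And>t. t \<in> {0..L} \<Longrightarrow> g t = c + of_int m * t - (\<Sum>u\<in>S. of_int (\<delta> u :: int) * max 0 (t - u))"
  shows "integral_pl_on L g"
  unfolding integral_pl_on_def
proof (intro conjI exI[of _ S] allI impI)
  have "continuous_on {0..L} (\<lambda>t. c + of_int m * t - (\<Sum>u\<in>S. of_int (\<delta> u) * max 0 (t - u)))"
    by (intro continuous_intros)
  then show "continuous_on {0..L} g"
    by (rule iffD1[OF continuous_on_cong, rotated -1]) (simp_all add: g)
  fix a b :: real assume ab: "a < b \<and> {a<..<b} \<subseteq> {0..L} - S"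
  have "u \<notin> {a<..<b}" if "u \<in> S" for u using ab that by blast
  then have "u \<le> a \<or> b \<le> u" if "u \<in> S" for u using that by force
  then have eq: "(\<Sum>u\<in>S. of_int (\<delta> u) * max 0 (t - u)) = (\<Sum>u\<in>S. (if u \<le> a then of_int (\<delta> u) * (t - u) else 0))"
    if "t \<in> {a<..<b}" for t :: real
    using that by (intro sum.cong refl) (force simp: max_def)
  have "g t = of_int (m - (\<Sum>u\<in>{u\<in>S. u \<le> a}. \<delta> u)) * t + (c + (\<Sum>u\<in>{u\<in>S. u \<le> a}. of_int (\<delta> u) * u))"
    if "t \<in> {a<..<b}" for t
  proof -
    have "t \<in> {0..L}" using ab that by blast
    then show ?thesis
      using g[of t] eq[OF that] S
      by (simp add: sum.If_cases Int_def right_diff_distrib sum_subtractf sum_distrib_right sum_distrib_left algebra_simps)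
  qed
  then show "\<exists>(m::int) c. \<forall>t\<in>{a<..<b}. g t = of_int m * t + c" by blast
qed (rule S)

lemma integral_pl_onE:
  assumes "integral_pl_on L g" "0 < L"
  obtains S and m :: int and \<delta> :: "real \<Rightarrow> int" where "finite S" "S \<subseteq> {0<..<L}"
    "\<And>t. t \<in> {0..L} \<Longrightarrow> g t = g 0 + of_int m * t - (\<Sum>u\<in>S. of_int (\<delta> u) * max 0 (t - u))"
proof -
  from assms(1) obtain S where S: "finite S" "continuous_on {0..L} g"
    "\<And>a b. a < b \<and> {a<..<b} \<subseteq> {0..L} - S \<Longrightarrow> \<exists>(m::int) c. \<forall>t\<in>{a<..<b}. g t = of_int m * t + c"
    unfolding integral_pl_on_def by blast
  have "\<exists>(m::int) (\<delta>::real \<Rightarrow> int). \<forall>t\<in>{0..L}.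
    g t = g 0 + of_int m * (t - 0) - (\<Sum>u\<in>S \<inter> {0<..<L}. of_int (\<delta> u) * max 0 (t - u))"
  proof (rule integral_pl_representation)
    fix c d :: real assume cd: "c < d" "{c<..<d} \<subseteq> {0..L} - S \<inter> {0<..<L}"
    have "x \<in> {0<..<L}" if x: "x \<in> {c<..<d}" for x
    proof -
      have "(c + x) / 2 \<in> {c<..<d}" "(x + d) / 2 \<in> {c<..<d}" using x by auto
      then have "(c + x) / 2 \<in> {0..L}" "(x + d) / 2 \<in> {0..L}" using cd by blast+
      then show ?thesis using x by auto
    qed
    then show "\<exists>(m::int) k. \<forall>t\<in>{c<..<d}. g t = of_int m * t + k"
      using cd by (intro S(3)) auto
  qed (use S(1,2) assms(2) in auto)
  then obtain m :: int and \<delta> :: "real \<Rightarrow> int" where m: "\<forall>t\<in>{0..L}.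
    g t = g 0 + of_int m * (t - 0) - (\<Sum>u\<in>S \<inter> {0<..<L}. of_int (\<delta> u) * max 0 (t - u))" by blast
  show thesis
    by (rule that[of "S \<inter> {0<..<L}" m \<delta>]) (use S(1) m[unfolded diff_zero] in blast)+
qed

lemma edge_point_interior [simp]:
  "0 < t \<Longrightarrow> t < edge_length \<Gamma> e \<Longrightarrow> edge_point \<Gamma> e t = Interior e t"
  by (simp add: edge_point_def)

lemma div_at_representation:
  assumes G: "fin_digraph (curve_graph \<Gamma>)" and L: "\<And>e. e \<in> arcs (curve_graph \<Gamma>) \<Longrightarrow> 0 < edge_length \<Gamma> e"
    and S: "\<And>e. e \<in> arcs (curve_graph \<Gamma>) \<Longrightarrow> finite (S e) \<and> S e \<subseteq> {0<..<edge_length \<Gamma> e}"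
    and f: "\<And>e t. e \<in> arcs (curve_graph \<Gamma>) \<Longrightarrow> t \<in> {0..edge_length \<Gamma> e} \<Longrightarrow>
      f (edge_point \<Gamma> e t) = c e + m e * t - (\<Sum>u\<in>S e. \<delta> e u * max 0 (t - u))"
  shows "e \<in> arcs (curve_graph \<Gamma>) \<Longrightarrow> 0 < t \<Longrightarrow> t < edge_length \<Gamma> e \<Longrightarrow>
      div_at \<Gamma> f (Interior e t) = (if t \<in> S e then \<delta> e t else 0)"
    and "div_at \<Gamma> f (Vertex v) = (\<Sum>e\<in>in_arcs (curve_graph \<Gamma>) v. m e - (\<Sum>u\<in>S e. \<delta> e u)) -
      (\<Sum>e\<in>out_arcs (curve_graph \<Gamma>) v. m e)"
proof -
  assume e: "e \<in> arcs (curve_graph \<Gamma>)" and t: "0 < t" "t < edge_length \<Gamma> e"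
  have "div_at \<Gamma> f (Interior e t) = (\<Sum>u\<in>{u\<in>S e. u \<le> t}. \<delta> e u) - (\<Sum>u\<in>{u\<in>S e. u < t}. \<delta> e u)"
    using t pl_right_derivative[OF conjunct1[OF S[OF e]] less_imp_le[OF t(1)] t(2) f[OF e]]
      pl_left_derivative[OF conjunct1[OF S[OF e]] t(1) less_imp_le[OF t(2)] f[OF e]]
    unfolding div_at_def by simp
  also have "{u\<in>S e. u \<le> t} = (if t \<in> S e then insert t {u\<in>S e. u < t} else {u\<in>S e. u < t})"
    by (auto simp: order_le_less)
  finally show "div_at \<Gamma> f (Interior e t) = (if t \<in> S e then \<delta> e t else 0)"
    using S[OF e] by (auto split: if_splits)
next
  have 1: "vector_derivative (\<lambda>u. f (edge_point \<Gamma> e u)) (at_left (edge_length \<Gamma> e)) = m e - (\<Sum>u\<in>S e. \<delta> e u)"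
    if e: "e \<in> arcs (curve_graph \<Gamma>)" for e
  proof -
    have *: "{u \<in> S e. u < edge_length \<Gamma> e} = S e" using S[OF e] by auto
    show ?thesis
      by (subst pl_left_derivative[OF _ _ _ f[OF e]]) (use S[OF e] L[OF e] * in auto)
  qed
  have 2: "vector_derivative (\<lambda>u. f (edge_point \<Gamma> e u)) (at_right 0) = m e"
    if e: "e \<in> arcs (curve_graph \<Gamma>)" for e
  proof -
    have *: "{u \<in> S e. u \<le> 0} = {}" using S[OF e] by force
    show ?thesis
      by (subst pl_right_derivative[OF _ _ _ f[OF e]]) (use S[OF e] L[OF e] in \<open>auto simp: *\<close>)
  qed
  show "div_at \<Gamma> f (Vertex v) = (\<Sum>e\<in>in_arcs (curve_graph \<Gamma>) v. m e - (\<Sum>u\<in>S e. \<delta> e u)) -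
      (\<Sum>e\<in>out_arcs (curve_graph \<Gamma>) v. m e)"
    unfolding div_at_def by (simp add: 1 2 sum_negf)
qed

lemma wsum_edge:
  assumes D: "D \<in> divisors \<Gamma>" and S: "finite S"
    and "\<And>t. 0 < t \<Longrightarrow> t < edge_length \<Gamma> e \<Longrightarrow> Poly_Mapping.lookup D (Interior e t) = (if t \<in> S then \<delta> t else 0)"
    and "S \<subseteq> {0<..<edge_length \<Gamma> e}"
  shows "wsum (\<lambda>p. case p of Vertex _ \<Rightarrow> 0 | Interior e' t \<Rightarrow> if e' = e then h t else 0) D =
    (\<Sum>u\<in>S. h u * of_int (\<delta> u))"
proof -
  let ?w = "\<lambda>p. case p of Vertex _ \<Rightarrow> 0 | Interior e' t \<Rightarrow> if e' = e then h t else 0"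
  have "wsum ?w D = (\<Sum>p\<in>Poly_Mapping.keys D \<union> Interior e ` S. ?w p * of_int (Poly_Mapping.lookup D p))"
    using S by (intro wsum_superset) auto
  also have "\<dots> = (\<Sum>p\<in>Interior e ` S. ?w p * of_int (Poly_Mapping.lookup D p))"
  proof (intro sum.mono_neutral_right ballI)
    fix p assume p: "p \<in> (Poly_Mapping.keys D \<union> Interior e ` S) - Interior e ` S"
    then have "p \<in> points \<Gamma>" using D by (auto simp: divisors_def)
    then consider v where "p = Vertex v"
      | e' t where "p = Interior e' t" "0 < t" "t < edge_length \<Gamma> e'" by (auto simp: points_def)
    then show "?w p * of_int (Poly_Mapping.lookup D p) = 0"
      by cases (use p assms(3) in \<open>auto split: if_splits\<close>)
  qed (use S in auto)
  also have "\<dots> = (\<Sum>u\<in>S. h u * of_int (\<delta> u))"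
    using assms by (subst sum.reindex) (auto intro!: sum.cong simp: inj_on_def)
  finally show ?thesis .
qed

lemma head_degree_divisor:
  assumes G: "fin_digraph (curve_graph \<Gamma>)" and D: "D \<in> divisors \<Gamma>"
  shows "head_degree (curve_graph \<Gamma>) v D = of_int (Poly_Mapping.lookup D (Vertex v)) +
    (\<Sum>e\<in>in_arcs (curve_graph \<Gamma>) v. wsum (\<lambda>p. case p of Vertex _ \<Rightarrow> 0 | Interior e' t \<Rightarrow> if e' = e then 1 else 0) D)"
proof -
  interpret fin_digraph "curve_graph \<Gamma>" by fact
  have "head_degree (curve_graph \<Gamma>) v D = wsum (\<lambda>p. (if p = Vertex v then 1 else 0) +
     (\<Sum>e\<in>in_arcs (curve_graph \<Gamma>) v. case p of Vertex _ \<Rightarrow> 0 | Interior e' t \<Rightarrow> if e' = e then 1 else 0)) D"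
    unfolding head_degree_def
  proof (rule wsum_cong)
    fix p assume "p \<in> Poly_Mapping.keys D"
    then have "p \<in> points \<Gamma>" using D by (auto simp: divisors_def)
    then show "(if head_point (curve_graph \<Gamma>) p = v then 1 else 0) = (if p = Vertex v then 1 else 0) +
     (\<Sum>e\<in>in_arcs (curve_graph \<Gamma>) v. case p of Vertex _ \<Rightarrow> 0 | Interior e' t \<Rightarrow> if e' = e then 1 else (0::real))"
      by (auto simp: points_def sum.delta'[OF finite_in_arcs])
  qed
  then show ?thesis by (simp add: wsum_weight_add wsum_weight_sum wsum_indicator)
qed

text \<open>Both sides carry the same data. The hinges of \<open>f\<close> on \<open>e\<close> are
  the chips of \<open>D\<close> inside \<open>e\<close>, \<open>m e\<close> is the slope at the
  tail, and the hinge formula at the head of \<open>e\<close> is the equation for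
  \<open>\<phi>\<close>. At a vertex the slope arriving along \<open>e\<close> is \<open>m e\<close>
  minus the number of chips inside \<open>e\<close>; once these chips are moved to the head, the
  divisor becomes the net inflow of \<open>m\<close>.\<close>

lemma principal_iff_abel_rel:
  assumes G: "fin_digraph (curve_graph \<Gamma>)" and L: "\<And>e. e \<in> arcs (curve_graph \<Gamma>) \<Longrightarrow> 0 < edge_length \<Gamma> e"
    and D: "D \<in> divisors \<Gamma>"
  shows "(\<exists>f. rational_function \<Gamma> f \<and> (\<forall>p\<in>points \<Gamma>. of_int (Poly_Mapping.lookup D p) = div_at \<Gamma> f p)) \<longleftrightarrow>
    curve_rel \<Gamma> D (\<lambda>_. 0)"
proof
  let ?G = "curve_graph \<Gamma>" and ?L = "edge_length \<Gamma>"
  assume "\<exists>f. rational_function \<Gamma> f \<and> (\<forall>p\<in>points \<Gamma>. of_int (Poly_Mapping.lookup D p) = div_at \<Gamma> f p)"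
  then obtain f where f: "rational_function \<Gamma> f"
    and Df: "\<And>p. p \<in> points \<Gamma> \<Longrightarrow> of_int (Poly_Mapping.lookup D p) = div_at \<Gamma> f p" by blast
  define P where "P = (\<lambda>e S (m::int) (\<delta>::real \<Rightarrow> int). finite S \<and> S \<subseteq> {0<..<?L e} \<and> (\<forall>t\<in>{0..?L e}.
      f (edge_point \<Gamma> e t) = f (edge_point \<Gamma> e 0) + of_int m * t - (\<Sum>u\<in>S. of_int (\<delta> u) * max 0 (t - u))))"
  have "\<exists>S m \<delta>. P e S m \<delta>" if e: "e \<in> arcs ?G" for e
  proof -
    have "integral_pl_on (?L e) (\<lambda>t. f (edge_point \<Gamma> e t))"
      using f e by (auto simp: rational_function_def)
    then show ?thesis by (rule integral_pl_onE[OF _ L[OF e]]) (unfold P_def, blast)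
  qed
  then have "\<forall>e\<in>arcs ?G. \<exists>x. P e (fst x) (fst (snd x)) (snd (snd x))" by auto
  from bchoice[OF this] obtain F where
    F: "\<forall>e\<in>arcs ?G. P e (fst (F e)) (fst (snd (F e))) (snd (snd (F e)))" ..
  then obtain S and m :: "_ \<Rightarrow> int" and \<delta> :: "_ \<Rightarrow> real \<Rightarrow> int" where
    S: "\<And>e. e \<in> arcs ?G \<Longrightarrow> finite (S e) \<and> S e \<subseteq> {0<..<?L e}" and
    fe: "\<And>e t. e \<in> arcs ?G \<Longrightarrow> t \<in> {0..?L e} \<Longrightarrow>
      f (edge_point \<Gamma> e t) = f (edge_point \<Gamma> e 0) + of_int (m e) * t - (\<Sum>u\<in>S e. of_int (\<delta> e u) * max 0 (t - u))"
    using that[of "\<lambda>e. fst (F e)" "\<lambda>e. fst (snd (F e))" "\<lambda>e. snd (snd (F e))"] F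
    unfolding P_def by blast
  have div1: "div_at \<Gamma> f (Interior e t) = (if t \<in> S e then of_int (\<delta> e t) else 0)"
    if "e \<in> arcs ?G" "0 < t" "t < ?L e" for e t
    by (rule div_at_representation(1)[OF G L S fe]) (use that in auto)
  have div2: "div_at \<Gamma> f (Vertex v) = (\<Sum>e\<in>in_arcs ?G v. of_int (m e) - (\<Sum>u\<in>S e. of_int (\<delta> e u))) -
      (\<Sum>e\<in>out_arcs ?G v. of_int (m e))" for v
    by (rule div_at_representation(2)[OF G L S fe]) auto
  have lookup_int: "Poly_Mapping.lookup D (Interior e t) = (if t \<in> S e then \<delta> e t else 0)"
    if "e \<in> arcs ?G" "0 < t" "t < ?L e" for e t
  proof -
    have "Interior e t \<in> points \<Gamma>" using that by (auto simp: points_def)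
    from Df[OF this] div1[OF that] show ?thesis by (auto split: if_splits)
  qed
  have w: "wsum (\<lambda>p. case p of Vertex _ \<Rightarrow> 0 | Interior e' t \<Rightarrow> if e' = e then h t else 0) D =
    (\<Sum>u\<in>S e. h u * of_int (\<delta> e u))" if "e \<in> arcs ?G" for e h
    using wsum_edge[OF D, of "S e" e "\<delta> e" h] S[OF that] lookup_int[OF that] by auto
  show "curve_rel \<Gamma> D (\<lambda>_. 0)"
  proof (rule abel_relI[of _ "\<lambda>v. f (Vertex v)" m])
    fix e assume e: "e \<in> arcs ?G"
    have "edge_moment (\<lambda>e t. ?L e - t) e D = (\<Sum>u\<in>S e. of_int (\<delta> e u) * max 0 (?L e - u))"
      unfolding edge_moment_def w[OF e] using S[OF e]
      by (intro sum.cong) (auto simp: max_def mult.commute)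
    then show "f (Vertex (head ?G e)) - f (Vertex (tail ?G e)) =
        of_int (m e) * ?L e - edge_moment (\<lambda>e t. ?L e - t) e D - 0"
      using fe[OF e, of "?L e"] L[OF e] by (simp add: edge_point_def)
  next
    fix v assume v: "v \<in> verts ?G"
    have "Vertex v \<in> points \<Gamma>" using v by (auto simp: points_def)
    from Df[OF this] div2[of v] have 
      "real_of_int (Poly_Mapping.lookup D (Vertex v)) =
        (\<Sum>e\<in>in_arcs ?G v. of_int (m e) - (\<Sum>u\<in>S e. of_int (\<delta> e u))) - (\<Sum>e\<in>out_arcs ?G v. of_int (m e))"
      by simp
    then show "head_degree ?G v D = of_int (net_inflow ?G m v)"
      unfolding head_degree_divisor[OF G D] by (simp add: w net_inflow_def sum_subtractf)
  qed
next
  let ?G = "curve_graph \<Gamma>" and ?L = "edge_length \<Gamma>"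
  assume "curve_rel \<Gamma> D (\<lambda>_. 0)"
  then obtain \<phi> m where \<phi>: "\<And>e. e \<in> arcs ?G \<Longrightarrow>
      \<phi> (head ?G e) - \<phi> (tail ?G e) = of_int (m e) * ?L e - edge_moment (\<lambda>e t. ?L e - t) e D - 0"
    and m: "\<And>v. v \<in> verts ?G \<Longrightarrow> head_degree ?G v D = of_int (net_inflow ?G m v)"
    by (rule abel_relE) blast
  define S where "S = (\<lambda>e. {t. Interior e t \<in> Poly_Mapping.keys D})"
  define \<delta> where "\<delta> = (\<lambda>e t. Poly_Mapping.lookup D (Interior e t))"
  have S: "finite (S e) \<and> S e \<subseteq> {0<..<?L e}" if "e \<in> arcs ?G" for e
  proof
    have "finite (Interior e -` Poly_Mapping.keys D)"
      by (rule finite_vimageI) (auto simp: inj_on_def)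
    then show "finite (S e)" by (simp add: S_def vimage_def)
    show "S e \<subseteq> {0<..<?L e}" using D by (auto simp: S_def divisors_def points_def)
  qed
  have w: "wsum (\<lambda>p. case p of Vertex _ \<Rightarrow> 0 | Interior e' t \<Rightarrow> if e' = e then h t else 0) D =
    (\<Sum>u\<in>S e. h u * of_int (\<delta> e u))" if "e \<in> arcs ?G" for e h
    using wsum_edge[OF D, of "S e" e "\<delta> e" h] S[OF that] by (auto simp: S_def \<delta>_def in_keys_iff)
  have mom: "edge_moment (\<lambda>e t. ?L e - t) e D = (\<Sum>u\<in>S e. of_int (\<delta> e u) * max 0 (?L e - u))"
    if e: "e \<in> arcs ?G" for e
    unfolding edge_moment_def w[OF e] using S[OF e] by (intro sum.cong) (auto simp: max_def mult.commute)
  define g where "g = (\<lambda>e t. \<phi> (tail ?G e) + of_int (m e) * t - (\<Sum>u\<in>S e. of_int (\<delta> e u) * max 0 (t - u)))"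
  define f where "f = (\<lambda>p. case p of Vertex v \<Rightarrow> \<phi> v | Interior e t \<Rightarrow> g e t)"
  have fe: "f (edge_point \<Gamma> e t) = \<phi> (tail ?G e) + of_int (m e) * t - (\<Sum>u\<in>S e. of_int (\<delta> e u) * max 0 (t - u))"
    if e: "e \<in> arcs ?G" and t: "t \<in> {0..?L e}" for e t
  proof -
    consider "t = 0" | "t = ?L e" "t > 0" | "0 < t" "t < ?L e" using t by force
    then show ?thesis
    proof cases
      case 1
      then have "(\<Sum>u\<in>S e. of_int (\<delta> e u) * max 0 (t - u)) = 0"
        using S[OF e] by (intro sum.neutral) (auto simp: max_def)
      then show ?thesis using 1 by (simp add: edge_point_def f_def)
    next
      case 2
      then show ?thesis using \<phi>[OF e] mom[OF e] by (simp add: edge_point_def f_def)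
    next
      case 3
      then show ?thesis by (simp add: f_def g_def)
    qed
  qed
  have "rational_function \<Gamma> f"
    unfolding rational_function_def
  proof
    fix e assume e: "e \<in> arcs ?G"
    show "integral_pl_on (?L e) (\<lambda>t. f (edge_point \<Gamma> e t))"
      by (rule integral_pl_on_representation[OF conjunct1[OF S[OF e]] fe[OF e]])
  qed
  moreover have "of_int (Poly_Mapping.lookup D p) = div_at \<Gamma> f p" if p: "p \<in> points \<Gamma>" for p
  proof -
    have div1: "div_at \<Gamma> f (Interior e t) = (if t \<in> S e then of_int (\<delta> e t) else 0)"
      if "e \<in> arcs ?G" "0 < t" "t < ?L e" for e t
      by (rule div_at_representation(1)[OF G L S fe]) (use that in auto)
    have div2: "div_at \<Gamma> f (Vertex v) = (\<Sum>e\<in>in_arcs ?G v. of_int (m e) - (\<Sum>u\<in>S e. of_int (\<delta> e u))) -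
        (\<Sum>e\<in>out_arcs ?G v. of_int (m e))" for v
      by (rule div_at_representation(2)[OF G L S fe]) auto
    from p consider v where "p = Vertex v" "v \<in> verts ?G"
      | e t where "p = Interior e t" "e \<in> arcs ?G" "0 < t" "t < ?L e"
      by (auto simp: points_def)
    then show ?thesis
    proof cases
      case 1
      show ?thesis
        using m[OF 1(2)] unfolding 1 head_degree_divisor[OF G D] 
        by (simp add: div2 w net_inflow_def sum_subtractf)
    next
      case 2
      then show ?thesis using div1[OF 2(2-4)] by (auto simp: S_def \<delta>_def in_keys_iff)
    qed
  qed
  ultimately show "\<exists>f. rational_function \<Gamma> f \<and> (\<forall>p\<in>points \<Gamma>. of_int (Poly_Mapping.lookup D p) = div_at \<Gamma> f p)"
    by blast
qed

lemma lin_equiv_iff: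
  assumes "fin_digraph (curve_graph \<Gamma>)" "\<And>e. e \<in> arcs (curve_graph \<Gamma>) \<Longrightarrow> 0 < edge_length \<Gamma> e"
  shows "(D, D') \<in> lin_equiv \<Gamma> \<longleftrightarrow> D \<in> divisors \<Gamma> \<and> D' \<in> divisors \<Gamma> \<and> curve_rel \<Gamma> (D' - D) (\<lambda>_. 0)"
  using principal_iff_abel_rel[OF assms, of "D' - D"] divisors_diff[of D' \<Gamma> D]
  unfolding lin_equiv_def by blast


section \<open>The Abel--Jacobi identification\<close>

lemma keys_diff_subset:
  "Poly_Mapping.keys D \<subseteq> X \<Longrightarrow> Poly_Mapping.keys E \<subseteq> X \<Longrightarrow> Poly_Mapping.keys (D - E) \<subseteq> X"
  for D E :: "'a \<Rightarrow>\<^sub>0 int"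
  using keys_diff[of D E] by blast

lemma keys_sum_subset:
  fixes f :: "'i \<Rightarrow> 'a \<Rightarrow>\<^sub>0 int"
  assumes "\<And>i. i \<in> I \<Longrightarrow> Poly_Mapping.keys (f i) \<subseteq> X"
  shows "Poly_Mapping.keys (\<Sum>i\<in>I. f i) \<subseteq> X"
  using assms
proof (induction I rule: infinite_finite_induct)
  case (insert i I)
  then show ?case using Poly_Mapping.keys_add[of "f i" "\<Sum>i\<in>I. f i"] by auto
qed auto

lemma lookup_frag_extend_general:
  "Poly_Mapping.lookup (frag_extend f D) q =
    (\<Sum>p\<in>Poly_Mapping.keys D. Poly_Mapping.lookup D p * Poly_Mapping.lookup (f p) q)"
  by (simp add: frag_extend_def lookup_sum)

lemma wsum_frag_extend: "wsum w (frag_extend f D) = wsum (\<lambda>p. wsum w (f p)) D"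
  by (simp add: frag_extend_def) (simp add: wsum_def mult.commute)

lemma frag_extend_frag_extend: "frag_extend f (frag_extend g D) = frag_extend (\<lambda>p. frag_extend f (g p)) D"
  by (simp add: frag_extend_def[of g] frag_extend_sum frag_extend_cmul comp_def)
     (simp add: frag_extend_def)

lemma (in fin_digraph) net_inflow_delta:
  assumes "e \<in> arcs G"
  shows "net_inflow G (\<lambda>e'. if e' = e then c else 0) v =
    (if head G e = v then c else 0) - (if tail G e = v then c else 0)"
  using assms by (auto simp: net_inflow_def sum.delta[OF finite_in_arcs] sum.delta[OF finite_out_arcs])

definition chain_length :: "'e chain \<Rightarrow> 'e \<Rightarrow> real" where
  "chain_length c e = wsum (\<lambda>(e', a, b). if e' = e then b - a else 0) c"

lemma chain_pairing_eq:
  assumes "finite (arcs (curve_graph \<Gamma>))" "c \<in> int_chains \<Gamma>"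
  shows "chain_pairing c z = (\<Sum>e\<in>arcs (curve_graph \<Gamma>). chain_length c e * z e)"
proof -
  have "chain_pairing c z = wsum (\<lambda>(e, a, b). (b - a) * z e) c"
    by (auto simp: chain_pairing_def wsum_def intro!: sum.cong)
  also have "\<dots> = wsum (\<lambda>q. \<Sum>e\<in>arcs (curve_graph \<Gamma>). z e * (case q of (e', a, b) \<Rightarrow> if e' = e then b - a else 0)) c"
    using assms by (intro wsum_cong)
      (auto simp: int_chains_def if_distrib[of "\<lambda>x. _ * x"] mult.commute cong: if_cong)
  also have "\<dots> = (\<Sum>e\<in>arcs (curve_graph \<Gamma>). chain_length c e * z e)"
    by (simp add: wsum_weight_sum wsum_weight_mult chain_length_def mult.commute)
  finally show ?thesis .
qed

section \<open>Chains, cycles and divisor classes on a metric graph\<close>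

locale metric_graph =
  fixes \<Gamma> :: "('v, 'e) tropical_curve"
  assumes fin_graph: "fin_digraph (curve_graph \<Gamma>)"
    and length_pos: "\<And>e. e \<in> arcs (curve_graph \<Gamma>) \<Longrightarrow> 0 < edge_length \<Gamma> e"
begin

sublocale fin_digraph "curve_graph \<Gamma>"
  by (rule fin_graph)

lemma head_point_in_verts: "p \<in> points \<Gamma> \<Longrightarrow> head_point (curve_graph \<Gamma>) p \<in> verts (curve_graph \<Gamma>)"
  by (auto simp: points_def)

lemma edge_point_in_points: "e \<in> arcs (curve_graph \<Gamma>) \<Longrightarrow> edge_point \<Gamma> e t \<in> points \<Gamma>"
  by (auto simp: edge_point_def points_def)

lemma lin_equiv_iff_curve_rel:
  "(D, D') \<in> lin_equiv \<Gamma> \<longleftrightarrow> D \<in> divisors \<Gamma> \<and> D' \<in> divisors \<Gamma> \<and> curve_rel \<Gamma> (D' - D) (\<lambda>_. 0)"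
  by (rule lin_equiv_iff[OF fin_graph length_pos])

lemma curve_rel_segment_to_head:
  assumes e: "e \<in> arcs (curve_graph \<Gamma>)" and a: "0 \<le> a" "a \<le> edge_length \<Gamma> e"
  shows "curve_rel \<Gamma> (frag_of (Vertex (head (curve_graph \<Gamma>) e)) - frag_of (edge_point \<Gamma> e a))
    (\<lambda>e'. if e = e' then edge_length \<Gamma> e - a else 0)"
proof -
  consider "a = 0" | "a = edge_length \<Gamma> e" "0 < a" | "0 < a" "a < edge_length \<Gamma> e"
    using a by force
  then show ?thesis
  proof cases
    \<comment> \<open>At \<open>a = 0\<close> the point is the tail vertex, whose
      \<open>head_point\<close> is the tail itself; slope 1 along \<open>e\<close> makes up for the
      difference.\<close>
    case 1
    then show ?thesis
      by (intro abel_relI[of _ "\<lambda>_. 0" "\<lambda>e'. if e' = e then 1 else 0"])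
         (auto simp: edge_point_def net_inflow_delta[OF e])
  next
    case 2
    then show ?thesis
      by (intro abel_relI[of _ "\<lambda>_. 0" "\<lambda>_. 0"]) (auto simp: edge_point_def)
  next
    case 3
    then show ?thesis
      by (intro abel_relI[of _ "\<lambda>_. 0" "\<lambda>_. 0"]) auto
  qed
qed

lemma curve_rel_boundary:
  assumes "c \<in> int_chains \<Gamma>"
  shows "curve_rel \<Gamma> (boundary \<Gamma> c) (chain_length c)"
proof -
  let ?f = "\<lambda>(e, a, b). frag_of (edge_point \<Gamma> e b) - frag_of (edge_point \<Gamma> e a)"
  let ?y = "\<lambda>(e', a, b) e. if e' = e then b - a else (0::real)"
  have "curve_rel \<Gamma> (?f q) (?y q)" if "q \<in> Poly_Mapping.keys c" for q
  proof -
    obtain e a b where q: "q = (e, a, b)" by (cases q)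
    then have *: "e \<in> arcs (curve_graph \<Gamma>)" "0 \<le> a" "a \<le> b" "b \<le> edge_length \<Gamma> e"
      using assms that by (auto simp: int_chains_def)
    have "curve_rel \<Gamma> (?f q) (\<lambda>e'. (if e = e' then edge_length \<Gamma> e - a else 0) - (if e = e' then edge_length \<Gamma> e - b else 0))"
      using abel_rel_diff[OF curve_rel_segment_to_head[of e a] curve_rel_segment_to_head[of e b]] *
      by (simp add: q)
    then show ?thesis by (rule iffD1[OF abel_rel_cong, rotated]) (simp add: q)
  qed
  from abel_rel_frag_extend[of c _ _ _ ?f ?y, OF this]
  have "curve_rel \<Gamma> (boundary \<Gamma> c) (\<lambda>e. \<Sum>q\<in>Poly_Mapping.keys c. of_int (Poly_Mapping.lookup c q) * ?y q e)"
    by (simp add: boundary_def)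
  then show ?thesis
    by (rule iffD1[OF abel_rel_cong, rotated])
       (auto simp: chain_length_def wsum_def mult.commute intro!: sum.cong)
qed

text \<open>The chain runs \<open>m e\<close> times along every edge and then back from the heads to
  the interior points of \<open>D\<close>. By the condition on \<open>m\<close>, the boundary of the
  first part is \<open>D\<close> with all its chips moved to the heads.\<close>

lemma curve_rel_chain_exists:
  assumes D: "D \<in> divisors \<Gamma>"
    and m: "\<And>v. v \<in> verts (curve_graph \<Gamma>) \<Longrightarrow> head_degree (curve_graph \<Gamma>) v D = of_int (net_inflow (curve_graph \<Gamma>) m v)"
  obtains c where "c \<in> int_chains \<Gamma>" "boundary \<Gamma> c = D"
    "\<And>e. e \<in> arcs (curve_graph \<Gamma>) \<Longrightarrow> chain_length c e =
      of_int (m e) * edge_length \<Gamma> e - edge_moment (\<lambda>e t. edge_length \<Gamma> e - t) e D"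
proof -
  let ?G = "curve_graph \<Gamma>" and ?L = "edge_length \<Gamma>"
  define seg :: "('v, 'e) point \<Rightarrow> 'e chain" where "seg = (\<lambda>p. case p of Vertex _ \<Rightarrow> 0 | Interior e t \<Rightarrow> frag_of (e, t, ?L e))"
  define c where "c = (\<Sum>e\<in>arcs ?G. frag_cmul (m e) (frag_of (e, 0, ?L e))) - frag_extend seg D"
  have keysD: "Poly_Mapping.keys D \<subseteq> points \<Gamma>" using D by (simp add: divisors_def)
  have c1: "c \<in> int_chains \<Gamma>"
    unfolding int_chains_def c_def mem_Collect_eq
  proof (intro keys_diff_subset keys_sum_subset)
    fix e assume "e \<in> arcs ?G"
    then show "Poly_Mapping.keys (frag_cmul (m e) (frag_of (e, 0, ?L e)))
      \<subseteq> {(e, a, b). e \<in> arcs ?G \<and> 0 \<le> a \<and> a \<le> b \<and> b \<le> ?L e}"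
      using length_pos[of e] keys_cmul[of "m e" "frag_of (e, 0, ?L e)"] by auto
  next
    have "Poly_Mapping.keys (seg p) \<subseteq> {(e, a, b). e \<in> arcs ?G \<and> 0 \<le> a \<and> a \<le> b \<and> b \<le> ?L e}"
      if "p \<in> Poly_Mapping.keys D" for p
    proof -
      have "p \<in> points \<Gamma>" using keysD that by blast
      then show ?thesis by (auto simp: seg_def points_def)
    qed
    then show "Poly_Mapping.keys (frag_extend seg D) \<subseteq> {(e, a, b). e \<in> arcs ?G \<and> 0 \<le> a \<and> a \<le> b \<and> b \<le> ?L e}"
      using keys_frag_extend[of seg D] by blast
  qed
  have bseg: "boundary \<Gamma> (seg p) = frag_of (Vertex (head_point ?G p)) - frag_of p"
    if "p \<in> Poly_Mapping.keys D" for p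
  proof -
    have "p \<in> points \<Gamma>" using keysD that by blast
    then show ?thesis
      by (auto simp: seg_def points_def boundary_def edge_point_def)
  qed
  have "boundary \<Gamma> c = (\<Sum>e\<in>arcs ?G. frag_cmul (m e) (frag_of (Vertex (head ?G e)) - frag_of (Vertex (tail ?G e)))) -
      frag_extend (\<lambda>p. boundary \<Gamma> (seg p)) D"
    unfolding c_def boundary_def frag_extend_diff frag_extend_frag_extend
    by (simp add: frag_extend_sum frag_extend_cmul comp_def edge_point_def)
       (intro sum.cong refl, auto dest: length_pos)
  also have "frag_extend (\<lambda>p. boundary \<Gamma> (seg p)) D = push (\<lambda>p. Vertex (head_point ?G p)) D - D"
  proof (rule poly_mapping_eqI)
    fix q
    have "Poly_Mapping.lookup (frag_extend (\<lambda>p. boundary \<Gamma> (seg p)) D) q =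
      (\<Sum>p\<in>Poly_Mapping.keys D. Poly_Mapping.lookup D p * (if Vertex (head_point ?G p) = q then 1 else 0)) -
      (\<Sum>p\<in>Poly_Mapping.keys D. Poly_Mapping.lookup D p * (if p = q then 1 else 0))"
      unfolding lookup_frag_extend_general sum_subtractf[symmetric]
      by (intro sum.cong refl) (auto simp: bseg lookup_minus)
    also have "(\<Sum>p\<in>Poly_Mapping.keys D. Poly_Mapping.lookup D p * (if p = q then 1 else 0)) = Poly_Mapping.lookup D q"
      by (simp add: if_distrib[of "\<lambda>x. _ * x"] in_keys_iff cong: if_cong)
    finally show "Poly_Mapping.lookup (frag_extend (\<lambda>p. boundary \<Gamma> (seg p)) D) q =
       Poly_Mapping.lookup (push (\<lambda>p. Vertex (head_point ?G p)) D - D) q"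
      by (simp add: lookup_minus lookup_frag_extend if_distrib[of "\<lambda>x. _ * x"] cong: if_cong)
  qed
  finally have bc: "boundary \<Gamma> c = (\<Sum>e\<in>arcs ?G. frag_cmul (m e) (frag_of (Vertex (head ?G e)) - frag_of (Vertex (tail ?G e)))) -
      (push (\<lambda>p. Vertex (head_point ?G p)) D - D)" .
  have "(\<Sum>e\<in>arcs ?G. frag_cmul (m e) (frag_of (Vertex (head ?G e)) - frag_of (Vertex (tail ?G e)))) =
      push (\<lambda>p. Vertex (head_point ?G p)) D"
  proof (rule poly_mapping_eqI)
    fix q
    have l: "Poly_Mapping.lookup (\<Sum>e\<in>arcs ?G. frag_cmul (m e) (frag_of (Vertex (head ?G e)) - frag_of (Vertex (tail ?G e)))) q
      = (\<Sum>e\<in>arcs ?G. ((if Vertex (head ?G e) = q then 1 else 0) - (if Vertex (tail ?G e) = q then 1 else 0)) * m e)"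
      by (simp add: lookup_sum lookup_minus mult.commute) (intro sum.cong, auto)
    show "Poly_Mapping.lookup (\<Sum>e\<in>arcs ?G. frag_cmul (m e) (frag_of (Vertex (head ?G e)) - frag_of (Vertex (tail ?G e)))) q
      = Poly_Mapping.lookup (push (\<lambda>p. Vertex (head_point ?G p)) D) q"
    proof (cases "\<exists>v\<in>verts ?G. q = Vertex v")
      case True
      then obtain v where v: "v \<in> verts ?G" "q = Vertex v" by blast
      have "(\<Sum>e\<in>arcs ?G. ((if Vertex (head ?G e) = q then 1 else 0) - (if Vertex (tail ?G e) = q then 1 else 0)) * m e)
        = (\<Sum>x\<in>verts ?G. (if Vertex x = q then 1 else 0) * net_inflow ?G m x)"
        by (rule summation_by_parts)
      also have "\<dots> = net_inflow ?G m v"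
        using v by (simp add: if_distrib[of "\<lambda>x. x * _"] cong: if_cong)
      finally have "real_of_int (Poly_Mapping.lookup (\<Sum>e\<in>arcs ?G. frag_cmul (m e) (frag_of (Vertex (head ?G e)) - frag_of (Vertex (tail ?G e)))) q)
        = head_degree ?G v D" unfolding l m[OF v(1)] by simp
      also have "\<dots> = of_int (Poly_Mapping.lookup (push (\<lambda>p. Vertex (head_point ?G p)) D) q)"
        by (simp add: of_int_lookup_push head_degree_def v(2))
      finally show ?thesis by simp
    next
      case False
      then have *: "Vertex (head ?G e) \<noteq> q" "Vertex (tail ?G e) \<noteq> q" if "e \<in> arcs ?G" for e
        using that by auto
      have "Vertex (head_point ?G p) \<noteq> q" if "p \<in> Poly_Mapping.keys D" for p
        using False head_point_in_verts[of p] keysD that by blast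
      then have "Poly_Mapping.lookup (push (\<lambda>p. Vertex (head_point ?G p)) D) q = 0"
        by (simp add: lookup_frag_extend)
      moreover have "(\<Sum>e\<in>arcs ?G. ((if Vertex (head ?G e) = q then 1 else 0) - (if Vertex (tail ?G e) = q then 1 else 0)) * m e) = 0"
        using * by (intro sum.neutral) auto
      ultimately show ?thesis unfolding l by simp
    qed
  qed
  with bc have c2: "boundary \<Gamma> c = D" by simp
  have c3: "chain_length c e = of_int (m e) * ?L e - edge_moment (\<lambda>e t. ?L e - t) e D"
    if e: "e \<in> arcs ?G" for e
  proof -
    have "wsum (\<lambda>(e', a, b). if e' = e then b - a else 0) (frag_extend seg D) = edge_moment (\<lambda>e t. ?L e - t) e D"
      unfolding edge_moment_def wsum_frag_extend
      by (intro wsum_cong) (simp add: seg_def split: point.split)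
    then show ?thesis
      using e by (simp add: chain_length_def c_def if_distrib[of "\<lambda>x. _ * x"] cong: if_cong)
  qed
  show thesis by (rule that[OF c1 c2 c3])
qed

text \<open>The pairings agree on all cycles iff \<open>edge_length \<Gamma> e * z e\<close> and the
  length of the chain along \<open>e\<close> differ by a gradient, and this gradient is absorbed
  into the potential.\<close>

lemma chain_pairing_iff_curve_rel:
  assumes D: "D \<in> divisors \<Gamma>" and z: "z \<in> H1R (curve_graph \<Gamma>)"
  shows "(\<exists>c\<in>int_chains \<Gamma>. boundary \<Gamma> c = D \<and>
      (\<forall>z'\<in>H1R (curve_graph \<Gamma>). cycle_pairing \<Gamma> z z' = chain_pairing c z')) \<longleftrightarrow>
    curve_rel \<Gamma> D (\<lambda>e. edge_length \<Gamma> e * z e)" (is "?lhs \<longleftrightarrow> ?rhs")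
proof
  let ?G = "curve_graph \<Gamma>" and ?L = "edge_length \<Gamma>"
  assume ?lhs
  then obtain c where c: "c \<in> int_chains \<Gamma>" "boundary \<Gamma> c = D"
    "\<And>z'. z' \<in> H1R ?G \<Longrightarrow> cycle_pairing \<Gamma> z z' = chain_pairing c z'" by blast
  have "(\<Sum>e\<in>arcs ?G. (?L e * z e - chain_length c e) * z' e) = 0" if "z' \<in> H1R ?G" for z'
    using c(3)[OF that] by (simp add: chain_pairing_eq[OF finite_arcs c(1)] cycle_pairing_def left_diff_distrib sum_subtractf)
  from orthogonal_to_cycles_potential[OF this]
  obtain \<psi> where \<psi>: "\<And>e. e \<in> arcs ?G \<Longrightarrow> ?L e * z e - chain_length c e = \<psi> (head ?G e) - \<psi> (tail ?G e)" by blast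
  from curve_rel_boundary[OF c(1)] obtain \<phi> m where
    \<phi>: "\<And>e. e \<in> arcs ?G \<Longrightarrow> \<phi> (head ?G e) - \<phi> (tail ?G e) =
       of_int (m e) * ?L e - edge_moment (\<lambda>e t. ?L e - t) e D - chain_length c e"
    and m: "\<And>v. v \<in> verts ?G \<Longrightarrow> head_degree ?G v D = of_int (net_inflow ?G m v)"
    unfolding c(2) by (rule abel_relE) blast
  show ?rhs
    by (rule abel_relI[of _ "\<lambda>v. \<phi> v - \<psi> v" m]) (use \<phi> \<psi> m in \<open>force simp: algebra_simps\<close>)+
next
  let ?G = "curve_graph \<Gamma>" and ?L = "edge_length \<Gamma>"
  assume ?rhs
  then obtain \<phi> m where
    \<phi>: "\<And>e. e \<in> arcs ?G \<Longrightarrow> \<phi> (head ?G e) - \<phi> (tail ?G e) =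
       of_int (m e) * ?L e - edge_moment (\<lambda>e t. ?L e - t) e D - ?L e * z e"
    and m: "\<And>v. v \<in> verts ?G \<Longrightarrow> head_degree ?G v D = of_int (net_inflow ?G m v)"
    by (rule abel_relE) blast
  obtain c where c: "c \<in> int_chains \<Gamma>" "boundary \<Gamma> c = D"
    "\<And>e. e \<in> arcs ?G \<Longrightarrow> chain_length c e = of_int (m e) * ?L e - edge_moment (\<lambda>e t. ?L e - t) e D"
    using curve_rel_chain_exists[OF D m] by blast
  have "chain_pairing c z' = cycle_pairing \<Gamma> z z'" if "z' \<in> H1R ?G" for z'
  proof -
    have "chain_pairing c z' = (\<Sum>e\<in>arcs ?G. (\<phi> (head ?G e) - \<phi> (tail ?G e)) * z' e + ?L e * z e * z' e)"
      unfolding chain_pairing_eq[OF finite_arcs c(1)]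
      by (intro sum.cong refl) (simp add: c(3) \<phi> algebra_simps)
    then show ?thesis
      using potential_cycle_orthogonal[OF that] by (simp add: sum.distrib cycle_pairing_def)
  qed
  then show ?lhs using c by force
qed

lemma curve_rel_0_H1Z:
  assumes "h \<in> H1Z (curve_graph \<Gamma>)"
  shows "curve_rel \<Gamma> 0 (\<lambda>e. edge_length \<Gamma> e * h e)"
proof -
  let ?G = "curve_graph \<Gamma>"
  have h: "of_int \<lfloor>h e\<rfloor> = h e" for e using assms by (auto simp: H1Z_def)
  have "real_of_int (net_inflow ?G (\<lambda>e. \<lfloor>h e\<rfloor>) v) = 0" if "v \<in> verts ?G" for v
    using assms that by (simp add: net_inflow_of_int[symmetric] h H1Z_def H1R_iff)
  then show ?thesis
    by (intro abel_relI[of _ "\<lambda>_. 0" "\<lambda>e. \<lfloor>h e\<rfloor>"]) (auto simp: h)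
qed

text \<open>The difference \<open>x\<close> of the integral slopes and \<open>z\<close> is a cycle,
  while its multiple by the edge lengths is a gradient. Pairing the two gives energy zero, so
  \<open>z\<close> equals the slopes.\<close>

lemma curve_rel_0_imp_H1Z:
  assumes z: "z \<in> H1R (curve_graph \<Gamma>)" and rel: "curve_rel \<Gamma> 0 (\<lambda>e. edge_length \<Gamma> e * z e)"
  shows "z \<in> H1Z (curve_graph \<Gamma>)"
proof -
  let ?G = "curve_graph \<Gamma>" and ?L = "edge_length \<Gamma>"
  from rel obtain \<phi> m where
    \<phi>: "\<And>e. e \<in> arcs ?G \<Longrightarrow> \<phi> (head ?G e) - \<phi> (tail ?G e) = of_int (m e) * ?L e - ?L e * z e"
    and m: "\<And>v. v \<in> verts ?G \<Longrightarrow> net_inflow ?G m v = 0"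
    unfolding abel_rel_def edge_moment_linear head_degree_linear by auto
  define x where "x = (\<lambda>e. if e \<in> arcs ?G then of_int (m e) - z e else 0)"
  have "net_inflow ?G x v = 0" if v: "v \<in> verts ?G" for v
  proof -
    have "net_inflow ?G x v = net_inflow ?G (\<lambda>e. of_int (m e) - z e) v"
      by (rule net_inflow_cong) (simp add: x_def)
    then show ?thesis using m[OF v] z v by (simp add: net_inflow_diff net_inflow_of_int H1R_iff)
  qed
  then have "x \<in> H1R ?G" by (simp add: H1R_iff x_def)
  from potential_cycle_orthogonal[OF this, of \<phi>]
  have "(\<Sum>e\<in>arcs ?G. ?L e * (x e * x e)) = 0"
    by (simp add: \<phi> x_def algebra_simps cong: sum.cong)
  then have "\<forall>e\<in>arcs ?G. ?L e * (x e * x e) = 0"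
    by (subst (asm) sum_nonneg_eq_0_iff) (auto simp: less_imp_le[OF length_pos])
  then have "z e = of_int (m e)" if "e \<in> arcs ?G" for e
    using that length_pos[OF that] by (force simp: x_def)
  then have "z e \<in> \<int>" for e
    using z by (cases "e \<in> arcs ?G") (auto simp: H1R_iff)
  then show ?thesis using z by (simp add: H1Z_def)
qed

lemma curve_rel_class_eq_iff:
  assumes "z \<in> H1R (curve_graph \<Gamma>)" "z' \<in> H1R (curve_graph \<Gamma>)"
    and "curve_rel \<Gamma> D (\<lambda>e. edge_length \<Gamma> e * z e)"
  shows "H1_class (curve_graph \<Gamma>) z' = H1_class (curve_graph \<Gamma>) z \<longleftrightarrow> curve_rel \<Gamma> D (\<lambda>e. edge_length \<Gamma> e * z' e)"
proof
  assume "H1_class (curve_graph \<Gamma>) z' = H1_class (curve_graph \<Gamma>) z"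
  then have "z' - z \<in> H1Z (curve_graph \<Gamma>)" by (simp add: H1_class_eq_iff)
  from abel_rel_add[OF assms(3) curve_rel_0_H1Z[OF this]]
  show "curve_rel \<Gamma> D (\<lambda>e. edge_length \<Gamma> e * z' e)" by (simp add: algebra_simps)
next
  assume "curve_rel \<Gamma> D (\<lambda>e. edge_length \<Gamma> e * z' e)"
  from abel_rel_diff[OF this assms(3)]
  have "curve_rel \<Gamma> 0 (\<lambda>e. edge_length \<Gamma> e * (z' - z) e)" by (simp add: algebra_simps)
  then show "H1_class (curve_graph \<Gamma>) z' = H1_class (curve_graph \<Gamma>) z"
    using curve_rel_0_imp_H1Z[OF H1R_diff[OF assms(2,1)]] by (simp add: H1_class_eq_iff)
qed

lemma curve_rel_exists:
  assumes "\<And>v. v \<in> verts (curve_graph \<Gamma>) \<Longrightarrow> head_degree (curve_graph \<Gamma>) v D = of_int (net_inflow (curve_graph \<Gamma>) m v)"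
  obtains z where "z \<in> H1R (curve_graph \<Gamma>)" "curve_rel \<Gamma> D (\<lambda>e. edge_length \<Gamma> e * z e)"
proof -
  let ?G = "curve_graph \<Gamma>" and ?L = "edge_length \<Gamma>"
  obtain z \<psi> where z: "z \<in> H1R ?G" and
    \<psi>: "\<And>e. e \<in> arcs ?G \<Longrightarrow> of_int (m e) * ?L e - edge_moment (\<lambda>e t. ?L e - t) e D = ?L e * z e + (\<psi> (head ?G e) - \<psi> (tail ?G e))"
    using length_pos hodge_decomposition[where L = ?L and h = "\<lambda>e. of_int (m e) * ?L e - edge_moment (\<lambda>e t. ?L e - t) e D"] by blast
  have "curve_rel \<Gamma> D (\<lambda>e. ?L e * z e)"
    by (rule abel_relI[of _ \<psi> m]) (use assms \<psi> in \<open>force simp: algebra_simps\<close>)+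
  with z show thesis by (rule that)
qed

text \<open>For uniqueness in the definite description: any other admissible chain bounds a divisor
  of the same class, and two coordinate vectors of one class differ by an integral cycle.\<close>

lemma abel_jacobi_eq:
  assumes D: "D \<in> divisors \<Gamma>" and F: "F \<in> divisors \<Gamma>" and z: "z \<in> H1R (curve_graph \<Gamma>)"
    and rel: "curve_rel \<Gamma> (D - F) (\<lambda>e. edge_length \<Gamma> e * z e)"
  shows "abel_jacobi \<Gamma> ((\<lambda>D. D - F) ` (lin_equiv \<Gamma> `` {D})) = H1_class (curve_graph \<Gamma>) z"
  unfolding abel_jacobi_def
proof (rule the_equality)
  let ?G = "curve_graph \<Gamma>" and ?L = "edge_length \<Gamma>"
  have "D - F \<in> divisors \<Gamma>" using D F by (rule divisors_diff)
  from chain_pairing_iff_curve_rel[OF this z] rel obtain c where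
    "c \<in> int_chains \<Gamma>" "boundary \<Gamma> c = D - F" "\<forall>z'\<in>H1R ?G. cycle_pairing \<Gamma> z z' = chain_pairing c z'" by blast
  moreover have "D - F \<in> (\<lambda>D. D - F) ` (lin_equiv \<Gamma> `` {D})"
    using D by (auto simp: lin_equiv_iff_curve_rel abel_rel_0)
  ultimately show "\<exists>c\<in>int_chains \<Gamma>. \<exists>za\<in>H1R ?G. boundary \<Gamma> c \<in> (\<lambda>D. D - F) ` (lin_equiv \<Gamma> `` {D}) \<and>
     (\<forall>z'\<in>H1R ?G. cycle_pairing \<Gamma> za z' = chain_pairing c z') \<and> H1_class ?G z = H1_class ?G za"
    using z by (intro bexI[of _ c] bexI[of _ z]) auto
next
  let ?G = "curve_graph \<Gamma>" and ?L = "edge_length \<Gamma>"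
  fix x assume "\<exists>c\<in>int_chains \<Gamma>. \<exists>z\<in>H1R ?G. boundary \<Gamma> c \<in> (\<lambda>D. D - F) ` (lin_equiv \<Gamma> `` {D}) \<and>
     (\<forall>z'\<in>H1R ?G. cycle_pairing \<Gamma> z z' = chain_pairing c z') \<and> x = H1_class ?G z"
  then obtain c z' D' where c: "c \<in> int_chains \<Gamma>" "z' \<in> H1R ?G" "boundary \<Gamma> c = D' - F" "(D, D') \<in> lin_equiv \<Gamma>"
    "\<forall>z''\<in>H1R ?G. cycle_pairing \<Gamma> z' z'' = chain_pairing c z''" "x = H1_class ?G z'"
    by blast
  from c(4) have D': "D' \<in> divisors \<Gamma>" "curve_rel \<Gamma> (D' - D) (\<lambda>_. 0)"
    by (simp_all add: lin_equiv_iff_curve_rel)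
  have "curve_rel \<Gamma> (D' - F) (\<lambda>e. ?L e * z' e)"
    using chain_pairing_iff_curve_rel[OF divisors_diff[OF D'(1) F] c(2)] c by blast
  from abel_rel_diff[OF this D'(2)] have "curve_rel \<Gamma> (D - F) (\<lambda>e. ?L e * z' e)"
    by simp
  with curve_rel_class_eq_iff[OF z c(2) rel] c(6) show "x = H1_class ?G z" by simp
qed

end


section \<open>Contracting edges of length zero\<close>

text \<open>Points of the uncontracted graph have coordinates in \<open>{0..1}\<close> on every edge, independently of
  the lengths \<open>s\<close>, so that they make sense for all members of the family at once.\<close>

definition closed_points :: "('v, 'e) pre_digraph \<Rightarrow> ('v, 'e) point set" where
  "closed_points G = Vertex ` verts G \<union> {Interior e t | e t. e \<in> arcs G \<and> 0 \<le> t \<and> t \<le> 1}"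

text \<open>Coordinate 0 is excluded because such a point has the head as its
  \<open>head_point\<close> but contracts to the tail; at coordinate 1 the two agree. Lifts of
  points of a curve are half open, whereas limits of such points are only closed.\<close>

definition half_open_points :: "('v, 'e) pre_digraph \<Rightarrow> ('v, 'e) point set" where
  "half_open_points G = Vertex ` verts G \<union> {Interior e t | e t. e \<in> arcs G \<and> 0 < t \<and> t \<le> 1}"

definition contract_point :: "('v, 'e) pre_digraph \<Rightarrow> ('e \<Rightarrow> real) \<Rightarrow> ('v, 'e) point \<Rightarrow> ('v set, 'e) point" where
  "contract_point G s p = (case p of
      Vertex v \<Rightarrow> Vertex (collapsed_rel G s `` {v})
    | Interior e t \<Rightarrow> edge_point (curve_at G (\<lambda>_. 0) s) e (s e * t))"

text \<open>A section of \<open>contract_point G s\<close> over the points of the curve, with an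
  arbitrary representative for each class of vertices.\<close>

definition lift_point :: "('e \<Rightarrow> real) \<Rightarrow> ('v set, 'e) point \<Rightarrow> ('v, 'e) point" where
  "lift_point s p = (case p of Vertex V \<Rightarrow> Vertex (SOME v. v \<in> V) | Interior e t \<Rightarrow> Interior e (t / s e))"

abbreviation lifted_rel :: "('v, 'e) pre_digraph \<Rightarrow> ('e \<Rightarrow> real) \<Rightarrow> ('v, 'e) divisor \<Rightarrow> ('e \<Rightarrow> real) \<Rightarrow> bool" where
  "lifted_rel G s \<equiv> abel_rel G s (\<lambda>e t. s e * (1 - t))"

lemma edge_moment_neutral:
  assumes "\<And>t. \<kappa> e t = 0"
  shows "edge_moment \<kappa> e D = 0"
proof -
  have "edge_moment \<kappa> e D = wsum (\<lambda>_. 0) D"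
    unfolding edge_moment_def using assms by (intro wsum_cong) (auto split: point.split)
  then show ?thesis by (simp add: wsum_def)
qed

lemma head_degree_Ints: "head_degree G v D \<in> \<int>"
  by (auto simp: head_degree_def wsum_def)

lemma divisor_degree_push: "divisor_degree (push g D) = divisor_degree D"
proof -
  have "real_of_int (divisor_degree (push g D)) = of_int (divisor_degree D)"
    unfolding divisor_degree_wsum by simp
  then show ?thesis by linarith
qed

locale contraction =
  fixes G :: "('v, 'e) pre_digraph" and s :: "'e \<Rightarrow> real"
  assumes fin_G: "fin_digraph G" and s_cone: "s \<in> length_cone G"
begin

sublocale fin_digraph G
  by (rule fin_G)

abbreviation "K \<equiv> collapsed_graph G s"
abbreviation "Gs \<equiv> contracted_graph G s"
abbreviation "cls v \<equiv> collapsed_rel G s `` {v}"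

lemma s_nonneg: "e \<in> arcs G \<Longrightarrow> 0 \<le> s e"
  using s_cone by (simp add: length_cone_def)

lemma collapsed_graph_simps [simp]:
  "verts K = verts G" "arcs K = {e \<in> arcs G. s e = 0}" "tail K = tail G" "head K = head G"
  by (simp_all add: collapsed_graph_def)

lemma contracted_graph_simps [simp]:
  "verts Gs = verts G // collapsed_rel G s" "arcs Gs = {e \<in> arcs G. 0 < s e}"
  "tail Gs e = cls (tail G e)" "head Gs e = cls (head G e)"
  by (simp_all add: contracted_graph_def)

lemma curve_at_simps [simp]:
  "curve_graph (curve_at G w s) = Gs" "edge_length (curve_at G w s) = s"
  by (simp_all add: curve_at_def)

lemma fin_K: "fin_digraph K"
  by unfold_locales auto

lemma collapsed_rel_iff: "(u, v) \<in> collapsed_rel G s \<longleftrightarrow> (u, v) \<in> rtrancl_on (verts G) (parcs (mk_symmetric K))"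
  by (simp add: collapsed_rel_def reachable_def)

lemma collapsed_rel_sym: "(u, v) \<in> collapsed_rel G s \<Longrightarrow> (v, u) \<in> collapsed_rel G s"
  unfolding collapsed_rel_def mem_Collect_eq case_prod_conv
  by (rule symmetric_reachable[OF symmetric_mk_symmetric])

lemma collapsed_rel_trans:
  "(u, v) \<in> collapsed_rel G s \<Longrightarrow> (v, x) \<in> collapsed_rel G s \<Longrightarrow> (u, x) \<in> collapsed_rel G s"
  unfolding collapsed_rel_iff by (rule rtrancl_on_trans)

lemma equiv_collapsed: "equiv (verts G) (collapsed_rel G s)"
proof (rule equivI)
  have "u \<in> verts G \<and> v \<in> verts G" if "(u, v) \<in> collapsed_rel G s" for u v
    using that unfolding collapsed_rel_iff by (induction rule: rtrancl_on.induct) auto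
  then show "collapsed_rel G s \<subseteq> verts G \<times> verts G" by auto
  show "refl_on (verts G) (collapsed_rel G s)"
    by (rule refl_onI) (simp add: collapsed_rel_iff)
  show "sym (collapsed_rel G s)"
    by (rule symI) (rule collapsed_rel_sym)
  show "trans (collapsed_rel G s)"
    by (rule transI) (rule collapsed_rel_trans)
qed

lemma cls_eq_iff: "u \<in> verts G \<Longrightarrow> v \<in> verts G \<Longrightarrow> cls u = cls v \<longleftrightarrow> (u, v) \<in> collapsed_rel G s"
  by (rule eq_equiv_class_iff[OF equiv_collapsed])

lemma in_cls_self: "v \<in> verts G \<Longrightarrow> v \<in> cls v"
  by (rule equiv_class_self[OF equiv_collapsed])

lemma cls_in_verts: "v \<in> verts G \<Longrightarrow> cls v \<in> verts Gs"
  by (simp add: quotientI)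

lemma verts_Gs_cases:
  assumes "V \<in> verts Gs"
  obtains v where "v \<in> verts G" "V = cls v"
  using assms unfolding contracted_graph_simps by (rule quotientE) blast

lemma class_subset: "V \<in> verts Gs \<Longrightarrow> V \<subseteq> verts G"
  using in_quotient_imp_subset[OF equiv_collapsed] by simp

lemma cls_eq_class_iff:
  assumes "V \<in> verts Gs" "v \<in> verts G"
  shows "cls v = V \<longleftrightarrow> v \<in> V"
proof -
  obtain u where u: "u \<in> verts G" "V = cls u" using assms(1) by (rule verts_Gs_cases)
  show ?thesis
    unfolding u(2) cls_eq_iff[OF assms(2) u(1)] using collapsed_rel_sym by blast
qed

lemma some_in_class: "V \<in> verts Gs \<Longrightarrow> (SOME v. v \<in> V) \<in> V"
  using in_quotient_imp_non_empty[OF equiv_collapsed, of V] by (simp add: some_in_eq)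

lemma cls_tail_eq_head: "e \<in> arcs G \<Longrightarrow> s e = 0 \<Longrightarrow> cls (tail G e) = cls (head G e)"
proof -
  assume e: "e \<in> arcs G" "s e = 0"
  have "(tail G e, head G e) \<in> parcs (mk_symmetric K)"
    using e by (auto simp: parcs_mk_symmetric)
  then have "(tail G e, head G e) \<in> rtrancl_on (verts G) (parcs (mk_symmetric K))"
    using e by (intro rtrancl_on_into_rtrancl_on[OF rtrancl_on_refl]) auto
  then have "(tail G e, head G e) \<in> collapsed_rel G s"
    by (simp add: collapsed_rel_iff)
  then show ?thesis using e by (simp add: cls_eq_iff)
qed

lemma fin_Gs: "fin_digraph Gs"
proof unfold_locales
  show "finite (verts Gs)"
    using finite_quotient[OF finite_verts, of "collapsed_rel G s"] equiv_collapsed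
    by (simp add: equiv_def)
qed (auto intro!: quotientI)

lemma metric_graph_curve_at: "metric_graph (curve_at G w s)"
  by (intro metric_graph.intro) (auto simp: fin_Gs)

text \<open>A collapsed edge has both ends in the same class, so its two contributions cancel in the
  sum over that class.\<close>

lemma net_inflow_contracted:
  fixes z :: "'e \<Rightarrow> 'a::comm_ring_1"
  assumes V: "V \<in> verts Gs"
  shows "net_inflow Gs z V = (\<Sum>v\<in>V. net_inflow G z v)"
proof -
  interpret Gs: fin_digraph Gs by (rule fin_Gs)
  have "net_inflow Gs z V = (\<Sum>X\<in>verts Gs. (if X = V then 1 else 0) * net_inflow Gs z X)"
    using V Gs.finite_verts by (simp add: if_distrib[of "\<lambda>x. x * _"] del: contracted_graph_simps cong: if_cong)
  also have "\<dots> = (\<Sum>e\<in>arcs Gs. ((if head Gs e = V then 1 else 0) - (if tail Gs e = V then 1 else 0)) * z e)"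
    by (rule Gs.summation_by_parts[symmetric])
  also have "\<dots> = (\<Sum>e\<in>arcs Gs. ((if head G e \<in> V then 1 else 0) - (if tail G e \<in> V then 1 else 0)) * z e)"
    using V by (intro sum.cong refl) (auto simp: cls_eq_class_iff)
  also have "\<dots> = (\<Sum>e\<in>arcs G. ((if head G e \<in> V then 1 else 0) - (if tail G e \<in> V then 1 else 0)) * z e)"
  proof (intro sum.mono_neutral_left ballI)
    fix e assume e: "e \<in> arcs G - arcs Gs"
    then have "s e = 0" using s_nonneg[of e] by auto
    then have "cls (tail G e) = cls (head G e)" using e cls_tail_eq_head by auto
    then have "head G e \<in> V \<longleftrightarrow> tail G e \<in> V"
      using e V cls_eq_class_iff[OF V, of "head G e"] cls_eq_class_iff[OF V, of "tail G e"] by auto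
    then show "((if head G e \<in> V then 1 else 0) - (if tail G e \<in> V then 1 else 0)) * z e = 0" by simp
  qed auto
  also have "\<dots> = (\<Sum>v\<in>verts G. (if v \<in> V then 1 else 0) * net_inflow G z v)"
    by (rule summation_by_parts)
  also have "\<dots> = (\<Sum>v\<in>V. net_inflow G z v)"
    using class_subset[OF V] by (simp add: if_distrib[of "\<lambda>x. x * _"] sum.If_cases Int_absorb1 cong: if_cong)
  finally show ?thesis .
qed

lemma rescale_H1_H1R: "z \<in> H1R G \<Longrightarrow> rescale_H1 s z \<in> H1R Gs"
proof -
  assume z: "z \<in> H1R G"
  have "net_inflow Gs (rescale_H1 s z) V = 0" if V: "V \<in> verts Gs" for V
  proof -
    have "net_inflow Gs (rescale_H1 s z) V = net_inflow Gs z V"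
      by (rule net_inflow_cong) (simp add: rescale_H1_def)
    also have "\<dots> = 0"
      unfolding net_inflow_contracted[OF V] using z class_subset[OF V]
      by (intro sum.neutral) (auto simp: H1R_iff)
    finally show ?thesis .
  qed
  then show ?thesis using z by (auto simp: H1R_iff rescale_H1_def)
qed

lemma rescale_H1_H1Z: "z \<in> H1Z G \<Longrightarrow> rescale_H1 s z \<in> H1Z Gs"
  using rescale_H1_H1R by (auto simp: H1Z_def rescale_H1_def)

lemma contract_point_simps:
  "contract_point G s (Vertex v) = Vertex (cls v)"
  "contract_point G s (Interior e t) =
    (if s e * t \<le> 0 then Vertex (cls (tail G e)) else if s e \<le> s e * t then Vertex (cls (head G e)) else Interior e (s e * t))"
  by (simp_all add: contract_point_def edge_point_def)

lemma contract_point_in_points: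
  assumes "p \<in> closed_points G"
  shows "contract_point G s p \<in> points (curve_at G w s)"
proof -
  from assms consider v where "p = Vertex v" "v \<in> verts G"
    | e t where "p = Interior e t" "e \<in> arcs G"
    by (auto simp: closed_points_def)
  then show ?thesis
  proof cases
    case 1
    then show ?thesis using cls_in_verts[of v] by (auto simp: contract_point_simps points_def)
  next
    case 2
    then have "Vertex (cls (tail G e)) \<in> points (curve_at G w s)" "Vertex (cls (head G e)) \<in> points (curve_at G w s)"
      using cls_in_verts[of "tail G e"] cls_in_verts[of "head G e"] by (auto simp: points_def)
    moreover have "Interior e (s e * t) \<in> points (curve_at G w s)" if "0 < s e * t" "s e * t < s e"
      using that 2 by (simp add: points_def)
    ultimately show ?thesis unfolding 2(1) contract_point_simps by (simp add: not_le)
  qed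
qed

lemma lift_point_half_open:
  assumes "p \<in> points (curve_at G w s)"
  shows "lift_point s p \<in> half_open_points G"
proof -
  from assms consider V where "p = Vertex V" "V \<in> verts Gs"
    | e t where "p = Interior e t" "e \<in> arcs G" "0 < s e" "0 < t" "t < s e"
    by (auto simp: points_def)
  then show ?thesis
  proof cases
    case 1
    then show ?thesis using some_in_class[OF 1(2)] class_subset[OF 1(2)]
      by (auto simp: lift_point_def half_open_points_def)
  next
    case 2
    then show ?thesis by (auto simp: lift_point_def half_open_points_def)
  qed
qed

lemma contract_lift_point:
  assumes "p \<in> points (curve_at G w s)"
  shows "contract_point G s (lift_point s p) = p"
proof -
  from assms consider V where "p = Vertex V" "V \<in> verts Gs"
    | e t where "p = Interior e t" "e \<in> arcs G" "0 < s e" "0 < t" "t < s e"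
    by (auto simp: points_def)
  then show ?thesis
  proof cases
    case 1
    then show ?thesis
      using cls_eq_class_iff[OF 1(2), of "SOME v. v \<in> V"] some_in_class[OF 1(2)] class_subset[OF 1(2)]
      by (auto simp: lift_point_def contract_point_simps)
  next
    case 2
    then show ?thesis by (auto simp: lift_point_def contract_point_simps)
  qed
qed

lemma half_open_cases:
  assumes "p \<in> half_open_points G"
  obtains v where "p = Vertex v" "v \<in> verts G" | e t where "p = Interior e t" "e \<in> arcs G" "0 < t" "t \<le> 1"
  using assms by (auto simp: half_open_points_def)

lemma head_point_contract:
  assumes "p \<in> half_open_points G"
  shows "head_point Gs (contract_point G s p) = cls (head_point G p)"
  using assms
proof (cases rule: half_open_cases)
  case (2 e t)
  then show ?thesis using s_nonneg[of e] cls_tail_eq_head[of e]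
    by (auto simp: contract_point_simps mult_le_0_iff)
qed (simp add: contract_point_simps)

lemma head_degree_contract:
  assumes D: "Poly_Mapping.keys D \<subseteq> half_open_points G" and V: "V \<in> verts Gs"
  shows "head_degree Gs V (push (contract_point G s) D) = (\<Sum>v\<in>V. head_degree G v D)"
proof -
  have "head_degree Gs V (push (contract_point G s) D) =
      wsum (\<lambda>p. \<Sum>v\<in>V. if head_point G p = v then 1 else 0) D"
    unfolding head_degree_def wsum_push
  proof (rule wsum_cong)
    fix p assume "p \<in> Poly_Mapping.keys D"
    then have p: "p \<in> half_open_points G" using D by blast
    then have h: "head_point G p \<in> verts G" by (cases rule: half_open_cases) auto
    have "finite V" using class_subset[OF V] by (rule finite_subset) simp
    then show "(if head_point Gs (contract_point G s p) = V then 1 else 0) =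
        (\<Sum>v\<in>V. if head_point G p = v then 1 else 0)"
      unfolding head_point_contract[OF p] cls_eq_class_iff[OF V h] by simp
  qed
  then show ?thesis by (simp add: wsum_weight_sum head_degree_def)
qed

lemma edge_moment_contract:
  assumes D: "Poly_Mapping.keys D \<subseteq> half_open_points G" and e: "0 < s e"
  shows "edge_moment (\<lambda>e t. s e - t) e (push (contract_point G s) D) = edge_moment (\<lambda>e t. s e * (1 - t)) e D"
  unfolding edge_moment_def wsum_push
proof (rule wsum_cong)
  fix p assume "p \<in> Poly_Mapping.keys D"
  then have p: "p \<in> half_open_points G" using D by blast
  then show "(case contract_point G s p of Vertex _ \<Rightarrow> 0 | Interior e' t \<Rightarrow> if e' = e then s e - t else 0) =
      (case p of Vertex _ \<Rightarrow> 0 | Interior e' t \<Rightarrow> if e' = e then s e * (1 - t) else 0)"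
  proof (cases rule: half_open_cases)
    case (2 e' t)
    then show ?thesis using e
      by (auto simp: contract_point_simps mult_le_0_iff right_diff_distrib)
  qed (simp add: contract_point_simps)
qed

text \<open>On edges with \<open>s e = 0\<close> the first equation only says that
  \<open>\<phi>\<close> agrees at both ends, so \<open>\<phi>\<close> descends to classes, while the
  slopes there are free. Conversely, the free slopes are used to balance the vertices inside each
  class; this is possible because the total defect of a class vanishes by the equation at the
  contracted vertex.\<close>

lemma lifted_rel_iff_curve_rel:
  assumes D: "Poly_Mapping.keys D \<subseteq> half_open_points G"
  shows "lifted_rel G s D (\<lambda>e. s e * z e) \<longleftrightarrow>
    curve_rel (curve_at G w s) (push (contract_point G s) D) (\<lambda>e. s e * z e)"
proof
  assume "lifted_rel G s D (\<lambda>e. s e * z e)"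
  then obtain \<phi> m where
    \<phi>: "\<And>e. e \<in> arcs G \<Longrightarrow> \<phi> (head G e) - \<phi> (tail G e) = of_int (m e) * s e - edge_moment (\<lambda>e t. s e * (1 - t)) e D - s e * z e"
    and m: "\<And>v. v \<in> verts G \<Longrightarrow> head_degree G v D = of_int (net_inflow G m v)"
    by (rule abel_relE) blast
  have \<phi>0: "\<phi> (head G e) = \<phi> (tail G e)" if "e \<in> arcs G" "s e = 0" for e
    using \<phi>[OF that(1)] that(2) by (simp add: edge_moment_neutral)
  have \<phi>_cls: "\<phi> u = \<phi> v" if "(u, v) \<in> collapsed_rel G s" for u v
    using that unfolding collapsed_rel_iff
    by (induction rule: rtrancl_on.induct) (auto simp: parcs_mk_symmetric \<phi>0)
  define \<phi>' where "\<phi>' = (\<lambda>V. \<phi> (SOME v. v \<in> V))"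
  have \<phi>': "\<phi>' (cls v) = \<phi> v" if "v \<in> verts G" for v
  proof -
    have "(v, SOME u. u \<in> cls v) \<in> collapsed_rel G s"
      using some_in_class[OF cls_in_verts[OF that]] by simp
    then show ?thesis by (simp add: \<phi>'_def \<phi>_cls)
  qed
  show "curve_rel (curve_at G w s) (push (contract_point G s) D) (\<lambda>e. s e * z e)"
  proof (rule abel_relI[of _ \<phi>' m])
    fix e assume "e \<in> arcs (curve_graph (curve_at G w s))"
    then have e: "e \<in> arcs G" "0 < s e" by auto
    show "\<phi>' (head (curve_graph (curve_at G w s)) e) - \<phi>' (tail (curve_graph (curve_at G w s)) e) =
       of_int (m e) * edge_length (curve_at G w s) e -
       edge_moment (\<lambda>e t. edge_length (curve_at G w s) e - t) e (push (contract_point G s) D) - s e * z e"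
      using \<phi>[OF e(1)] e by (simp add: \<phi>' edge_moment_contract[OF D])
  next
    fix V assume "V \<in> verts (curve_graph (curve_at G w s))"
    then have V: "V \<in> verts Gs" by simp
    then show "head_degree (curve_graph (curve_at G w s)) V (push (contract_point G s) D) =
       of_int (net_inflow (curve_graph (curve_at G w s)) m V)"
      using class_subset[OF V] m unfolding curve_at_simps head_degree_contract[OF D V] net_inflow_contracted[OF V]
      by (simp add: subset_iff)
  qed
next
  assume "curve_rel (curve_at G w s) (push (contract_point G s) D) (\<lambda>e. s e * z e)"
  then obtain \<phi> m where
    \<phi>: "\<And>e. e \<in> arcs Gs \<Longrightarrow> \<phi> (head Gs e) - \<phi> (tail Gs e) = of_int (m e) * s e - edge_moment (\<lambda>e t. s e - t) e (push (contract_point G s) D) - s e * z e"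
    and m: "\<And>V. V \<in> verts Gs \<Longrightarrow> head_degree Gs V (push (contract_point G s) D) = of_int (net_inflow Gs m V)"
    unfolding curve_at_simps by (rule abel_relE) blast
  define m0 where "m0 = (\<lambda>e. if 0 < s e then m e else 0)"
  \<comment> \<open>The defect left at \<open>v\<close> when the collapsed edges carry slope 0. The
    cut-off \<open>m0\<close> is taken because the values of \<open>m\<close> on those edges are
    arbitrary.\<close>
  define g where "g = (\<lambda>v. \<lfloor>head_degree G v D\<rfloor> - net_inflow G m0 v)"
  have gV: "(\<Sum>v\<in>V. g v) = 0" if V: "V \<in> verts Gs" for V
  proof -
    have "net_inflow Gs m V = net_inflow Gs m0 V"
      by (rule net_inflow_cong) (simp add: m0_def)
    then have "real_of_int (\<Sum>v\<in>V. g v) = 0"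
      using m[OF V] head_degree_Ints[of G _ D]
      by (simp add: g_def sum_subtractf net_inflow_contracted[OF V] head_degree_contract[OF D V] of_int_floor_cancel)
    then show ?thesis by linarith
  qed
  define rep where "rep = (\<lambda>v. SOME u. u \<in> cls v)"
  have rep: "(v, rep v) \<in> collapsed_rel G s" if "v \<in> verts G" for v
    using some_in_class[OF cls_in_verts[OF that]] by (simp add: rep_def)
  interpret K: fin_digraph K by (rule fin_K)
  have "\<exists>n::'e \<Rightarrow> int. (\<forall>e. e \<notin> arcs K \<longrightarrow> n e = 0) \<and> (\<forall>x\<in>verts K. net_inflow K n x = g x)"
  proof (rule K.integral_flow_exists[of rep])
    fix v assume "v \<in> verts K"
    then have "(rep v, v) \<in> collapsed_rel G s"
      using rep[of v] collapsed_rel_sym by simp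
    then show "rep v \<rightarrow>\<^sup>*\<^bsub>with_proj (mk_symmetric K)\<^esub> v" by (simp add: collapsed_rel_def)
  next
    fix x assume "x \<in> verts K"
    show "(\<Sum>v\<in>{v \<in> verts K. rep v = x}. g v) = 0"
    proof (cases "\<exists>u\<in>verts G. rep u = x")
      case True
      then obtain u where u: "u \<in> verts G" "rep u = x" by blast
      have "{v \<in> verts K. rep v = x} = cls u"
      proof (intro equalityI subsetI)
        fix v assume "v \<in> {v \<in> verts K. rep v = x}"
        then have v: "v \<in> verts G" "rep v = x" by auto
        then have "(u, x) \<in> collapsed_rel G s" "(v, x) \<in> collapsed_rel G s"
          using rep[OF u(1)] rep[OF v(1)] u by auto
        then have "(u, v) \<in> collapsed_rel G s"
          using collapsed_rel_sym collapsed_rel_trans by blast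
        then show "v \<in> cls u" by simp
      next
        fix v assume v: "v \<in> cls u"
        then have "v \<in> verts G" using class_subset[OF cls_in_verts[OF u(1)]] by blast
        moreover from this v have "rep v = rep u"
          unfolding rep_def using u cls_eq_iff[of v u] collapsed_rel_sym[of u v] by auto
        ultimately show "v \<in> {v \<in> verts K. rep v = x}" using u by simp
      qed
      then show ?thesis using gV[OF cls_in_verts[OF u(1)]] by simp
    next
      case False
      then have e: "{v \<in> verts K. rep v = x} = {}" by auto
      show ?thesis unfolding e by simp
    qed
  qed
  then obtain n :: "'e \<Rightarrow> int" where n: "\<And>e. e \<notin> arcs K \<Longrightarrow> n e = 0" "\<And>v. v \<in> verts G \<Longrightarrow> net_inflow K n v = g v"
    by auto
  have nG: "net_inflow G n v = g v" if v: "v \<in> verts G" for v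
  proof -
    have "(\<Sum>e\<in>in_arcs G v. n e) = (\<Sum>e\<in>in_arcs K v. n e)"
      by (rule sum.mono_neutral_right[OF finite_in_arcs]) (auto intro!: n(1))
    moreover have "(\<Sum>e\<in>out_arcs G v. n e) = (\<Sum>e\<in>out_arcs K v. n e)"
      by (rule sum.mono_neutral_right[OF finite_out_arcs]) (auto intro!: n(1))
    ultimately show ?thesis using n(2)[OF v] by (simp add: net_inflow_def)
  qed
  show "lifted_rel G s D (\<lambda>e. s e * z e)"
  proof (rule abel_relI[of _ "\<lambda>v. \<phi> (cls v)" "\<lambda>e. m0 e + n e"])
    fix e assume e: "e \<in> arcs G"
    show "\<phi> (cls (head G e)) - \<phi> (cls (tail G e)) =
       of_int (m0 e + n e) * s e - edge_moment (\<lambda>e t. s e * (1 - t)) e D - s e * z e"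
    proof (cases "s e = 0")
      case True
      then show ?thesis using cls_tail_eq_head[OF e] by (simp add: edge_moment_neutral)
    next
      case False
      then have "0 < s e" using s_nonneg[OF e] by simp
      then show ?thesis using \<phi>[of e] e n(1)[of e] by (simp add: m0_def edge_moment_contract[OF D])
    qed
  next
    fix v assume "v \<in> verts G"
    then show "head_degree G v D = of_int (net_inflow G (\<lambda>e. m0 e + n e) v)"
      using head_degree_Ints[of G v D] by (simp add: net_inflow_add nG g_def)
  qed
qed

definition normalize_point :: "('v, 'e) point \<Rightarrow> ('v, 'e) point" where
  "normalize_point p = (case p of Vertex v \<Rightarrow> Vertex v | Interior e t \<Rightarrow> if t = 0 then Vertex (tail G e) else Interior e t)"

text \<open>A chip at coordinate 0 is counted at the head with full moment \<open>s e\<close>; slope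
  1 on \<open>e\<close> transfers it to the tail. This brings limits of chips back into the half
  open form required for contraction.\<close>

lemma lifted_rel_normalize:
  assumes D: "Poly_Mapping.keys D \<subseteq> closed_points G" and rel: "lifted_rel G s D y"
  shows "lifted_rel G s (push normalize_point D) y"
proof -
  have 1: "lifted_rel G s (frag_of p - frag_of (normalize_point p)) (\<lambda>_. 0)" if "p \<in> Poly_Mapping.keys D" for p
  proof (cases "\<exists>e\<in>arcs G. p = Interior e 0")
    case True
    then obtain e where e: "e \<in> arcs G" "p = Interior e 0" by blast
    show ?thesis
      by (rule abel_relI[of _ "\<lambda>_. 0" "\<lambda>e'. if e' = e then 1 else 0"])
         (use e in \<open>auto simp: normalize_point_def net_inflow_delta\<close>)
  next
    case False
    have "p \<in> closed_points G" using that D by blast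
    then have "normalize_point p = p"
      using False by (auto simp: normalize_point_def closed_points_def)
    then show ?thesis by (simp add: abel_rel_0)
  qed
  have "frag_extend (\<lambda>p. frag_of p - frag_of (normalize_point p)) D = D - push normalize_point D"
  proof (rule poly_mapping_eqI)
    fix q
    have "(\<Sum>p\<in>Poly_Mapping.keys D. Poly_Mapping.lookup D p * (if p = q then 1 else 0)) = Poly_Mapping.lookup D q"
      by (simp add: if_distrib[of "\<lambda>x. _ * x"] in_keys_iff cong: if_cong)
    then show "Poly_Mapping.lookup (frag_extend (\<lambda>p. frag_of p - frag_of (normalize_point p)) D) q =
        Poly_Mapping.lookup (D - push normalize_point D) q"
      unfolding lookup_minus lookup_frag_extend_general
      by (simp add: right_diff_distrib sum_subtractf lookup_minus eq_commute cong: if_cong)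
  qed
  with abel_rel_frag_extend[of D _ _ _ "\<lambda>p. frag_of p - frag_of (normalize_point p)" "\<lambda>_ _. 0", OF 1]
  have "lifted_rel G s (D - push normalize_point D) (\<lambda>_. 0)" by simp
  from abel_rel_diff[OF rel this] show ?thesis by simp
qed

lemma contract_normalize_point: "contract_point G s (normalize_point p) = contract_point G s p"
  by (auto simp: normalize_point_def contract_point_simps split: point.split)

lemma lifted_rel_imp_curve_rel:
  assumes D: "Poly_Mapping.keys D \<subseteq> closed_points G" and rel: "lifted_rel G s D (\<lambda>e. s e * z e)"
  shows "curve_rel (curve_at G w s) (push (contract_point G s) D) (\<lambda>e. s e * z e)"
proof -
  have "Poly_Mapping.keys (push normalize_point D) \<subseteq> half_open_points G"
  proof
    fix q assume "q \<in> Poly_Mapping.keys (push normalize_point D)"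
    then obtain p where "p \<in> Poly_Mapping.keys D" "q = normalize_point p"
      using keys_push[of normalize_point D] by blast
    then have "p \<in> closed_points G" using D by blast
    then consider v where "p = Vertex v" "v \<in> verts G"
      | e t where "p = Interior e t" "e \<in> arcs G" "0 \<le> t" "t \<le> 1"
      by (auto simp: closed_points_def)
    then show "q \<in> half_open_points G"
      by cases (auto simp: \<open>q = normalize_point p\<close> normalize_point_def half_open_points_def)
  qed
  from lifted_rel_iff_curve_rel[OF this] lifted_rel_normalize[OF assms]
  show ?thesis by (simp add: push_push contract_normalize_point)
qed

lemma push_contract_lift:
  assumes "D \<in> divisors (curve_at G w s)"
  shows "push (contract_point G s) (push (lift_point s) D) = D"
  unfolding push_push using assms contract_lift_point
  by (intro push_id) (auto simp: divisors_def)

lemma keys_push_lift: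
  assumes "D \<in> divisors (curve_at G w s)"
  shows "Poly_Mapping.keys (push (lift_point s) D) \<subseteq> half_open_points G"
  using assms keys_push[of "lift_point s" D] lift_point_half_open by (fastforce simp: divisors_def)

text \<open>The flow is constructed on the connected graph \<open>G\<close> for a lift of
  \<open>D\<close> and then summed over classes, so connectedness is used upstairs only.\<close>

lemma curve_at_rel_exists:
  assumes conn: "Digraph_Component.connected G" and D: "D \<in> divisors (curve_at G w s)" and deg: "divisor_degree D = 0"
  obtains z where "z \<in> H1R Gs" "curve_rel (curve_at G w s) D (\<lambda>e. s e * z e)"
proof -
  interpret M: metric_graph "curve_at G w s" by (rule metric_graph_curve_at)
  define E where "E = push (lift_point s) D"
  have E: "Poly_Mapping.keys E \<subseteq> half_open_points G" unfolding E_def using D by (rule keys_push_lift)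
  have hd: "head_point G p \<in> verts G" if "p \<in> Poly_Mapping.keys E" for p
    using E that by (auto simp: half_open_points_def)
  obtain r where r: "r \<in> verts G" using conn by (auto simp: connected_def strongly_connected_def)
  have "\<exists>m::'e \<Rightarrow> int. (\<forall>e. e \<notin> arcs G \<longrightarrow> m e = 0) \<and> (\<forall>x\<in>verts G. net_inflow G m x = \<lfloor>head_degree G x E\<rfloor>)"
  proof (rule integral_flow_exists[of "\<lambda>_. r"])
    fix v assume "v \<in> verts G"
    then show "r \<rightarrow>\<^sup>*\<^bsub>with_proj (mk_symmetric G)\<^esub> v"
      using conn r by (auto simp: connected_def strongly_connected_def)
  next
    fix x assume "x \<in> verts G"
    have "(\<Sum>v\<in>verts G. head_degree G v E) = of_int (divisor_degree E)"
      unfolding divisor_degree_wsum head_degree_def wsum_weight_sum[symmetric]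
      by (intro wsum_cong) (simp add: hd)
    then have "real_of_int (\<Sum>v\<in>verts G. \<lfloor>head_degree G v E\<rfloor>) = 0"
      using head_degree_Ints[of G _ E] by (simp add: E_def divisor_degree_push deg of_int_floor_cancel)
    then have "(\<Sum>v\<in>verts G. \<lfloor>head_degree G v E\<rfloor>) = 0" by linarith
    then show "(\<Sum>v\<in>{v \<in> verts G. r = x}. \<lfloor>head_degree G v E\<rfloor>) = 0"
      by (cases "r = x") simp_all
  qed
  then obtain m :: "'e \<Rightarrow> int" where m: "\<And>x. x \<in> verts G \<Longrightarrow> net_inflow G m x = \<lfloor>head_degree G x E\<rfloor>" by blast
  have "head_degree Gs V D = of_int (net_inflow Gs m V)" if V: "V \<in> verts Gs" for V
  proof -
    have "head_degree Gs V D = (\<Sum>v\<in>V. head_degree G v E)"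
      using head_degree_contract[OF E V] push_contract_lift[OF D] by (simp add: E_def)
    also have "\<dots> = of_int (net_inflow Gs m V)"
      using class_subset[OF V] head_degree_Ints[of G _ E]
      by (simp add: net_inflow_contracted[OF V] m of_int_floor_cancel subset_iff)
    finally show ?thesis .
  qed
  then show thesis
    using M.curve_rel_exists[of D m] that by auto
qed

end

section \<open>The curve with all lengths 1 and the base point\<close>

lemma collapsed_rel_ones: "collapsed_rel G (ones G) = Id_on (verts G)"
proof -
  have 1: "arcs (collapsed_graph G (ones G)) = {}" "verts (collapsed_graph G (ones G)) = verts G"
    by (auto simp: collapsed_graph_def ones_def indicator_def)
  have "u = v \<and> u \<in> verts G" if "(u, v) \<in> rtrancl_on (verts G) {}" for u v
    using that by induction auto
  then show ?thesis
    unfolding collapsed_rel_def reachable_def by (auto simp: parcs_mk_symmetric 1)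
qed

lemma ones_eq: "e \<in> arcs G \<Longrightarrow> ones G e = 1"
  by (simp add: ones_def)

lemma ones_pos_iff: "0 < ones G e \<longleftrightarrow> e \<in> arcs G"
  by (simp add: ones_def indicator_def)

lemma ones_cone: "ones G \<in> length_cone G"
  by (auto simp: length_cone_def ones_def indicator_def)

lemma H1R_contracted_ones:
  assumes "fin_digraph G"
  shows "H1R (contracted_graph G (ones G)) = H1R G"
proof -
  interpret contraction G "ones G" by (intro contraction.intro assms ones_cone)
  have v: "verts Gs = (\<lambda>v. {v}) ` verts G"
    by (auto simp: collapsed_rel_ones quotient_def)
  have a: "arcs Gs = arcs G" by (auto simp: ones_pos_iff)
  have "(\<forall>V\<in>verts Gs. net_inflow Gs z V = 0) \<longleftrightarrow> (\<forall>v\<in>verts G. net_inflow G z v = 0)" for z :: "_ \<Rightarrow> real"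
  proof -
    have "(\<forall>V\<in>verts Gs. net_inflow Gs z V = 0) \<longleftrightarrow> (\<forall>V\<in>verts Gs. (\<Sum>v\<in>V. net_inflow G z v) = 0)"
      by (simp add: net_inflow_contracted del: contracted_graph_simps)
    then show ?thesis unfolding v by simp
  qed
  then show ?thesis unfolding H1R_iff set_eq_iff a by blast
qed

text \<open>Replaces the moving base point by the contraction of one fixed point of
  \<open>G\<close>, so that the base divisor stays constant along sequences of parameters.\<close>

lemma rescale_eq_contract_lift:
  assumes "p \<in> points (curve_at G w (ones G))" and s: "s \<in> length_cone G"
  shows "rescale G s p = contract_point G s (lift_point (ones G) p)"
proof -
  from assms consider v where "p = Vertex {v}" "v \<in> verts G" | e t where "p = Interior e t" "e \<in> arcs G" "0 < t" "t < 1"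
    by (auto simp: points_def curve_at_def contracted_graph_def collapsed_rel_ones quotient_def ones_eq)
  then show ?thesis
  proof cases
    case 1
    then show ?thesis by (simp add: rescale_def lift_point_def contract_point_def)
  next
    case 2
    then have "0 \<le> s e" using s by (simp add: length_cone_def)
    with 2 show ?thesis
      by (cases "s e = 0") (auto simp: rescale_def lift_point_def contract_point_def edge_point_def curve_at_def
          contracted_graph_def ones_eq mult_le_0_iff)
  qed
qed


section \<open>The rank of a divisor on a weighted curve\<close>

lemma (in fin_digraph) net_inflow_eq_sum:
  fixes m :: "'b \<Rightarrow> 'c::comm_ring_1"
  assumes "v \<in> verts G"
  shows "net_inflow G m v = (\<Sum>e\<in>arcs G. ((if head G e = v then 1 else 0) - (if tail G e = v then 1 else 0)) * m e)"
  using summation_by_parts[of "\<lambda>x. if x = v then 1 else 0" m] assms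
  by (simp add: if_distrib[of "\<lambda>x. x * _"] cong: if_cong)

lemma sum_const_frag: "finite A \<Longrightarrow> (\<Sum>i\<in>A. x) = frag_cmul (int (card A)) x"
  by (induction A rule: finite_induct) (simp_all add: frag_cmul_distrib)

context metric_graph
begin

lemma curve_rel_degree:
  assumes "(D, D') \<in> lin_equiv \<Gamma>"
  shows "divisor_degree D' = divisor_degree D"
proof -
  have D: "D \<in> divisors \<Gamma>" "D' \<in> divisors \<Gamma>" "curve_rel \<Gamma> (D' - D) (\<lambda>_. 0)"
    using assms by (simp_all add: lin_equiv_iff_curve_rel)
  have "divisor_degree (D' - D) = 0"
    using abel_rel_degree[OF D(3)] divisors_diff[OF D(2,1)] head_point_in_verts by (auto simp: divisors_def)
  then have "real_of_int (divisor_degree D') = of_int (divisor_degree D)"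
    using divisor_degree_wsum[of "D' - D"] by (simp add: divisor_degree_wsum)
  then show ?thesis by linarith
qed

text \<open>The predicate under \<open>GREATEST\<close> is closed downwards, since a test divisor
  can be enlarged by chips at a vertex, and it is bounded, since an effective divisor contains no
  divisor of larger degree. So \<open>GREATEST\<close> is a true maximum whenever the predicate
  holds for some number.\<close>

lemma pure_rank_ge_iff:
  assumes "verts (curve_graph \<Gamma>) \<noteq> {}"
  shows "int r \<le> pure_rank \<Gamma> D \<longleftrightarrow> (\<forall>E\<in>divisors \<Gamma>. effective E \<and> divisor_degree E = int r \<longrightarrow>
    (\<exists>D'. (D, D') \<in> lin_equiv \<Gamma> \<and> effective D' \<and> divisor_contains D' E))"
proof -
  define P where "P = (\<lambda>r. \<forall>E\<in>divisors \<Gamma>. effective E \<and> divisor_degree E = int r \<longrightarrow>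
    (\<exists>D'. (D, D') \<in> lin_equiv \<Gamma> \<and> effective D' \<and> divisor_contains D' E))"
  obtain v where "v \<in> verts (curve_graph \<Gamma>)" using assms by blast
  then have v: "Vertex v \<in> points \<Gamma>" by (simp add: points_def)
  define X where "X = (\<lambda>n::nat. frag_cmul (int n) (frag_of (Vertex v :: ('v, 'e) point)))"
  have X: "X n \<in> divisors \<Gamma>" "effective (X n)" "wsum (\<lambda>_. 1) (X n) = real n" for n
    using v by (auto simp: X_def intro: divisors_cmul effective_cmul)
  have degX: "divisor_degree (E + X n) = divisor_degree E + int n" for E n
  proof -
    have "real_of_int (divisor_degree (E + X n)) = of_int (divisor_degree E + int n)"
      using X(3)[of n] by (simp add: divisor_degree_wsum)
    then show ?thesis by linarith
  qed
  have degX0: "divisor_degree (X n) = int n" for n using degX[of 0 n] by (simp add: divisor_degree_def)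
  have ex: "\<exists>D'. (D, D') \<in> lin_equiv \<Gamma> \<and> effective D'" if "P n" for n
    using that X[of n] degX0 unfolding P_def by blast
  have bound: "n \<le> nat (divisor_degree D)" if P: "P n" for n
  proof -
    obtain D' where D': "(D, D') \<in> lin_equiv \<Gamma>" "effective (D' - X n)"
      using P X[of n] degX0 unfolding P_def divisor_contains_def by blast
    have "0 \<le> wsum (\<lambda>_. 1) (D' - X n)" by (rule effective_wsum_nonneg[OF D'(2)]) simp
    then have "real n \<le> of_int (divisor_degree D')" by (simp add: divisor_degree_wsum X(3))
    then show ?thesis using curve_rel_degree[OF D'(1)] by linarith
  qed
  have down: "P n" if Pm: "P m" and nm: "n \<le> m" for n m
    unfolding P_def
  proof (intro ballI impI)
    fix E assume E: "E \<in> divisors \<Gamma>" "effective E \<and> divisor_degree E = int n"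
    have "E + X (m - n) \<in> divisors \<Gamma>" "effective (E + X (m - n))" "divisor_degree (E + X (m - n)) = int m"
      using E X[of "m - n"] nm by (auto intro: divisors_add effective_add simp: degX)
    then obtain D' where D': "(D, D') \<in> lin_equiv \<Gamma>" "effective D'" "effective (D' - (E + X (m - n)))"
      using Pm unfolding P_def divisor_contains_def by blast
    have "effective (D' - E)"
      using effective_add[OF D'(3) X(2)[of "m - n"]] by (simp add: algebra_simps)
    then show "\<exists>D'. (D, D') \<in> lin_equiv \<Gamma> \<and> effective D' \<and> divisor_contains D' E"
      using D' by (auto simp: divisor_contains_def)
  qed
  have "int r \<le> pure_rank \<Gamma> D \<longleftrightarrow> P r"
  proof
    assume r: "int r \<le> pure_rank \<Gamma> D"
    then have ex: "\<exists>D'. (D, D') \<in> lin_equiv \<Gamma> \<and> effective D'"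
      unfolding pure_rank_def by (auto split: if_splits)
    have P0: "P 0"
      unfolding P_def
    proof (intro ballI impI)
      fix E :: "('v, 'e) divisor" assume E: "E \<in> divisors \<Gamma>" "effective E \<and> divisor_degree E = int 0"
      then have "E = 0" using effective_eq_sum_points[of E 0] by auto
      then show "\<exists>D'. (D, D') \<in> lin_equiv \<Gamma> \<and> effective D' \<and> divisor_contains D' E"
        using ex by (auto simp: divisor_contains_def)
    qed
    have "pure_rank \<Gamma> D = int (GREATEST r. P r)" using ex by (simp add: pure_rank_def P_def)
    then have "r \<le> (GREATEST r. P r)" using r by simp
    moreover have "P (GREATEST r. P r)"
      using P0 bound by (rule GreatestI_nat)
    ultimately show "P r" by (rule down[rotated])
  next
    assume "P r"
    then have "pure_rank \<Gamma> D = int (GREATEST r. P r)" using ex by (simp add: pure_rank_def P_def)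
    then show "int r \<le> pure_rank \<Gamma> D" using Greatest_le_nat[of P r, OF \<open>P r\<close> bound] by simp
  qed
  then show ?thesis by (simp add: P_def)
qed

end

section \<open>Weights as attached loops\<close>

locale weighted_curve = metric_graph \<Gamma> for \<Gamma> :: "('v, 'e) tropical_curve" +
  fixes \<epsilon> :: real
  assumes eps_pos: "0 < \<epsilon>"
begin

abbreviation "\<Gamma>\<epsilon> \<equiv> attach_loops \<epsilon> \<Gamma>"
abbreviation "loops \<equiv> SIGMA v : verts (curve_graph \<Gamma>). {..<curve_weight \<Gamma> v}"
abbreviation embed :: "('v, 'e) point \<Rightarrow> ('v, 'e + 'v \<times> nat) point" where
  "embed \<equiv> map_point id Inl"

definition retract :: "('v, 'e + 'v \<times> nat) point \<Rightarrow> ('v, 'e) point" where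
  "retract p = (case p of Vertex v \<Rightarrow> Vertex v |
     Interior e t \<Rightarrow> (case e of Inl e \<Rightarrow> Interior e t | Inr l \<Rightarrow> Vertex (fst l)))"

lemma attach_loops_simps [simp]:
  "verts (curve_graph \<Gamma>\<epsilon>) = verts (curve_graph \<Gamma>)"
  "arcs (curve_graph \<Gamma>\<epsilon>) = Inl ` arcs (curve_graph \<Gamma>) \<union> Inr ` loops"
  "tail (curve_graph \<Gamma>\<epsilon>) (Inl e) = tail (curve_graph \<Gamma>) e" "tail (curve_graph \<Gamma>\<epsilon>) (Inr l) = fst l"
  "head (curve_graph \<Gamma>\<epsilon>) (Inl e) = head (curve_graph \<Gamma>) e" "head (curve_graph \<Gamma>\<epsilon>) (Inr l) = fst l"
  "edge_length \<Gamma>\<epsilon> (Inl e) = edge_length \<Gamma> e" "edge_length \<Gamma>\<epsilon> (Inr l) = \<epsilon>"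
  by (simp_all add: attach_loops_def)

lemma retract_simps [simp]:
  "retract (Vertex v) = Vertex v" "retract (Interior (Inl e) t) = Interior e t"
  "retract (Interior (Inr l) t) = Vertex (fst l)"
  by (simp_all add: retract_def)

lemma finite_loops: "finite loops"
  by auto

sublocale L: metric_graph \<Gamma>\<epsilon>
  by unfold_locales (use length_pos eps_pos in auto)

lemma point_cases:
  obtains v where "p = Vertex v" | e t where "p = Interior (Inl e) t" | l t where "p = Interior (Inr l) t"
  by (metis point.exhaust sum.exhaust)

lemma retract_embed [simp]: "retract (embed p) = p"
  by (cases p) auto

lemma head_point_retract [simp]: "head_point (curve_graph \<Gamma>) (retract p) = head_point (curve_graph \<Gamma>\<epsilon>) p"
  by (cases p rule: point_cases) auto

lemma head_point_embed [simp]: "head_point (curve_graph \<Gamma>\<epsilon>) (embed p) = head_point (curve_graph \<Gamma>) p"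
  by (cases p) auto

lemma retract_in_points: "p \<in> points \<Gamma>\<epsilon> \<Longrightarrow> retract p \<in> points \<Gamma>"
  by (cases p rule: point_cases) (auto simp: points_def)

lemma embed_in_points: "p \<in> points \<Gamma> \<Longrightarrow> embed p \<in> points \<Gamma>\<epsilon>"
  by (cases p) (auto simp: points_def)

lemma push_retract_divisors: "D \<in> divisors \<Gamma>\<epsilon> \<Longrightarrow> push retract D \<in> divisors \<Gamma>"
  using keys_push[of retract D] retract_in_points by (fastforce simp: divisors_def)

lemma push_embed_divisors: "D \<in> divisors \<Gamma> \<Longrightarrow> push embed D \<in> divisors \<Gamma>\<epsilon>"
  using keys_push[of embed D] embed_in_points by (fastforce simp: divisors_def)

lemma push_retract_embed: "push retract (push embed D) = D"
  unfolding push_push by (rule push_id) simp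

lemma head_degree_retract: "head_degree (curve_graph \<Gamma>) v (push retract D) = head_degree (curve_graph \<Gamma>\<epsilon>) v D"
  by (simp add: head_degree_def)

lemma head_degree_embed: "head_degree (curve_graph \<Gamma>\<epsilon>) v (push embed D) = head_degree (curve_graph \<Gamma>) v D"
  by (simp add: head_degree_def)

text \<open>A loop enters and leaves its base vertex with the same slope.\<close>

lemma net_inflow_attach:
  assumes v: "v \<in> verts (curve_graph \<Gamma>)"
  shows "net_inflow (curve_graph \<Gamma>\<epsilon>) (m :: _ \<Rightarrow> 'a::comm_ring_1) v = net_inflow (curve_graph \<Gamma>) (\<lambda>e. m (Inl e)) v"
proof -
  let ?c = "\<lambda>e. ((if head (curve_graph \<Gamma>\<epsilon>) e = v then 1 else 0) - (if tail (curve_graph \<Gamma>\<epsilon>) e = v then 1 else 0)) * m e"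
  have "net_inflow (curve_graph \<Gamma>\<epsilon>) m v = (\<Sum>e\<in>Inl ` arcs (curve_graph \<Gamma>) \<union> Inr ` loops. ?c e)"
    using L.net_inflow_eq_sum[of v m] v by simp
  also have "\<dots> = (\<Sum>e\<in>Inl ` arcs (curve_graph \<Gamma>). ?c e) + (\<Sum>e\<in>Inr ` loops. ?c e)"
    by (rule sum.union_disjoint) auto
  also have "(\<Sum>e\<in>Inr ` loops. ?c e) = 0"
    by (rule sum.neutral) auto
  also have "(\<Sum>e\<in>Inl ` arcs (curve_graph \<Gamma>). ?c e) = net_inflow (curve_graph \<Gamma>) (\<lambda>e. m (Inl e)) v"
    by (subst sum.reindex) (simp_all add: net_inflow_eq_sum[OF v])
  finally show ?thesis by simp
qed

lemma edge_moment_retract: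
  "edge_moment (\<lambda>e t. edge_length \<Gamma> e - t) e (push retract D) = edge_moment (\<lambda>e t. edge_length \<Gamma>\<epsilon> e - t) (Inl e) D"
  unfolding edge_moment_def wsum_push
proof (rule wsum_cong)
  fix p
  show "(case retract p of Vertex _ \<Rightarrow> 0 | Interior e' t \<Rightarrow> if e' = e then edge_length \<Gamma> e - t else 0) =
    (case p of Vertex _ \<Rightarrow> 0 | Interior e' t \<Rightarrow> if e' = Inl e then edge_length \<Gamma>\<epsilon> (Inl e) - t else 0)"
    by (cases p rule: point_cases) auto
qed

lemma edge_moment_embed:
  "edge_moment (\<lambda>e t. edge_length \<Gamma>\<epsilon> e - t) e' (push embed D) =
    (case e' of Inl e \<Rightarrow> edge_moment (\<lambda>e t. edge_length \<Gamma> e - t) e D | Inr l \<Rightarrow> 0)"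
proof (cases e')
  case (Inl e)
  show ?thesis
    using edge_moment_retract[of e "push embed D"] by (simp add: push_retract_embed Inl)
next
  case (Inr l)
  have "edge_moment (\<lambda>e t. edge_length \<Gamma>\<epsilon> e - t) e' (push embed D) = wsum (\<lambda>_. 0) D"
    unfolding edge_moment_def wsum_push
  proof (rule wsum_cong)
    fix p :: "('v, 'e) point"
    show "(case embed p of Vertex _ \<Rightarrow> 0 | Interior e'' t \<Rightarrow> if e'' = e' then edge_length \<Gamma>\<epsilon> e' - t else 0) = 0"
      by (cases p) (auto simp: Inr)
  qed
  then show ?thesis by (simp add: Inr wsum_def)
qed

lemma curve_rel_retract:
  assumes "curve_rel \<Gamma>\<epsilon> D (\<lambda>_. 0)"
  shows "curve_rel \<Gamma> (push retract D) (\<lambda>_. 0)"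
proof -
  obtain \<phi> m where
    \<phi>: "\<And>e. e \<in> arcs (curve_graph \<Gamma>\<epsilon>) \<Longrightarrow> \<phi> (head (curve_graph \<Gamma>\<epsilon>) e) - \<phi> (tail (curve_graph \<Gamma>\<epsilon>) e) =
       of_int (m e) * edge_length \<Gamma>\<epsilon> e - edge_moment (\<lambda>e t. edge_length \<Gamma>\<epsilon> e - t) e D - 0"
    and m: "\<And>v. v \<in> verts (curve_graph \<Gamma>\<epsilon>) \<Longrightarrow> head_degree (curve_graph \<Gamma>\<epsilon>) v D = of_int (net_inflow (curve_graph \<Gamma>\<epsilon>) m v)"
    using assms by (rule abel_relE) blast
  show ?thesis
  proof (rule abel_relI[of _ \<phi> "\<lambda>e. m (Inl e)"])
    fix e assume "e \<in> arcs (curve_graph \<Gamma>)"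
    then show "\<phi> (head (curve_graph \<Gamma>) e) - \<phi> (tail (curve_graph \<Gamma>) e) =
        of_int (m (Inl e)) * edge_length \<Gamma> e - edge_moment (\<lambda>e t. edge_length \<Gamma> e - t) e (push retract D) - 0"
      using \<phi>[of "Inl e"] by (simp add: edge_moment_retract)
  next
    fix v assume "v \<in> verts (curve_graph \<Gamma>)"
    then show "head_degree (curve_graph \<Gamma>) v (push retract D) = of_int (net_inflow (curve_graph \<Gamma>) (\<lambda>e. m (Inl e)) v)"
      using m[of v] by (simp add: head_degree_retract net_inflow_attach)
  qed
qed

lemma curve_rel_embed:
  assumes "curve_rel \<Gamma> D (\<lambda>_. 0)"
  shows "curve_rel \<Gamma>\<epsilon> (push embed D) (\<lambda>_. 0)"
proof -
  obtain \<phi> m where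
    \<phi>: "\<And>e. e \<in> arcs (curve_graph \<Gamma>) \<Longrightarrow> \<phi> (head (curve_graph \<Gamma>) e) - \<phi> (tail (curve_graph \<Gamma>) e) =
       of_int (m e) * edge_length \<Gamma> e - edge_moment (\<lambda>e t. edge_length \<Gamma> e - t) e D - 0"
    and m: "\<And>v. v \<in> verts (curve_graph \<Gamma>) \<Longrightarrow> head_degree (curve_graph \<Gamma>) v D = of_int (net_inflow (curve_graph \<Gamma>) m v)"
    using assms by (rule abel_relE) blast
  show ?thesis
  proof (rule abel_relI[of _ \<phi> "case_sum m (\<lambda>_. 0)"])
    fix e assume "e \<in> arcs (curve_graph \<Gamma>\<epsilon>)"
    then show "\<phi> (head (curve_graph \<Gamma>\<epsilon>) e) - \<phi> (tail (curve_graph \<Gamma>\<epsilon>) e) =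
        of_int (case_sum m (\<lambda>_. 0) e) * edge_length \<Gamma>\<epsilon> e - edge_moment (\<lambda>e t. edge_length \<Gamma>\<epsilon> e - t) e (push embed D) - 0"
      using \<phi> by (auto simp: edge_moment_embed)
  next
    fix v assume "v \<in> verts (curve_graph \<Gamma>\<epsilon>)"
    then show "head_degree (curve_graph \<Gamma>\<epsilon>) v (push embed D) = of_int (net_inflow (curve_graph \<Gamma>\<epsilon>) (case_sum m (\<lambda>_. 0)) v)"
      using m[of v] by (simp add: head_degree_embed net_inflow_attach)
  qed
qed

text \<open>A loop at \<open>v\<close> on which \<open>E\<close> has \<open>a > 0\<close> chips can be served by \<open>a + 1\<close> chips at \<open>v\<close>: \<open>a\<close> of them
  are moved to the chips of \<open>E\<close> and the last one is the remainder \<open>y\<close> in the circle group.\<close>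

lemma divisor_rank_geI:
  assumes ne: "verts (curve_graph \<Gamma>) \<noteq> {}" and D: "D \<in> divisors \<Gamma>"
    and ex: "\<And>k E. (\<And>v. v \<in> verts (curve_graph \<Gamma>) \<Longrightarrow> k v \<le> curve_weight \<Gamma> v) \<Longrightarrow> E \<in> divisors \<Gamma> \<Longrightarrow> effective E \<Longrightarrow>
      divisor_degree E + int (\<Sum>v\<in>verts (curve_graph \<Gamma>). k v) = int r \<Longrightarrow>
      \<exists>D'\<in>divisors \<Gamma>. curve_rel \<Gamma> (D' - D) (\<lambda>_. 0) \<and>
        effective (D' - E - (\<Sum>v\<in>verts (curve_graph \<Gamma>). frag_cmul (2 * int (k v)) (frag_of (Vertex v))))"
  shows "int r \<le> divisor_rank \<epsilon> \<Gamma> D"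
proof -
  have "\<exists>D'. (push embed D, D') \<in> lin_equiv \<Gamma>\<epsilon> \<and> effective D' \<and> divisor_contains D' E"
    if E: "E \<in> divisors \<Gamma>\<epsilon>" "effective E" "divisor_degree E = int r" for E
  proof -
    define \<Lambda> where "\<Lambda> = {l. \<exists>t. Interior (Inr l) t \<in> Poly_Mapping.keys E}"
    have keysE: "Poly_Mapping.keys E \<subseteq> points \<Gamma>\<epsilon>" using E by (simp add: divisors_def)
    have \<Lambda>: "\<Lambda> \<subseteq> loops" using keysE by (fastforce simp: \<Lambda>_def points_def)
    have fin\<Lambda>: "finite \<Lambda>" using finite_subset[OF \<Lambda> finite_loops] .
    have "\<forall>l\<in>\<Lambda>. \<exists>t. Interior (Inr l) t \<in> Poly_Mapping.keys E" by (simp add: \<Lambda>_def)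
    from bchoice[OF this] obtain \<tau> where \<tau>: "\<And>l. l \<in> \<Lambda> \<Longrightarrow> Interior (Inr l) (\<tau> l) \<in> Poly_Mapping.keys E" by blast
    define F where "F = (\<Sum>l\<in>\<Lambda>. frag_of (Interior (Inr l :: 'e + 'v \<times> nat) (\<tau> l) :: ('v, 'e + 'v \<times> nat) point))"
    define V\<Lambda> :: "('v, 'e) divisor" where "V\<Lambda> = (\<Sum>l\<in>\<Lambda>. frag_of (Vertex (fst l)))"
    have EF: "effective (E - F)"
      unfolding effective_def
    proof
      fix q
      have l: "Poly_Mapping.lookup F q = (\<Sum>l\<in>\<Lambda>. if q = Interior (Inr l) (\<tau> l) then 1 else 0)"
        by (simp add: F_def lookup_sum)
      show "0 \<le> Poly_Mapping.lookup (E - F) q"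
      proof (cases "\<exists>l\<in>\<Lambda>. q = Interior (Inr l) (\<tau> l)")
        case True
        then obtain l where l': "l \<in> \<Lambda>" "q = Interior (Inr l) (\<tau> l)" by blast
        then have "Poly_Mapping.lookup F q = (\<Sum>l'\<in>\<Lambda>. if l' = l then 1 else 0)"
          unfolding l by (intro sum.cong) auto
        also have "\<dots> = 1" using l' fin\<Lambda> by simp
        finally have "Poly_Mapping.lookup F q = 1" .
        moreover have "0 < Poly_Mapping.lookup E q"
          using \<tau>[OF l'(1)] l'(2) E(2) by (auto simp: effective_def in_keys_iff order.strict_iff_order)
        ultimately show ?thesis by (simp add: lookup_minus)
      next
        case False
        then have "Poly_Mapping.lookup F q = 0" unfolding l by (intro sum.neutral) auto
        then show ?thesis using E(2) by (simp add: lookup_minus effective_def)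
      qed
    qed
    have pushF: "push retract F = V\<Lambda>"
      by (simp add: F_def V\<Lambda>_def frag_extend_sum[OF fin\<Lambda>] comp_def)
    \<comment> \<open>Each loop carrying chips of \<open>E\<close> uses one unit of
      \<open>k\<close>, paid for by taking one chip out of \<open>E0\<close>, so the degrees still
      add up to \<open>r\<close>. Since \<open>2 * k v\<close> chips come back, the net gain over
      the retracted \<open>E\<close> is one extra chip per such loop.\<close>
    define k where "k = (\<lambda>v. card {l\<in>\<Lambda>. fst l = v})"
    define E0 where "E0 = push retract E - V\<Lambda>"
    have "k v \<le> curve_weight \<Gamma> v" for v
    proof -
      have "{l\<in>\<Lambda>. fst l = v} \<subseteq> Pair v ` {..<curve_weight \<Gamma> v}" using \<Lambda> by auto
      from card_mono[OF _ this] show ?thesis by (simp add: k_def card_image inj_on_def)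
    qed
    moreover have "V\<Lambda> \<in> divisors \<Gamma>"
      unfolding V\<Lambda>_def using \<Lambda> by (intro divisors_sum) (auto simp: points_def)
    moreover have "E0 \<in> divisors \<Gamma>"
      unfolding E0_def using calculation(2) push_retract_divisors[OF E(1)] by (rule divisors_diff[rotated])
    moreover have "effective E0"
      using effective_push[OF EF, of retract] by (simp add: E0_def frag_extend_diff pushF)
    moreover have cardk: "(\<Sum>v\<in>verts (curve_graph \<Gamma>). k v) = card \<Lambda>"
    proof -
      have "(\<Sum>v\<in>verts (curve_graph \<Gamma>). \<Sum>l\<in>{l\<in>\<Lambda>. fst l = v}. 1) = (\<Sum>l\<in>\<Lambda>. (1::nat))"
        using \<Lambda> by (intro sum.group fin\<Lambda>) auto
      then show ?thesis by (simp add: k_def)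
    qed
    moreover have "divisor_degree E0 + int (\<Sum>v\<in>verts (curve_graph \<Gamma>). k v) = int r"
    proof -
      have "real_of_int (divisor_degree E0 + int (\<Sum>v\<in>verts (curve_graph \<Gamma>). k v)) = of_int (divisor_degree E)"
        unfolding cardk by (simp add: divisor_degree_wsum E0_def V\<Lambda>_def)
      then show ?thesis using E(3) by linarith
    qed
    ultimately obtain D' where D': "D' \<in> divisors \<Gamma>" "curve_rel \<Gamma> (D' - D) (\<lambda>_. 0)"
      and eff: "effective (D' - E0 - (\<Sum>v\<in>verts (curve_graph \<Gamma>). frag_cmul (2 * int (k v)) (frag_of (Vertex v))))"
      using ex[of k E0] by blast
    have "(\<Sum>v\<in>verts (curve_graph \<Gamma>). frag_cmul (int (k v)) (frag_of (Vertex v :: ('v, 'e) point))) =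
        (\<Sum>v\<in>verts (curve_graph \<Gamma>). \<Sum>l\<in>{l\<in>\<Lambda>. fst l = v}. frag_of (Vertex (fst l)))"
    proof (intro sum.cong refl)
      fix v
      have "(\<Sum>l\<in>{l\<in>\<Lambda>. fst l = v}. frag_of (Vertex (fst l) :: ('v, 'e) point)) = (\<Sum>l\<in>{l\<in>\<Lambda>. fst l = v}. frag_of (Vertex v))"
        by (intro sum.cong) auto
      then show "frag_cmul (int (k v)) (frag_of (Vertex v :: ('v, 'e) point)) = (\<Sum>l\<in>{l\<in>\<Lambda>. fst l = v}. frag_of (Vertex (fst l)))"
        using fin\<Lambda> by (simp add: sum_const_frag k_def)
    qed
    also have "\<dots> = V\<Lambda>"
      unfolding V\<Lambda>_def using \<Lambda> by (intro sum.group fin\<Lambda>) auto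
    finally have kV: "(\<Sum>v\<in>verts (curve_graph \<Gamma>). frag_cmul (int (k v)) (frag_of (Vertex v))) = V\<Lambda>" .
    have "(\<Sum>v\<in>verts (curve_graph \<Gamma>). frag_cmul (2 * int (k v)) (frag_of (Vertex v))) = frag_cmul 2 V\<Lambda>"
      by (simp add: kV[symmetric] frag_cmul_sum)
    also have "frag_cmul 2 V\<Lambda> = V\<Lambda> + V\<Lambda>"
      using frag_cmul_distrib[of 1 1 V\<Lambda>] by simp
    finally have eff': "effective (D' - push retract E - V\<Lambda>)"
      using eff by (simp add: E0_def algebra_simps)
    define S where "S = (\<lambda>l. edge_moment (\<lambda>e t. edge_length \<Gamma>\<epsilon> e - t) (Inr l) E)"
    \<comment> \<open>The position that the extra chip has to take on the circle of length
      \<open>\<epsilon>\<close>: the total moment of the chips of \<open>E\<close> on the loop,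
      modulo \<open>\<epsilon>\<close>.\<close>
    define y where "y = (\<lambda>l. S l - \<epsilon> * of_int \<lfloor>S l / \<epsilon>\<rfloor>)"
    have y: "0 \<le> y l" "y l < \<epsilon>" for l
    proof -
      have "of_int \<lfloor>S l / \<epsilon>\<rfloor> \<le> S l / \<epsilon>" "S l / \<epsilon> < of_int \<lfloor>S l / \<epsilon>\<rfloor> + 1" by linarith+
      then show "0 \<le> y l" "y l < \<epsilon>"
        using eps_pos mult_left_mono[of "of_int \<lfloor>S l / \<epsilon>\<rfloor>" "S l / \<epsilon>" \<epsilon>] by (simp_all add: y_def field_simps)
    qed
    define Y where "Y = (\<lambda>l. edge_point \<Gamma>\<epsilon> (Inr l) (y l))"
    define T where "T = E - push embed (push retract E) + (\<Sum>l\<in>\<Lambda>. frag_of (Y l) - frag_of (Vertex (fst l)))"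
    have Y_cases: "Y l = (if y l = 0 then Vertex (fst l) else Interior (Inr l) (y l))" for l
      using y[of l] by (auto simp: Y_def edge_point_def)
    have Sout: "S l = 0" if "l \<notin> \<Lambda>" for l
    proof -
      have "S l = wsum (\<lambda>_. 0) E"
        unfolding S_def edge_moment_def using that
        by (intro wsum_cong) (auto simp: \<Lambda>_def split: point.split)
      then show ?thesis by (simp add: wsum_def)
    qed
    have T: "curve_rel \<Gamma>\<epsilon> T (\<lambda>_. 0)"
    \<comment> \<open>For \<open>y l = 0\<close> the extra chip stays at the base vertex and has
      moment 0; otherwise its moment is \<open>\<epsilon> - y l\<close>, which accounts for the
      additional 1 in the slope.\<close>
    proof (rule abel_relI[of _ "\<lambda>_. 0" "case_sum (\<lambda>_. 0) (\<lambda>l. if l \<in> \<Lambda> then \<lfloor>S l / \<epsilon>\<rfloor> + (if y l = 0 then 0 else 1) else 0)"])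
      fix e assume "e \<in> arcs (curve_graph \<Gamma>\<epsilon>)"
      show "(0::real) - 0 = of_int (case_sum (\<lambda>_. 0) (\<lambda>l. if l \<in> \<Lambda> then \<lfloor>S l / \<epsilon>\<rfloor> + (if y l = 0 then 0 else 1) else 0) e) * edge_length \<Gamma>\<epsilon> e -
          edge_moment (\<lambda>e t. edge_length \<Gamma>\<epsilon> e - t) e T - 0"
      proof (cases e)
        case (Inl e')
        have "edge_moment (\<lambda>e t. edge_length \<Gamma>\<epsilon> e - t) e (\<Sum>l\<in>\<Lambda>. frag_of (Y l) - frag_of (Vertex (fst l))) = 0"
          unfolding edge_moment_linear by (intro sum.neutral) (auto simp: Y_cases Inl)
        then show ?thesis
          by (simp add: T_def edge_moment_embed edge_moment_retract Inl)
      next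
        case (Inr l)
        have "edge_moment (\<lambda>e t. edge_length \<Gamma>\<epsilon> e - t) e (\<Sum>l\<in>\<Lambda>. frag_of (Y l) - frag_of (Vertex (fst l))) =
            (\<Sum>l'\<in>\<Lambda>. if l' = l then (if y l = 0 then 0 else \<epsilon> - y l) else 0)"
          unfolding edge_moment_linear by (intro sum.cong) (auto simp: Y_cases Inr)
        also have "\<dots> = (if l \<in> \<Lambda> then if y l = 0 then 0 else \<epsilon> - y l else 0)"
          using fin\<Lambda> by simp
        finally have "edge_moment (\<lambda>e t. edge_length \<Gamma>\<epsilon> e - t) e T = S l + (if l \<in> \<Lambda> then if y l = 0 then 0 else \<epsilon> - y l else 0)"
          by (simp add: T_def edge_moment_embed Inr S_def)
        then show ?thesis
          using Sout[of l] by (auto simp: Inr y_def algebra_simps)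
      qed
    next
      fix v assume v: "v \<in> verts (curve_graph \<Gamma>\<epsilon>)"
      have "head_degree (curve_graph \<Gamma>\<epsilon>) v T = 0"
        by (simp add: T_def head_degree_embed head_degree_retract Y_cases sum.neutral)
      then show "head_degree (curve_graph \<Gamma>\<epsilon>) v T = of_int (net_inflow (curve_graph \<Gamma>\<epsilon>)
          (case_sum (\<lambda>_. 0) (\<lambda>l. if l \<in> \<Lambda> then \<lfloor>S l / \<epsilon>\<rfloor> + (if y l = 0 then 0 else 1) else 0)) v)"
        using v by (simp add: net_inflow_attach)
    qed
    \<comment> \<open>The chips reserved at the base points, one extra per loop, are taken out of
      \<open>D'\<close> and replaced by \<open>E\<close> itself and the remainders \<open>Y\<close>.
      The difference is the principal divisor \<open>T\<close>.\<close>
    define D'' where "D'' = push embed (D' - push retract E - V\<Lambda>) + E + (\<Sum>l\<in>\<Lambda>. frag_of (Y l))"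
    have eV: "push embed V\<Lambda> = (\<Sum>l\<in>\<Lambda>. frag_of (Vertex (fst l)))"
      by (simp add: V\<Lambda>_def frag_extend_sum[OF fin\<Lambda>] comp_def)
    have "D'' - push embed D = push embed (D' - D) + T"
      unfolding D''_def T_def frag_extend_diff eV sum_subtractf by (simp add: algebra_simps)
    then have "curve_rel \<Gamma>\<epsilon> (D'' - push embed D) (\<lambda>_. 0)"
      using abel_rel_add[OF curve_rel_embed[OF D'(2)] T] by simp
    moreover have "D'' \<in> divisors \<Gamma>\<epsilon>"
      unfolding D''_def
    proof (intro divisors_add divisors_sum push_embed_divisors divisors_diff D'(1) push_retract_divisors E(1))
      show "V\<Lambda> \<in> divisors \<Gamma>" by fact
      fix l assume "l \<in> \<Lambda>"
      then show "frag_of (Y l) \<in> divisors \<Gamma>\<epsilon>"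
        using \<Lambda> L.edge_point_in_points[of "Inr l" "y l"] by (auto simp: Y_def)
    qed
    moreover have "effective (D'' - E)"
      using effective_add[OF effective_push[OF eff', of embed] effective_sum[of \<Lambda> "\<lambda>l. frag_of (Y l)"]]
      by (simp add: D''_def)
    moreover have "effective D''"
      using effective_add[OF calculation(3) E(2)] by simp
    ultimately show ?thesis
      using push_embed_divisors[OF D] by (auto simp: L.lin_equiv_iff_curve_rel divisor_contains_def)
  qed
  then show ?thesis
    unfolding divisor_rank_def using L.pure_rank_ge_iff[of r "push embed D"] ne by simp
qed

end


section \<open>Independent cycles and generic chips\<close>

text \<open>Gaussian elimination: an unknown \<open>k\<close> with \<open>a k f \<noteq> 0\<close>
  is eliminated by means of the equation \<open>f\<close>.\<close>

lemma homogeneous_system_nontrivial_solution: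
  fixes a :: "'j \<Rightarrow> 'e \<Rightarrow> real"
  assumes "finite F" "finite J" "card F < card J"
  shows "\<exists>c. (\<exists>j\<in>J. c j \<noteq> 0) \<and> (\<forall>e\<in>F. (\<Sum>j\<in>J. c j * a j e) = 0)"
  using assms
proof (induction F arbitrary: J a rule: finite_induct)
  case empty
  then obtain j where "j \<in> J" by fastforce
  then show ?case by (intro exI[of _ "\<lambda>_. 1"]) auto
next
  case (insert f F)
  show ?case
  proof (cases "\<forall>j\<in>J. a j f = 0")
    case True
    have "card F < card J" using insert by simp
    from insert.IH[OF insert.prems(1) this, of a] True show ?thesis by auto
  next
    case False
    then obtain k where k: "k \<in> J" "a k f \<noteq> 0" by blast
    define b where "b = (\<lambda>j e. a j e - a j f / a k f * a k e)"
    have "card F < card (J - {k})" using insert k by simp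
    from insert.IH[OF _ this, of b] insert.prems obtain c where
      c: "\<exists>j\<in>J - {k}. c j \<noteq> 0" "\<And>e. e \<in> F \<Longrightarrow> (\<Sum>j\<in>J - {k}. c j * b j e) = 0" by auto
    define c' where "c' = c(k := - (\<Sum>j\<in>J - {k}. c j * a j f / a k f))"
    have *: "(\<Sum>j\<in>J. c' j * a j e) = (\<Sum>j\<in>J - {k}. c j * b j e)" for e
    proof -
      have "(\<Sum>j\<in>J. c' j * a j e) = c' k * a k e + (\<Sum>j\<in>J - {k}. c' j * a j e)"
        using insert.prems k by (simp add: sum.remove)
      also have "(\<Sum>j\<in>J - {k}. c' j * a j e) = (\<Sum>j\<in>J - {k}. c j * a j e)"
        by (intro sum.cong) (auto simp: c'_def)
      also have "c' k * a k e = - (\<Sum>j\<in>J - {k}. c j * (a j f / a k f * a k e))"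
        by (simp add: c'_def sum_distrib_right sum_negf[symmetric] mult.assoc)
      finally show ?thesis by (simp add: b_def right_diff_distrib sum_subtractf)
    qed
    have "(\<Sum>j\<in>J - {k}. c j * b j f) = 0" using k by (intro sum.neutral) (simp add: b_def)
    moreover have "\<exists>j\<in>J. c' j \<noteq> 0" using c(1) by (auto simp: c'_def)
    ultimately show ?thesis using c(2) by (intro exI[of _ c']) (auto simp: *)
  qed
qed

text \<open>Once the other coordinates are fixed, a hyperplane with \<open>c k \<noteq> 0\<close>
  forbids a single value of \<open>x k\<close>, and countably many values do not exhaust an
  interval. Hyperplanes with \<open>c k = 0\<close> are left to the induction hypothesis.\<close>

lemma avoid_countably_many_hyperplanes:
  fixes lo hi :: "'j \<Rightarrow> real" and H :: "(('j \<Rightarrow> real) \<times> real) set"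
  assumes "finite J" "countable H" "\<And>j. j \<in> J \<Longrightarrow> lo j < hi j"
    and "\<And>c b. (c, b) \<in> H \<Longrightarrow> \<exists>j\<in>J. c j \<noteq> 0"
  shows "\<exists>x. (\<forall>j\<in>J. lo j < x j \<and> x j < hi j) \<and> (\<forall>(c, b)\<in>H. (\<Sum>j\<in>J. c j * x j) \<noteq> b)"
  using assms
proof (induction J arbitrary: H rule: finite_induct)
  case empty
  then have "H = {}" by auto
  then show ?case by simp
next
  case (insert k J)
  let ?H0 = "{(c, b) \<in> H. c k = 0}"
  have "\<exists>x. (\<forall>j\<in>J. lo j < x j \<and> x j < hi j) \<and> (\<forall>(c, b)\<in>?H0. (\<Sum>j\<in>J. c j * x j) \<noteq> b)"
  proof (rule insert.IH)
    show "countable ?H0" by (rule countable_subset[OF _ insert.prems(1)]) auto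
  qed (use insert.prems in auto)
  then obtain x where x: "\<And>j. j \<in> J \<Longrightarrow> lo j < x j \<and> x j < hi j"
    "\<And>c b. (c, b) \<in> H \<Longrightarrow> c k = 0 \<Longrightarrow> (\<Sum>j\<in>J. c j * x j) \<noteq> b" by auto
  let ?bad = "(\<lambda>(c, b). (b - (\<Sum>j\<in>J. c j * x j)) / c k) ` H"
  have "\<not> {lo k<..<hi k} \<subseteq> ?bad"
    using countable_subset[of "{lo k<..<hi k}" ?bad] insert.prems(1,2) uncountable_open_interval[of "lo k" "hi k"] by auto
  then obtain y where "y \<in> {lo k<..<hi k}" "y \<notin> ?bad" by blast
  then have y: "lo k < y" "y < hi k" "y \<notin> ?bad" by simp_all
  have "(\<Sum>j\<in>insert k J. c j * (x(k := y)) j) \<noteq> b" if "(c, b) \<in> H" for c b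
  proof -
    have eq: "(\<Sum>j\<in>insert k J. c j * (x(k := y)) j) = c k * y + (\<Sum>j\<in>J. c j * x j)"
      using insert.hyps by (simp, intro sum.cong) auto
    show ?thesis
    proof (cases "c k = 0")
      case True
      then show ?thesis using x(2)[OF that True] unfolding eq by simp
    next
      case False
      have "y \<noteq> (b - (\<Sum>j\<in>J. c j * x j)) / c k" using y(3) that by (metis (mono_tags, lifting) case_prod_conv image_eqI)
      then show ?thesis using False unfolding eq by (auto simp: field_simps)
    qed
  qed
  then show ?case
    using x(1) y(1,2) insert.hyps by (intro exI[of _ "x(k := y)"]) auto
qed

text \<open>Chips \<open>x j\<close> in general position on independent cycles can only be completed to a given class
  by a divisor \<open>R\<close> that has chips on as many edges as there are cycles: otherwise a linear
  combination of the cycles pairs to zero with \<open>R\<close>, and this fixes a linear combination of the \<open>x j\<close>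
  up to countably many values.\<close>

lemma (in metric_graph) generic_chips:
  assumes J: "finite J" "J \<subseteq> arcs (curve_graph \<Gamma>)"
    and \<gamma>: "\<And>j. j \<in> J \<Longrightarrow> \<gamma> j \<in> H1R (curve_graph \<Gamma>)"
    and dual: "\<And>i j. i \<in> J \<Longrightarrow> j \<in> J \<Longrightarrow> \<gamma> j i = (if i = j then 1 else 0)"
  shows "\<exists>x. (\<forall>j\<in>J. 0 < x j \<and> x j < edge_length \<Gamma> j) \<and>
    (\<forall>R. curve_rel \<Gamma> (C + (\<Sum>j\<in>J. frag_of (Interior j (x j))) + R) (\<lambda>_. 0) \<longrightarrow>
      (\<forall>J'\<subseteq>J. card J' \<le> card {e. (\<exists>t. Interior e t \<in> Poly_Mapping.keys R) \<and> (\<exists>j\<in>J'. \<gamma> j e \<noteq> 0)}))"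
proof -
  let ?G = "curve_graph \<Gamma>" and ?L = "edge_length \<Gamma>"
  let ?mom = "edge_moment (\<lambda>e t. ?L e - t)"
  \<comment> \<open>The finitely many ways to fail: \<open>F\<close> stands for the edges that carry
    chips of \<open>R\<close> and are met by the cycles of \<open>J'\<close>. A combination
    \<open>c\<close> is fixed for each pair before \<open>x\<close> and \<open>R\<close> are
    known.\<close>
  define I where "I = {(J', F). J' \<subseteq> J \<and> F \<subseteq> arcs ?G \<and> card F < card J'}"
  have "\<exists>c. (\<exists>j\<in>J. c j \<noteq> 0) \<and> (\<forall>j. j \<notin> J' \<longrightarrow> c j = 0) \<and> (\<forall>e\<in>F. (\<Sum>j\<in>J. c j * \<gamma> j e) = 0)"
    if "(J', F) \<in> I" for J' F
  proof -
    have *: "J' \<subseteq> J" "F \<subseteq> arcs ?G" "card F < card J'" using that by (auto simp: I_def)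
    then have fin: "finite J'" "finite F" using finite_subset[OF *(1) J(1)] finite_subset[OF *(2) finite_arcs] by simp_all
    from homogeneous_system_nontrivial_solution[OF fin(2,1) *(3), of \<gamma>] obtain c where
      c: "\<exists>j\<in>J'. c j \<noteq> 0" "\<And>e. e \<in> F \<Longrightarrow> (\<Sum>j\<in>J'. c j * \<gamma> j e) = 0" by blast
    define c' where "c' = (\<lambda>j. if j \<in> J' then c j else 0)"
    have "(\<Sum>j\<in>J. c' j * \<gamma> j e) = (\<Sum>j\<in>J'. c j * \<gamma> j e)" for e
      using *(1) J(1) by (intro sum.mono_neutral_cong_right) (auto simp: c'_def)
    then show ?thesis using c *(1) by (intro exI[of _ c']) (auto simp: c'_def)
  qed
  then have "\<forall>i\<in>I. \<exists>c. (\<exists>j\<in>J. c j \<noteq> 0) \<and> (\<forall>j. j \<notin> fst i \<longrightarrow> c j = 0) \<and> (\<forall>e\<in>snd i. (\<Sum>j\<in>J. c j * \<gamma> j e) = 0)"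
    by auto
  from bchoice[OF this] obtain c where c: "\<And>i. i \<in> I \<Longrightarrow> \<exists>j\<in>J. c i j \<noteq> 0"
    "\<And>i j. i \<in> I \<Longrightarrow> j \<notin> fst i \<Longrightarrow> c i j = 0"
    "\<And>i e. i \<in> I \<Longrightarrow> e \<in> snd i \<Longrightarrow> (\<Sum>j\<in>J. c i j * \<gamma> j e) = 0" by blast
  \<comment> \<open>The value that a completion with slopes \<open>m\<close> forces on the
    combination \<open>c i\<close> of the positions. It depends only on the restriction of
    \<open>m\<close> to the finitely many arcs, which leaves countably many values.\<close>
  define b where "b = (\<lambda>i (m :: 'e \<Rightarrow> int). \<Sum>j\<in>J. c i j * (?L j - (\<Sum>e\<in>arcs ?G. \<gamma> j e * (of_int (m e) * ?L e - ?mom e C))))"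
  define H where "H = (\<lambda>(i, m). (c i, b i m)) ` (I \<times> (arcs ?G \<rightarrow>\<^sub>E UNIV))"
  have "I \<subseteq> Pow J \<times> Pow (arcs ?G)" by (auto simp: I_def)
  then have "finite I" by (rule finite_subset) (simp add: J(1))
  then have "countable H"
    unfolding H_def by (intro countable_image countable_SIGMA countable_PiE) (auto intro: countable_finite)
  moreover have "\<exists>j\<in>J. d j \<noteq> 0" if "(d, e) \<in> H" for d e
    using that c(1) by (auto simp: H_def)
  ultimately obtain x where x: "\<And>j. j \<in> J \<Longrightarrow> 0 < x j \<and> x j < ?L j"
    and avoid: "\<And>d e. (d, e) \<in> H \<Longrightarrow> (\<Sum>j\<in>J. d j * x j) \<noteq> e"
    using avoid_countably_many_hyperplanes[OF J(1), of H "\<lambda>_. 0" ?L] J(2) length_pos by blast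
  have "card J' \<le> card {e. (\<exists>t. Interior e t \<in> Poly_Mapping.keys R) \<and> (\<exists>j\<in>J'. \<gamma> j e \<noteq> 0)}"
    if rel: "curve_rel \<Gamma> (C + (\<Sum>j\<in>J. frag_of (Interior j (x j))) + R) (\<lambda>_. 0)" and J': "J' \<subseteq> J" for R J'
  proof (rule ccontr)
    define F where "F = {e. (\<exists>t. Interior e t \<in> Poly_Mapping.keys R) \<and> (\<exists>j\<in>J'. \<gamma> j e \<noteq> 0)}"
    assume "\<not> card J' \<le> card F"
    moreover have "F \<subseteq> arcs ?G"
      using \<gamma> J' by (fastforce simp: F_def H1R_iff)
    ultimately have i: "(J', F) \<in> I" using J' by (simp add: I_def F_def)
    let ?i = "(J', F)" and ?X = "\<Sum>j\<in>J. frag_of (Interior j (x j) :: ('v, 'e) point)"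
    obtain \<phi> m where
      \<phi>: "\<And>e. e \<in> arcs ?G \<Longrightarrow> \<phi> (head ?G e) - \<phi> (tail ?G e) = of_int (m e) * ?L e - ?mom e (C + ?X + R) - 0"
      using rel by (rule abel_relE) blast
    have X: "?mom e ?X = (if e \<in> J then ?L e - x e else 0)" for e
      using J(1) by (simp cong: if_cong)
    \<comment> \<open>Pairing the gradient with \<open>\<gamma> j\<close> isolates the single
      position \<open>x j\<close>, because \<open>\<gamma> j\<close> vanishes on the other chosen
      edges.\<close>
    have 1: "(\<Sum>e\<in>arcs ?G. \<gamma> j e * (of_int (m e) * ?L e - ?mom e C)) - (?L j - x j) - (\<Sum>e\<in>arcs ?G. \<gamma> j e * ?mom e R) = 0"
      if j: "j \<in> J" for j
    proof -
      have "0 = (\<Sum>e\<in>arcs ?G. (\<phi> (head ?G e) - \<phi> (tail ?G e)) * \<gamma> j e)"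
        using potential_cycle_orthogonal[OF \<gamma>[OF j], of \<phi>] by simp
      also have "\<dots> = (\<Sum>e\<in>arcs ?G. \<gamma> j e * (of_int (m e) * ?L e - ?mom e C)
          - (if e \<in> J then \<gamma> j e * (?L e - x e) else 0) - \<gamma> j e * ?mom e R)"
        by (intro sum.cong refl) (simp only: \<phi> edge_moment_linear(2) X, simp add: algebra_simps)
      also have "\<dots> = (\<Sum>e\<in>arcs ?G. \<gamma> j e * (of_int (m e) * ?L e - ?mom e C))
          - (\<Sum>e\<in>J. \<gamma> j e * (?L e - x e)) - (\<Sum>e\<in>arcs ?G. \<gamma> j e * ?mom e R)"
        using J by (simp add: sum_subtractf sum.If_cases Int_absorb1)
      also have "(\<Sum>e\<in>J. \<gamma> j e * (?L e - x e)) = (\<Sum>e\<in>J. if e = j then ?L j - x j else 0)"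
        using dual j by (intro sum.cong) auto
      also have "\<dots> = ?L j - x j" using J(1) j by simp
      finally show ?thesis by simp
    qed
    \<comment> \<open>Where \<open>R\<close> has no chips its moment is 0. On an edge with chips,
      either all cycles of \<open>J'\<close> miss it or it lies in \<open>F\<close>, where the
      combination of cycles vanishes.\<close>
    have R0: "?mom e R * (\<Sum>j\<in>J. c ?i j * \<gamma> j e) = 0" for e
    proof (cases "\<exists>t. Interior e t \<in> Poly_Mapping.keys R")
      case True
      show ?thesis
      proof (cases "e \<in> F")
        case False
        then have "\<gamma> j e = 0" if "j \<in> J'" for j using True that by (auto simp: F_def)
        then have "(\<Sum>j\<in>J. c ?i j * \<gamma> j e) = 0"
          using c(2)[OF i] by (intro sum.neutral) force
        then show ?thesis by simp
      qed (use c(3)[OF i] in simp)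
    next
      case False
      have "?mom e R = wsum (\<lambda>_. 0) R"
        unfolding edge_moment_def using False by (intro wsum_cong) (auto split: point.split)
      then show ?thesis by (simp add: wsum_def)
    qed
    have "(\<Sum>j\<in>J. c ?i j * (\<Sum>e\<in>arcs ?G. \<gamma> j e * ?mom e R)) = (\<Sum>e\<in>arcs ?G. ?mom e R * (\<Sum>j\<in>J. c ?i j * \<gamma> j e))"
      unfolding sum_distrib_left by (subst sum.swap) (simp add: algebra_simps)
    then have R: "(\<Sum>j\<in>J. c ?i j * (\<Sum>e\<in>arcs ?G. \<gamma> j e * ?mom e R)) = 0" by (simp add: R0)
    have "(\<Sum>j\<in>J. c ?i j * x j) = (\<Sum>j\<in>J. c ?i j * (?L j - (\<Sum>e\<in>arcs ?G. \<gamma> j e * (of_int (m e) * ?L e - ?mom e C)))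
        + c ?i j * (\<Sum>e\<in>arcs ?G. \<gamma> j e * ?mom e R))"
    proof (intro sum.cong refl)
      fix j assume j: "j \<in> J"
      show "c ?i j * x j = c ?i j * (?L j - (\<Sum>e\<in>arcs ?G. \<gamma> j e * (of_int (m e) * ?L e - ?mom e C)))
        + c ?i j * (\<Sum>e\<in>arcs ?G. \<gamma> j e * ?mom e R)"
        unfolding distrib_left[symmetric] using 1[OF j] by (intro arg_cong[of _ _ "\<lambda>u. c ?i j * u"]) linarith
    qed
    also have "\<dots> = b ?i (restrict m (arcs ?G))"
      unfolding sum.distrib R b_def by simp
    finally have "(\<Sum>j\<in>J. c ?i j * x j) = b ?i (restrict m (arcs ?G))" .
    moreover have "(c ?i, b ?i (restrict m (arcs ?G))) \<in> H"
      unfolding H_def using i by (intro image_eqI[of _ _ "(?i, restrict m (arcs ?G))"]) auto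
    ultimately show False using avoid by blast
  qed
  then show ?thesis using x by blast
qed

section \<open>Dual bases of spaces of cycles\<close>

definition linear_closed :: "('e \<Rightarrow> real) set \<Rightarrow> bool" where
  "linear_closed U \<longleftrightarrow> (\<lambda>_. 0) \<in> U \<and> (\<forall>a\<in>U. \<forall>b\<in>U. \<forall>c. (\<lambda>e. a e + c * b e) \<in> U)"

lemma linear_closed_H1R: "linear_closed (H1R G)"
  by (auto simp: linear_closed_def H1R_iff net_inflow_add net_inflow_mult)

lemma linear_closedD: "linear_closed U \<Longrightarrow> a \<in> U \<Longrightarrow> b \<in> U \<Longrightarrow> (\<lambda>e. a e + c * b e) \<in> U"
  by (simp add: linear_closed_def)

lemma linear_closed_sum:
  assumes "linear_closed U" "finite J" "\<And>j. j \<in> J \<Longrightarrow> u j \<in> U"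
  shows "(\<lambda>e. \<Sum>j\<in>J. c j * u j e) \<in> U"
  using assms(2,3)
proof (induction J rule: finite_induct)
  case empty
  then show ?case using assms(1) by (simp add: linear_closed_def)
next
  case (insert k J)
  then have "(\<lambda>e. (\<Sum>j\<in>J. c j * u j e) + c k * u k e) \<in> U"
    by (intro linear_closedD[OF assms(1)]) simp_all
  then show ?case using insert.hyps by (simp add: add.commute)
qed

lemma sum_apply: "(\<Sum>i\<in>I. f i) x = (\<Sum>i\<in>I. f i x :: real)"
  by (induction I rule: infinite_finite_induct) auto

text \<open>A new coordinate joins \<open>J\<close> whenever some element of \<open>U\<close>
  vanishes on \<open>J\<close> but not there. For the cycle space and all edges of a graph,
  \<open>J\<close> is the complement of a spanning forest and \<open>u\<close> consists of the
  fundamental cycles.\<close>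

lemma dual_family_exists:
  assumes "finite A" and U: "linear_closed U"
  obtains J u where "J \<subseteq> A" "\<And>j. j \<in> J \<Longrightarrow> u j \<in> U"
    "\<And>i j. i \<in> J \<Longrightarrow> j \<in> J \<Longrightarrow> u j i = (if i = j then 1 else (0::real))"
    "\<And>x i. x \<in> U \<Longrightarrow> (\<And>j. j \<in> J \<Longrightarrow> x j = 0) \<Longrightarrow> i \<in> A \<Longrightarrow> x i = 0"
proof -
  have comb: "(\<lambda>e. a e + c * b e) \<in> U" if "a \<in> U" "b \<in> U" for a b c
    using U that by (rule linear_closedD)
  define P where "P = (\<lambda>A J u. J \<subseteq> A \<and> (\<forall>j\<in>J. u j \<in> U) \<and>
    (\<forall>i\<in>J. \<forall>j\<in>J. u j i = (if i = j then 1 else (0::real))) \<and>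
    (\<forall>x\<in>U. (\<forall>j\<in>J. x j = 0) \<longrightarrow> (\<forall>i\<in>A. x i = 0)))"
  have "\<exists>J u. P A J u"
    using assms(1)
  proof (induction A rule: finite_induct)
    case empty
    then show ?case by (auto simp: P_def)
  next
    case (insert a A)
    then obtain J u where "P A J u" by blast
    then have J: "J \<subseteq> A" "\<And>j. j \<in> J \<Longrightarrow> u j \<in> U"
      "\<And>i j. i \<in> J \<Longrightarrow> j \<in> J \<Longrightarrow> u j i = (if i = j then 1 else (0::real))"
      "\<And>x. x \<in> U \<Longrightarrow> \<forall>j\<in>J. x j = 0 \<Longrightarrow> \<forall>i\<in>A. x i = 0" by (simp_all add: P_def)
    show ?case
    proof (cases "\<forall>x\<in>U. (\<forall>j\<in>J. x j = 0) \<longrightarrow> x a = 0")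
      case True
      then have "P (insert a A) J u" unfolding P_def using J by (intro conjI ballI impI) auto
      then show ?thesis by blast
    next
      case False
      then obtain x where x: "x \<in> U" "\<And>j. j \<in> J \<Longrightarrow> x j = 0" "x a \<noteq> 0" by blast
      define x' where "x' = (\<lambda>e. 0 + (1 / x a) * x e)"
      have x': "x' \<in> U" "\<And>j. j \<in> J \<Longrightarrow> x' j = 0" "x' a = 1"
        using comb[OF _ x(1), of "\<lambda>_. 0" "1 / x a"] U x by (auto simp: x'_def linear_closed_def)
      have aJ: "a \<notin> J" using J insert.hyps by blast
      \<comment> \<open>Subtracting a multiple of \<open>x'\<close> makes the old members vanish at
        \<open>a\<close>; their values on \<open>J\<close> are unchanged, since \<open>x'\<close>
        vanishes there.\<close>
      define u' where "u' = (\<lambda>j. if j = a then x' else (\<lambda>e. u j e + (- u j a) * x' e))"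
      have "P (insert a A) (insert a J) u'"
        unfolding P_def
      proof (intro conjI ballI impI)
        show "insert a J \<subseteq> insert a A" using J(1) by auto
        show "u' j \<in> U" if "j \<in> insert a J" for j
          using that J(2)[of j] x'(1) comb[of "u j" x' "- u j a"] by (auto simp: u'_def)
        show "u' j i = (if i = j then 1 else 0)" if "i \<in> insert a J" "j \<in> insert a J" for i j
          using that aJ J(3) x' by (auto simp: u'_def)
        show "y i = 0" if "y \<in> U" "\<forall>j\<in>insert a J. y j = 0" "i \<in> insert a A" for y i
          using J(4)[of y] that by auto
      qed
      then show ?thesis by blast
    qed
  qed
  then obtain J u where "P A J u" by blast
  then show thesis unfolding P_def by (intro that[of J u]) simp_all
qed

text \<open>Evaluation at the coordinates in \<open>J\<close> identifies \<open>U\<close> with the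
  functions on \<open>J\<close>.\<close>

lemma dim_eq_card_dual_family:
  assumes U: "linear_closed U" and J: "finite J" "\<And>j. j \<in> J \<Longrightarrow> u j \<in> U"
    and dual: "\<And>i j. i \<in> J \<Longrightarrow> j \<in> J \<Longrightarrow> u j i = (if i = j then 1 else (0::real))"
    and det: "\<And>x. x \<in> U \<Longrightarrow> (\<And>j. j \<in> J \<Longrightarrow> x j = 0) \<Longrightarrow> x = (\<lambda>_. 0)"
  shows "vector_space.dim (\<lambda>(c::real) z e. c * z e) U = card J"
proof -
  interpret vs: vector_space "\<lambda>(c::real) (z :: 'a \<Rightarrow> real) e. c * z e"
    by unfold_locales (auto simp: fun_eq_iff algebra_simps)
  have inj: "inj_on u J"
    using dual by (intro inj_onI) (metis zero_neq_one)
  have eval: "(\<Sum>v\<in>u ` J. (\<lambda>e. f v * v e)) i = (\<Sum>j\<in>J. f (u j) * u j i)" for f :: "('a \<Rightarrow> real) \<Rightarrow> real" and i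
    using J(1) by (simp add: sum.reindex[OF inj] sum_apply)
  have "vs.independent (u ` J)"
  proof
    assume "vs.dependent (u ` J)"
    then obtain f j where f: "j \<in> J" "f (u j) \<noteq> 0" "(\<Sum>v\<in>u ` J. (\<lambda>e. f v * v e)) = 0"
      using vs.dependent_finite[of "u ` J"] J(1) by auto
    have "0 = (\<Sum>i\<in>J. f (u i) * u i j)" using fun_cong[OF f(3), of j] unfolding eval by simp
    also have "\<dots> = (\<Sum>i\<in>J. if i = j then f (u j) else 0)"
      using dual f(1) by (intro sum.cong) auto
    also have "\<dots> = f (u j)" using J(1) f(1) by simp
    finally show False using f(2) by simp
  qed
  moreover have "U \<subseteq> vs.span (u ` J)"
  proof
    fix x assume x: "x \<in> U"
    define y where "y = (\<lambda>e. x e + (- 1) * (\<Sum>j\<in>J. x j * u j e))"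
    have "y \<in> U" unfolding y_def by (rule linear_closedD[OF U x linear_closed_sum[OF U J]])
    moreover have "y i = 0" if i: "i \<in> J" for i
    proof -
      have "(\<Sum>j\<in>J. x j * u j i) = (\<Sum>j\<in>J. if j = i then x i else 0)"
        using dual i by (intro sum.cong) auto
      then show ?thesis using J(1) i by (simp add: y_def)
    qed
    ultimately have y0: "y = (\<lambda>_. 0)" by (rule det)
    have "x = (\<Sum>j\<in>J. (\<lambda>e. x j * u j e))"
    proof
      fix e show "x e = (\<Sum>j\<in>J. (\<lambda>e. x j * u j e)) e"
        using fun_cong[OF y0, of e] unfolding sum_apply y_def by linarith
    qed
    moreover have "(\<Sum>j\<in>J. (\<lambda>e. x j * u j e)) \<in> vs.span (u ` J)"
      by (intro vs.span_sum vs.span_scale vs.span_base) auto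
    ultimately show "x \<in> vs.span (u ` J)" by simp
  qed
  moreover have "u ` J \<subseteq> U" using J(2) by auto
  ultimately show ?thesis
    using vs.basis_card_eq_dim[of "u ` J" U] card_image[OF inj] by simp
qed

lemma dim_le_card_determining:
  assumes U: "linear_closed U" and J: "finite J"
    and det: "\<And>x. x \<in> U \<Longrightarrow> (\<And>j. j \<in> J \<Longrightarrow> x j = 0) \<Longrightarrow> x = (\<lambda>_. 0)"
  shows "vector_space.dim (\<lambda>(c::real) z e. c * z e) U \<le> card J"
proof -
  obtain J' u where J': "J' \<subseteq> J" "\<And>j. j \<in> J' \<Longrightarrow> u j \<in> U"
    "\<And>i j. i \<in> J' \<Longrightarrow> j \<in> J' \<Longrightarrow> u j i = (if i = j then 1 else (0::real))"
    "\<And>x i. x \<in> U \<Longrightarrow> (\<And>j. j \<in> J' \<Longrightarrow> x j = 0) \<Longrightarrow> i \<in> J \<Longrightarrow> x i = 0"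
    by (rule dual_family_exists[OF J U]) blast
  have "vector_space.dim (\<lambda>(c::real) z e. c * z e) U = card J'"
    by (rule dim_eq_card_dual_family[OF U finite_subset[OF J'(1) J] J'(2,3)]) (use det J'(4) in blast)+
  then show ?thesis using card_mono[OF J J'(1)] by simp
qed


section \<open>Chips on a collapsing subgraph\<close>

text \<open>The points that contract to \<open>V\<close>, apart from those at the ends of edges of
  positive length. Membership ignores the coordinate along an edge, so the number of chips in this
  set survives limits in which chips move along edges.\<close>

definition collapsing_points :: "('v, 'e) pre_digraph \<Rightarrow> ('e \<Rightarrow> real) \<Rightarrow> 'v set \<Rightarrow> ('v, 'e) point set" where
  "collapsing_points G s V = {p. case p of Vertex v \<Rightarrow> v \<in> V | Interior e t \<Rightarrow> s e = 0 \<and> tail G e \<in> V}"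

text \<open>\<open>s\<close> is the limit parameter and \<open>s'\<close> a nearby one, which may
  have positive lengths where \<open>s\<close> has 0 but not conversely. Each vertex of the limit
  curve is then a union of vertices of the curve at \<open>s'\<close>.\<close>

locale degeneration = lim: contraction G s + gen: contraction G s'
  for G :: "('v, 'e) pre_digraph" and s s' :: "'e \<Rightarrow> real" +
  assumes refine: "\<And>e. e \<in> arcs G \<Longrightarrow> s' e = 0 \<Longrightarrow> s e = 0"
begin

lemma collapsed_rel_mono: "(u, v) \<in> collapsed_rel G s' \<Longrightarrow> (u, v) \<in> collapsed_rel G s"
proof -
  have sub: "parcs (mk_symmetric (collapsed_graph G s')) \<subseteq> parcs (mk_symmetric (collapsed_graph G s))"
    using refine by (auto simp: parcs_mk_symmetric)
  have "(u, v) \<in> rtrancl_on (verts G) (parcs (mk_symmetric (collapsed_graph G s)))"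
    if "(u, v) \<in> rtrancl_on (verts G) (parcs (mk_symmetric (collapsed_graph G s')))"
    using that
    by (induction rule: rtrancl_on.induct)
       (auto intro: rtrancl_on_into_rtrancl_on[OF _ subsetD[OF sub]])
  then show "(u, v) \<in> collapsed_rel G s'  \<Longrightarrow> (u, v) \<in> collapsed_rel G s"
    by (simp add: lim.collapsed_rel_iff gen.collapsed_rel_iff)
qed

lemma gen_cls_subset: "V \<in> verts lim.Gs \<Longrightarrow> v \<in> V \<Longrightarrow> gen.cls v \<subseteq> V"
proof
  fix u assume V: "V \<in> verts lim.Gs" "v \<in> V" and u: "u \<in> gen.cls v"
  have v: "v \<in> verts G" using V lim.class_subset by blast
  have "(v, u) \<in> collapsed_rel G s" using u by (simp add: collapsed_rel_mono)
  moreover have "lim.cls v = V" using V v lim.cls_eq_class_iff by blast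
  ultimately show "u \<in> V" by auto
qed

abbreviation "subclasses V \<equiv> {V' \<in> verts gen.Gs. V' \<subseteq> V}"

lemma finite_subclasses: "finite (subclasses V)"
  using fin_digraph.finite_verts[OF gen.fin_Gs] by (rule rev_finite_subset) blast

lemma gen_cls_subclass: "V \<in> verts lim.Gs \<Longrightarrow> v \<in> V \<Longrightarrow> gen.cls v \<in> subclasses V"
  using gen_cls_subset[of V v] gen.cls_in_verts[of v] lim.class_subset[of V] by auto

lemma gen_tail_in_iff_head_in:
  assumes "V \<in> verts gen.Gs" "e \<in> arcs G" "s' e = 0"
  shows "tail G e \<in> V \<longleftrightarrow> head G e \<in> V"
  using gen.cls_tail_eq_head[OF assms(2,3)] gen.cls_eq_class_iff[OF assms(1), of "tail G e"]
    gen.cls_eq_class_iff[OF assms(1), of "head G e"] assms(2) by auto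

lemma collapsed_subgraph_simps [simp]:
  "verts (collapsed_subgraph G l V) = V"
  "arcs (collapsed_subgraph G l V) = {e \<in> arcs G. l e = 0 \<and> tail G e \<in> V \<and> head G e \<in> V}"
  "tail (collapsed_subgraph G l V) = tail G" "head (collapsed_subgraph G l V) = head G"
  by (simp_all add: collapsed_subgraph_def)

lemma net_inflow_subgraph:
  fixes x :: "'e \<Rightarrow> real"
  assumes "arcs H \<subseteq> arcs G" "tail H = tail G" "head H = head G"
    and "\<And>e. e \<in> arcs G \<Longrightarrow> e \<notin> arcs H \<Longrightarrow> head G e = v \<or> tail G e = v \<Longrightarrow> x e = 0"
  shows "net_inflow H x v = net_inflow G x v"
proof -
  have "(\<Sum>e\<in>in_arcs H v. x e) = (\<Sum>e\<in>in_arcs G v. x e)"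
    using assms by (intro sum.mono_neutral_left[OF lim.finite_in_arcs]) (auto simp: in_arcs_def)
  moreover have "(\<Sum>e\<in>out_arcs H v. x e) = (\<Sum>e\<in>out_arcs G v. x e)"
    using assms by (intro sum.mono_neutral_left[OF lim.finite_out_arcs]) (auto simp: out_arcs_def)
  ultimately show ?thesis by (simp add: net_inflow_def)
qed

lemma H1R_collapsed_subgraph:
  assumes "x \<in> H1R (collapsed_subgraph G l V)"
  shows "x \<in> H1R G"
proof -
  have 0: "x e = 0" if "e \<notin> arcs (collapsed_subgraph G l V)" for e
    using assms that by (simp add: H1R_iff)
  have "net_inflow G x v = 0" for v
  proof (cases "v \<in> V")
    case True
    have "net_inflow (collapsed_subgraph G l V) x v = net_inflow G x v"
      by (rule net_inflow_subgraph) (use 0 in auto)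
    then show ?thesis using assms True by (simp add: H1R_iff)
  next
    case False
    then show ?thesis unfolding net_inflow_def by (simp add: 0)
  qed
  then show ?thesis using 0 by (auto simp: H1R_iff)
qed

text \<open>A cycle of the collapsed subgraph that vanishes on all edges with
  \<open>0 < s' e\<close> splits into cycles of the subgraphs already collapsed by
  \<open>s'\<close>. Hence sets of edges determining the latter, together with a dual family on the
  remaining edges, determine every cycle.\<close>

lemma betti1_le:
  assumes V: "V \<in> verts lim.Gs"
  obtains J u where "J \<subseteq> {e \<in> arcs G. s e = 0 \<and> 0 < s' e \<and> tail G e \<in> V}"
    "\<And>j. j \<in> J \<Longrightarrow> u j \<in> H1R (collapsed_subgraph G s V)"
    "\<And>i j. i \<in> J \<Longrightarrow> j \<in> J \<Longrightarrow> u j i = (if i = j then 1 else (0::real))"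
    "betti1 (collapsed_subgraph G s V) \<le> card J + (\<Sum>V'\<in>subclasses V. betti1 (collapsed_subgraph G s' V'))"
proof -
  let ?K = "collapsed_subgraph G s V" and ?K' = "\<lambda>V'. collapsed_subgraph G s' V'"
  let ?A = "{e \<in> arcs G. s e = 0 \<and> 0 < s' e \<and> tail G e \<in> V}"
  have finA: "finite ?A" by simp
  obtain J u where J: "J \<subseteq> ?A" "\<And>j. j \<in> J \<Longrightarrow> u j \<in> H1R ?K"
    "\<And>i j. i \<in> J \<Longrightarrow> j \<in> J \<Longrightarrow> u j i = (if i = j then 1 else (0::real))"
    "\<And>x i. x \<in> H1R ?K \<Longrightarrow> (\<And>j. j \<in> J \<Longrightarrow> x j = 0) \<Longrightarrow> i \<in> ?A \<Longrightarrow> x i = 0"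
    by (rule dual_family_exists[OF finA linear_closed_H1R]) blast
  have "\<exists>I\<subseteq>arcs (?K' V'). card I = betti1 (?K' V') \<and>
      (\<forall>x\<in>H1R (?K' V'). (\<forall>i\<in>I. x i = 0) \<longrightarrow> x = (\<lambda>_. 0))" for V'
  proof -
    have fin: "finite (arcs (?K' V'))" by simp
    obtain I y where I: "I \<subseteq> arcs (?K' V')" "\<And>j. j \<in> I \<Longrightarrow> y j \<in> H1R (?K' V')"
      "\<And>i j. i \<in> I \<Longrightarrow> j \<in> I \<Longrightarrow> y j i = (if i = j then 1 else (0::real))"
      "\<And>x i. x \<in> H1R (?K' V') \<Longrightarrow> (\<And>j. j \<in> I \<Longrightarrow> x j = 0) \<Longrightarrow> i \<in> arcs (?K' V') \<Longrightarrow> x i = 0"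
      by (rule dual_family_exists[OF fin linear_closed_H1R]) blast
    have det: "x = (\<lambda>_. 0)" if x: "x \<in> H1R (?K' V')" "\<And>i. i \<in> I \<Longrightarrow> x i = 0" for x
    proof
      fix e show "x e = 0"
      proof (cases "e \<in> arcs (?K' V')")
        case True
        then show ?thesis using I(4)[OF x] by blast
      next
        case False
        then show ?thesis using x(1) by (simp add: H1R_iff del: collapsed_subgraph_simps)
      qed
    qed
    have "betti1 (?K' V') = card I"
      unfolding betti1_def
      by (rule dim_eq_card_dual_family[OF linear_closed_H1R finite_subset[OF I(1) fin] I(2,3) det])
    then show ?thesis using I(1) det by (intro exI[of _ I]) auto
  qed
  then obtain I where I: "\<And>V'. I V' \<subseteq> arcs (?K' V')" "\<And>V'. card (I V') = betti1 (?K' V')"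
    "\<And>V' x. x \<in> H1R (?K' V') \<Longrightarrow> \<forall>i\<in>I V'. x i = 0 \<Longrightarrow> x = (\<lambda>_. 0)" by metis
  let ?J0 = "J \<union> (\<Union>V'\<in>subclasses V. I V')"
  have finI: "finite (I V')" for V' using I(1)[of V'] by (rule finite_subset) simp
  have finJ: "finite J" using J(1) finA by (rule finite_subset)
  have finJ0: "finite ?J0" using finJ finI finite_subclasses by blast
  have "betti1 ?K \<le> card ?J0"
    unfolding betti1_def
  proof (rule dim_le_card_determining[OF linear_closed_H1R finJ0])
    fix x assume x: "x \<in> H1R ?K" and x0: "\<And>j. j \<in> ?J0 \<Longrightarrow> x j = 0"
    have xA: "x e = 0" if "e \<in> ?A" for e using J(4)[OF x _ that] x0 by blast
    show "x = (\<lambda>_. 0)"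
    proof
      fix e show "x e = 0"
      proof (cases "e \<in> arcs ?K \<and> s' e = 0")
        case True
        then have e: "e \<in> arcs G" "s e = 0" "tail G e \<in> V" "s' e = 0" by auto
        define V' where "V' = gen.cls (tail G e)"
        have V': "V' \<in> subclasses V" unfolding V'_def by (rule gen_cls_subclass[OF V e(3)])
        \<comment> \<open>The restriction is again a cycle: all other edges of \<open>G\<close> at
          vertices of \<open>V'\<close> have positive length for \<open>s'\<close>, and
          \<open>x\<close> vanishes on them.\<close>
        define x' where "x' = (\<lambda>e. if e \<in> arcs (?K' V') then x e else 0)"
        have "net_inflow (?K' V') x' v = 0" if v: "v \<in> V'" for v
        proof -
          have "net_inflow (?K' V') x' v = net_inflow (?K' V') x v"
            by (rule net_inflow_cong) (simp add: x'_def del: collapsed_subgraph_simps)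
          also have "\<dots> = net_inflow G x v"
          proof (rule net_inflow_subgraph)
            fix f assume f: "f \<in> arcs G" "f \<notin> arcs (?K' V')" "head G f = v \<or> tail G f = v"
            show "x f = 0"
            proof (cases "s' f = 0")
              case True
              then have "f \<in> arcs (?K' V')"
                using f v V' gen_tail_in_iff_head_in[of V' f] by auto
              then show ?thesis using f by simp
            next
              case False
              then have "0 < s' f" using gen.s_nonneg[OF f(1)] by simp
              then show ?thesis
                using xA[of f] x f(1) by (cases "f \<in> arcs ?K") (auto simp: H1R_iff)
            qed
          qed auto
          also have "\<dots> = 0"
            using H1R_collapsed_subgraph[OF x] v V' lim.class_subset[OF V] by (auto simp: H1R_iff)
          finally show ?thesis .
        qed
        then have "x' \<in> H1R (?K' V')" by (auto simp: H1R_iff x'_def)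
        moreover have "\<forall>i\<in>I V'. x' i = 0" using x0 V' by (auto simp: x'_def)
        ultimately have "x' = (\<lambda>_. 0)" by (rule I(3))
        moreover have "e \<in> arcs (?K' V')"
          using e V' gen.in_cls_self[of "tail G e"] gen_tail_in_iff_head_in[of V' e] by (auto simp: V'_def)
        ultimately show ?thesis by (metis x'_def)
      next
        case False
        show ?thesis
        proof (cases "e \<in> arcs ?K")
          case True
          then have "e \<in> ?A" using False gen.s_nonneg[of e] by auto
          then show ?thesis by (rule xA)
        next
          case False
          then show ?thesis using x by (simp add: H1R_iff del: collapsed_subgraph_simps)
        qed
      qed
    qed
  qed
  also have "\<dots> \<le> card J + card (\<Union>V'\<in>subclasses V. I V')" by (rule card_Un_le)
  also have "card (\<Union>V'\<in>subclasses V. I V') \<le> (\<Sum>V'\<in>subclasses V. card (I V'))"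
    by (rule card_UN_le[OF finite_subclasses])
  finally have "betti1 ?K \<le> card J + (\<Sum>V'\<in>subclasses V. betti1 (?K' V'))" by (simp add: I(2))
  with J(1-3) show thesis by (rule that)
qed

lemma sum_weights_subclasses:
  assumes V: "V \<in> verts lim.Gs"
  shows "(\<Sum>v\<in>V. w v :: nat) = (\<Sum>V'\<in>subclasses V. \<Sum>v\<in>V'. w v)"
proof -
  have finV: "finite V" using lim.class_subset[OF V] by (rule finite_subset) simp
  have "(\<Sum>V'\<in>subclasses V. \<Sum>v\<in>{v\<in>V. gen.cls v = V'}. w v) = (\<Sum>v\<in>V. w v)"
    using gen_cls_subclass[OF V] by (intro sum.group finV finite_subclasses) auto
  moreover have "{v\<in>V. gen.cls v = V'} = V'" if "V' \<in> subclasses V" for V'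
    using that gen.cls_eq_class_iff[of V'] lim.class_subset[OF V] by blast
  ultimately show ?thesis by simp
qed

end

section \<open>Forcing chips into the regions that shrink to vertices\<close>

locale weighted_degeneration = degeneration G s s'
  for G :: "('v, 'e) pre_digraph" and s s' :: "'e \<Rightarrow> real" +
  fixes w :: "'v \<Rightarrow> nat" and \<epsilon> :: real
  assumes eps: "0 < \<epsilon>"
begin

sublocale W: weighted_curve "curve_at G w s'" \<epsilon>
  by (intro weighted_curve.intro gen.metric_graph_curve_at weighted_curve_axioms.intro eps)

text \<open>What becomes the limit vertex \<open>V\<close>: edges of limit length 0, and the loops
  attached at vertices inside \<open>V\<close>. The loops keep their length
  \<open>\<epsilon>\<close>, but they contribute to the weight of \<open>V\<close>.\<close>

definition region :: "'v set \<Rightarrow> ('e + 'v set \<times> nat) set" where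
  "region V = Inl ` {e \<in> arcs G. s e = 0 \<and> tail G e \<in> V} \<union> Inr ` {l. fst l \<subseteq> V}"

text \<open>By \<open>betti1_le\<close>, the weight of \<open>V\<close> is at most the number of
  cycles dual to edges of positive length at \<open>s'\<close> plus the weights of the vertices
  inside \<open>V\<close> at \<open>s'\<close>. Each unit of the latter is an attached loop, a cycle
  by itself.\<close>

lemma independent_cycles:
  assumes V: "V \<in> verts lim.Gs" and k: "k \<le> curve_weight (curve_at G w s) V"
  shows "\<exists>J \<gamma>. J \<subseteq> arcs (curve_graph W.\<Gamma>\<epsilon>) \<and> card J = k \<and>
    (\<forall>j\<in>J. \<gamma> j \<in> H1R (curve_graph W.\<Gamma>\<epsilon>) \<and> (\<forall>e. \<gamma> j e \<noteq> 0 \<longrightarrow> e \<in> region V) \<and>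
      (\<forall>i\<in>J. \<gamma> j i = (if i = j then 1 else 0)))"
proof -
  obtain J u where J: "J \<subseteq> {e \<in> arcs G. s e = 0 \<and> 0 < s' e \<and> tail G e \<in> V}"
    "\<And>j. j \<in> J \<Longrightarrow> u j \<in> H1R (collapsed_subgraph G s V)"
    "\<And>i j. i \<in> J \<Longrightarrow> j \<in> J \<Longrightarrow> u j i = (if i = j then 1 else (0::real))"
    "betti1 (collapsed_subgraph G s V) \<le> card J + (\<Sum>V'\<in>subclasses V. betti1 (collapsed_subgraph G s' V'))"
    by (rule betti1_le[OF V]) blast
  let ?wt = "curve_weight (curve_at G w s')"
  define M where "M = (SIGMA V' : subclasses V. {..<?wt V'})"
  define J1 where "J1 = Inl ` J \<union> Inr ` M"
  \<comment> \<open>\<open>rescale_H1 s'\<close> erases the edges contracted at \<open>s'\<close>.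
    Duality is unaffected, since the edges of \<open>J\<close> have positive length there.\<close>
  define \<gamma> :: "'e + 'v set \<times> nat \<Rightarrow> 'e + 'v set \<times> nat \<Rightarrow> real" where "\<gamma> = (\<lambda>j e. case j of
      Inl j \<Rightarrow> (case e of Inl e \<Rightarrow> rescale_H1 s' (u j) e | Inr _ \<Rightarrow> 0)
    | Inr l \<Rightarrow> if e = Inr l then 1 else (0::real))"
  have finM: "finite M" unfolding M_def using finite_subclasses by auto
  have finJ: "finite J" using J(1) by (rule finite_subset) simp
  have "card J1 = card J + card M"
    unfolding J1_def using finJ finM
    by (subst card_Un_disjoint) (auto simp: card_image)
  also have "card M = (\<Sum>V'\<in>subclasses V. ?wt V')"
    unfolding M_def using finite_subclasses by simp
  also have "\<dots> = (\<Sum>V'\<in>subclasses V. betti1 (collapsed_subgraph G s' V')) + (\<Sum>v\<in>V. w v)"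
    unfolding sum_weights_subclasses[OF V] by (simp add: curve_at_def sum.distrib)
  finally have "k \<le> card J1" using k J(4) by (simp add: curve_at_def)
  then obtain J2 where J2: "J2 \<subseteq> J1" "card J2 = k" using obtain_subset_with_card_n by blast
  have J1: "J1 \<subseteq> arcs (curve_graph W.\<Gamma>\<epsilon>)"
    using J(1) unfolding J1_def M_def W.attach_loops_simps(2) gen.curve_at_simps by auto
  have 1: "\<gamma> j \<in> H1R (curve_graph W.\<Gamma>\<epsilon>)" if j: "j \<in> J1" for j
  proof (cases j)
    case (Inl i)
    then have "u i \<in> H1R G" using j J(2) H1R_collapsed_subgraph by (auto simp: J1_def)
    then have "rescale_H1 s' (u i) \<in> H1R gen.Gs" by (rule gen.rescale_H1_H1R)
    then show ?thesis
      unfolding H1R_iff using W.net_inflow_attach[of _ "\<gamma> j"]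
      by (auto simp: \<gamma>_def Inl split: sum.split)
  next
    case (Inr l)
    then show ?thesis
      unfolding H1R_iff using W.net_inflow_attach[of _ "\<gamma> j"] J1 j
      by (auto simp: \<gamma>_def split: sum.split)
  qed
  have 2: "e \<in> region V" if j: "j \<in> J1" and nz: "\<gamma> j e \<noteq> 0" for j e
  proof (cases j)
    case (Inl i)
    then obtain f where f: "e = Inl f" "u i f \<noteq> 0"
      using nz by (auto simp: \<gamma>_def rescale_H1_def split: sum.splits if_splits)
    have "u i \<in> H1R (collapsed_subgraph G s V)" using Inl j J(2) by (auto simp: J1_def)
    then have "f \<in> arcs (collapsed_subgraph G s V)"
      using f(2) unfolding H1R_iff by blast
    then show ?thesis using f by (auto simp: region_def)
  next
    case (Inr l)
    then show ?thesis using j nz by (auto simp: \<gamma>_def region_def J1_def M_def split: if_splits)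
  qed
  have 3: "\<gamma> j i = (if i = j then 1 else 0)" if "i \<in> J1" "j \<in> J1" for i j
    using that J(1,3) by (auto simp: J1_def \<gamma>_def rescale_H1_def split: if_splits)
  show ?thesis
  proof (intro exI[of _ J2] exI[of _ \<gamma>] conjI ballI allI impI)
    show "J2 \<subseteq> arcs (curve_graph W.\<Gamma>\<epsilon>)" using J1 J2 by blast
    show "card J2 = k" by fact
    fix j assume "j \<in> J2"
    then have j: "j \<in> J1" using J2 by blast
    show "\<gamma> j \<in> H1R (curve_graph W.\<Gamma>\<epsilon>)" by (rule 1[OF j])
    show "e \<in> region V" if "\<gamma> j e \<noteq> 0" for e by (rule 2[OF j that])
    show "\<gamma> j i = (if i = j then 1 else 0)" if "i \<in> J2" for i
      by (rule 3[OF _ j]) (use that J2 in blast)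
  qed
qed

text \<open>The rank is tested with \<open>E\<close> together with \<open>k V\<close> generic chips
  in every region. Applied to the cycles of one region at a time, \<open>generic_chips\<close> finds
  \<open>k V\<close> further chips of the remainder in that region. Retracting the loops and lifting
  to \<open>G\<close> keeps both groups among the collapsing points of \<open>V\<close>.\<close>

lemma effective_lift:
  assumes D: "D \<in> divisors (curve_at G w s')" and rank: "int r \<le> divisor_rank \<epsilon> (curve_at G w s') D"
    and E: "Poly_Mapping.keys E \<subseteq> half_open_points G" "effective E"
    and k: "\<And>V. V \<in> verts lim.Gs \<Longrightarrow> k V \<le> curve_weight (curve_at G w s) V"
    and r: "divisor_degree E + int (\<Sum>V\<in>verts lim.Gs. k V) = int r" and ne: "verts G \<noteq> {}"
  shows "\<exists>Y. effective Y \<and> Poly_Mapping.keys Y \<subseteq> half_open_points G \<and>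
    (\<forall>V\<in>verts lim.Gs. 2 * real (k V) \<le> wsum (\<lambda>p. if p \<in> collapsing_points G s V then 1 else 0) Y) \<and>
    curve_rel (curve_at G w s') (push (contract_point G s') (Y + E) - D) (\<lambda>_. 0)"
proof -
  let ?\<Gamma> = "curve_at G w s'" and ?A = "arcs (curve_graph W.\<Gamma>\<epsilon>)"
  define P where "P = (\<lambda>V J \<gamma>. J \<subseteq> ?A \<and> card J = k V \<and>
    (\<forall>j\<in>J. \<gamma> j \<in> H1R (curve_graph W.\<Gamma>\<epsilon>) \<and> (\<forall>e. \<gamma> j e \<noteq> 0 \<longrightarrow> e \<in> region V) \<and>
      (\<forall>i\<in>J. \<gamma> j i = (if i = j then 1 else 0))))"
  have "\<forall>V\<in>verts lim.Gs. \<exists>J\<gamma>. P V (fst J\<gamma>) (snd J\<gamma>)"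
    using independent_cycles[OF _ k] by (auto simp: P_def simp del: W.attach_loops_simps)
  from bchoice[OF this] obtain J\<gamma> where J\<gamma>: "\<And>V. V \<in> verts lim.Gs \<Longrightarrow> P V (fst (J\<gamma> V)) (snd (J\<gamma> V))" by blast
  define JV where "JV = (\<lambda>V. fst (J\<gamma> V))"
  define gV where "gV = (\<lambda>V. snd (J\<gamma> V))"
  have JV: "JV V \<subseteq> ?A" "card (JV V) = k V"
    and gV: "\<And>j. j \<in> JV V \<Longrightarrow> gV V j \<in> H1R (curve_graph W.\<Gamma>\<epsilon>)"
      "\<And>j e. j \<in> JV V \<Longrightarrow> gV V j e \<noteq> 0 \<Longrightarrow> e \<in> region V"
      "\<And>i j. i \<in> JV V \<Longrightarrow> j \<in> JV V \<Longrightarrow> gV V j i = (if i = j then 1 else 0)"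
    if "V \<in> verts lim.Gs" for V
    using J\<gamma>[OF that] by (simp_all add: P_def JV_def gV_def del: W.attach_loops_simps)
  have finA: "finite ?A" by (rule W.L.finite_arcs)
  have finJV: "finite (JV V)" if "V \<in> verts lim.Gs" for V using JV(1)[OF that] finA by (rule finite_subset)
  have JV_region: "j \<in> region V" if "V \<in> verts lim.Gs" "j \<in> JV V" for j V
    using gV(2)[OF that, of j] gV(3)[OF that(1) that(2) that(2)] by simp
  \<comment> \<open>Recovers \<open>V\<close> from any edge of its region. Thus the regions are
    disjoint, and the families of the different vertices merge into one dual family
    \<open>\<gamma>\<close>.\<close>
  define cls_of :: "'e + 'v set \<times> nat \<Rightarrow> 'v set" where
    "cls_of = (\<lambda>j. case j of Inl e \<Rightarrow> lim.cls (tail G e) | Inr l \<Rightarrow> lim.cls (SOME v. v \<in> fst l))"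
  have cls_of: "cls_of j = V" if "V \<in> verts lim.Gs" "j \<in> region V" "j \<in> ?A" for j V
  proof (cases j)
    case (Inl e)
    then show ?thesis using that lim.cls_eq_class_iff[OF that(1), of "tail G e"] by (auto simp: cls_of_def region_def)
  next
    case (Inr l)
    then have l: "fst l \<in> verts gen.Gs" "fst l \<subseteq> V" using that(2,3) by (auto simp: region_def)
    then have "(SOME v. v \<in> fst l) \<in> V" using gen.some_in_class[of "fst l"] by blast
    then show ?thesis using Inr lim.class_subset[OF that(1)] lim.cls_eq_class_iff[OF that(1)] by (auto simp: cls_of_def)
  qed
  define J where "J = (\<Union>V\<in>verts lim.Gs. JV V)"
  define \<gamma> where "\<gamma> = (\<lambda>j. gV (cls_of j) j)"
  have \<gamma>_eq: "\<gamma> j = gV V j" if "V \<in> verts lim.Gs" "j \<in> JV V" for j V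
    using cls_of[OF that(1) JV_region[OF that]] JV(1)[OF that(1)] that(2) by (auto simp: \<gamma>_def)
  have finV: "finite (verts lim.Gs)" by (rule fin_digraph.finite_verts[OF lim.fin_Gs])
  have J: "finite J" "J \<subseteq> ?A" unfolding J_def using finJV JV(1) finV by blast+
  have \<gamma>H: "\<gamma> j \<in> H1R (curve_graph W.\<Gamma>\<epsilon>)" if "j \<in> J" for j
    using that gV(1) \<gamma>_eq by (auto simp: J_def simp del: W.attach_loops_simps lim.contracted_graph_simps)
  have dual: "\<gamma> j i = (if i = j then 1 else 0)" if "i \<in> J" "j \<in> J" for i j
  proof -
    from that obtain V1 V2 where V: "V1 \<in> verts lim.Gs" "i \<in> JV V1" "V2 \<in> verts lim.Gs" "j \<in> JV V2"
      unfolding J_def by blast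
    show ?thesis
    proof (cases "V1 = V2")
      case True
      then show ?thesis using gV(3)[of V2 i j] \<gamma>_eq[of V2 j] V by simp
    next
      case False
      have "i \<in> ?A" using that(1) J(2) by blast
      then have c1: "cls_of i = V1" using cls_of[OF V(1) JV_region[OF V(1,2)]] by simp
      have "j \<in> ?A" using that(2) J(2) by blast
      then have "cls_of j = V2" using cls_of[OF V(3) JV_region[OF V(3,4)]] by simp
      moreover have "gV V2 j i = 0"
        using gV(2)[OF V(3,4), of i] cls_of[OF V(3), of i] c1 False \<open>i \<in> ?A\<close> by blast
      ultimately show ?thesis using c1 False \<gamma>_eq[OF V(3,4)] by auto
    qed
  qed
  have cardJ: "card J = (\<Sum>V\<in>verts lim.Gs. k V)"
  proof -
    have "card J = (\<Sum>V\<in>verts lim.Gs. card (JV V))"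
      unfolding J_def
    proof (rule card_UN_disjoint[OF finV])
      show "\<forall>V\<in>verts lim.Gs. finite (JV V)" using finJV by blast
      show "\<forall>V1\<in>verts lim.Gs. \<forall>V2\<in>verts lim.Gs. V1 \<noteq> V2 \<longrightarrow> JV V1 \<inter> JV V2 = {}"
      proof (intro ballI impI)
        fix V1 V2 assume V: "V1 \<in> verts lim.Gs" "V2 \<in> verts lim.Gs" "V1 \<noteq> V2"
        have "cls_of j = V1" "cls_of j = V2" if "j \<in> JV V1 \<inter> JV V2" for j
          using that cls_of[OF V(1) JV_region[OF V(1)]] cls_of[OF V(2) JV_region[OF V(2)]]
            subsetD[OF JV(1)[OF V(1)]] by blast+
        then show "JV V1 \<inter> JV V2 = {}" using V(3) by blast
      qed
    qed
    then show ?thesis using JV(2) by simp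
  qed
  define E1 where "E1 = push W.embed (push (contract_point G s') E)"
  have half_closed: "p \<in> closed_points G" if "p \<in> half_open_points G" for p
    using that by (auto simp: half_open_points_def closed_points_def)
  have cE: "push (contract_point G s') E \<in> divisors ?\<Gamma>"
    using keys_push[of "contract_point G s'" E] E(1) gen.contract_point_in_points half_closed
    by (fastforce simp: divisors_def)
  have E1: "E1 \<in> divisors W.\<Gamma>\<epsilon>" "effective E1" "divisor_degree E1 = divisor_degree E"
    unfolding E1_def using cE E(2) by (auto intro: W.push_embed_divisors effective_push simp: divisor_degree_push)
  \<comment> \<open>With this choice of \<open>C\<close>, the divisor \<open>R\<close> of
    \<open>generic_chips\<close> is what is left of a representative of \<open>D\<close> after
    removing \<open>E1\<close> and the generic chips.\<close>
  from W.L.generic_chips[OF J \<gamma>H dual, of "E1 - push W.embed D"] obtain x where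
    x: "\<And>j. j \<in> J \<Longrightarrow> 0 < x j \<and> x j < edge_length W.\<Gamma>\<epsilon> j" and
    gen_chips: "\<And>R J'. curve_rel W.\<Gamma>\<epsilon> (E1 - push W.embed D + (\<Sum>j\<in>J. frag_of (Interior j (x j))) + R) (\<lambda>_. 0) \<Longrightarrow>
      J' \<subseteq> J \<Longrightarrow> card J' \<le> card {e. (\<exists>t. Interior e t \<in> Poly_Mapping.keys R) \<and> (\<exists>j\<in>J'. \<gamma> j e \<noteq> 0)}"
    by blast
  define X where "X = (\<Sum>j\<in>J. frag_of (Interior j (x j) :: ('v set, 'e + 'v set \<times> nat) point))"
  have X: "X \<in> divisors W.\<Gamma>\<epsilon>" "effective X"
  proof -
    have "Interior j (x j) \<in> points W.\<Gamma>\<epsilon>" if "j \<in> J" for j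
      using J(2) x[OF that] that unfolding points_def by blast
    then show "X \<in> divisors W.\<Gamma>\<epsilon>" unfolding X_def by (intro divisors_sum) simp
    show "effective X" unfolding X_def by (intro effective_sum) simp
  qed
  have "divisor_degree (E1 + X) = int r"
  proof -
    have "real_of_int (divisor_degree (E1 + X)) = of_int (divisor_degree E + int (card J))"
      using arg_cong[OF E1(3), of real_of_int] by (simp add: divisor_degree_wsum X_def)
    then show ?thesis using r cardJ by linarith
  qed
  moreover have "verts (curve_graph W.\<Gamma>\<epsilon>) \<noteq> {}"
    using ne gen.cls_in_verts by auto
  ultimately obtain D' where D': "(push W.embed D, D') \<in> lin_equiv W.\<Gamma>\<epsilon>" "effective (D' - (E1 + X))"
    using rank W.L.pure_rank_ge_iff[of r "push W.embed D"] divisors_add[OF E1(1) X(1)] effective_add[OF E1(2) X(2)]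
    unfolding divisor_rank_def divisor_contains_def by blast
  define R where "R = D' - (E1 + X)"
  have D'div: "D' \<in> divisors W.\<Gamma>\<epsilon>" and D'rel: "curve_rel W.\<Gamma>\<epsilon> (D' - push W.embed D) (\<lambda>_. 0)"
    using D'(1) by (simp_all add: W.L.lin_equiv_iff_curve_rel)
  have R: "effective R" "R \<in> divisors W.\<Gamma>\<epsilon>"
    unfolding R_def using D'(2) divisors_diff[OF D'div divisors_add[OF E1(1) X(1)]] by auto
  have D'_eq: "E1 - push W.embed D + X + R = D' - push W.embed D" by (simp add: R_def)
  have chips: "card J' \<le> card {e. (\<exists>t. Interior e t \<in> Poly_Mapping.keys R) \<and> (\<exists>j\<in>J'. \<gamma> j e \<noteq> 0)}"
    if "J' \<subseteq> J" for J'
    by (rule gen_chips[of R, folded X_def, unfolded D'_eq, OF D'rel that])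
  \<comment> \<open>\<open>E\<close> is kept apart from \<open>Y\<close>, since it stays fixed while
    \<open>Y\<close> will vary with the parameter.\<close>
  define Y where "Y = push (lift_point s') (push W.retract (X + R))"
  have XR: "push W.retract (X + R) \<in> divisors ?\<Gamma>"
    by (intro W.push_retract_divisors divisors_add X R)
  have "effective Y" unfolding Y_def by (intro effective_push effective_add X R)
  moreover have "Poly_Mapping.keys Y \<subseteq> half_open_points G"
    unfolding Y_def by (rule gen.keys_push_lift[OF XR])
  moreover have "curve_rel ?\<Gamma> (push (contract_point G s') (Y + E) - D) (\<lambda>_. 0)"
  proof -
    have c1: "push (contract_point G s') Y = push W.retract (X + R)"
      unfolding Y_def by (rule gen.push_contract_lift[OF XR])
    have "push (contract_point G s') (Y + E) - D = push W.retract (X + R) + push W.retract E1 - push W.retract (push W.embed D)"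
      unfolding frag_extend_add[of _ Y E] c1 E1_def W.push_retract_embed ..
    also have "\<dots> = push W.retract (D' - push W.embed D)"
      unfolding frag_extend_add[symmetric] frag_extend_diff[symmetric] R_def
      by (intro arg_cong[of _ _ "push W.retract"]) (simp add: algebra_simps)
    finally show ?thesis using W.curve_rel_retract[OF D'rel] by simp
  qed
  moreover have "2 * real (k V) \<le> wsum (\<lambda>p. if p \<in> collapsing_points G s V then 1 else 0) Y" if V: "V \<in> verts lim.Gs" for V
  proof -
    let ?f = "\<lambda>p. if lift_point s' (W.retract p) \<in> collapsing_points G s V then 1 else (0::real)"
    have f1: "?f (Interior e t) = 1" if e: "e \<in> region V" "e \<in> ?A" for e t
    proof (cases e)
      case (Inl f)
      then show ?thesis using e by (auto simp: region_def lift_point_def collapsing_points_def)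
    next
      case (Inr l)
      then have "fst l \<in> verts gen.Gs" "fst l \<subseteq> V" using e by (auto simp: region_def)
      then have "(SOME v. v \<in> fst l) \<in> V" using gen.some_in_class[of "fst l"] by blast
      then show ?thesis by (simp add: Inr lift_point_def collapsing_points_def)
    qed
    have JVJ: "JV V \<subseteq> J" using V by (auto simp: J_def)
    have "real (k V) = (\<Sum>j\<in>JV V. 1)" using JV(2)[OF V] by simp
    also have "\<dots> = (\<Sum>j\<in>JV V. ?f (Interior j (x j)))"
      using f1[OF JV_region[OF V] subsetD[OF JV(1)[OF V]]] by (intro sum.cong refl) simp
    also have "\<dots> \<le> (\<Sum>j\<in>J. ?f (Interior j (x j)))"
      using J(1) JVJ by (intro sum_mono2) auto
    also have "\<dots> = wsum ?f X" by (simp add: X_def)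
    finally have 1: "real (k V) \<le> wsum ?f X" .
    \<comment> \<open>Distinct edges carry distinct chips, so the number of edges bounds the number
      of chips of \<open>R\<close> in the region from below.\<close>
    define F where "F = {e. (\<exists>t. Interior e t \<in> Poly_Mapping.keys R) \<and> (\<exists>j\<in>JV V. \<gamma> j e \<noteq> 0)}"
    have "\<forall>e\<in>F. \<exists>t. Interior e t \<in> Poly_Mapping.keys R" by (simp add: F_def)
    from bchoice[OF this] obtain \<tau> where \<tau>: "\<And>e. e \<in> F \<Longrightarrow> Interior e (\<tau> e) \<in> Poly_Mapping.keys R" by blast
    have FA: "e \<in> ?A" if "e \<in> F" for e
    proof -
      have "Interior e (\<tau> e) \<in> points W.\<Gamma>\<epsilon>" using \<tau>[OF that] R(2) unfolding divisors_def by blast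
      then show ?thesis unfolding points_def by blast
    qed
    have Freg: "e \<in> region V" if "e \<in> F" for e
      using that gV(2)[OF V] \<gamma>_eq[OF V] by (auto simp: F_def)
    have finF: "finite F" using FA finA by (meson finite_subset subsetI)
    let ?I = "\<lambda>e. Interior e (\<tau> e) :: ('v set, 'e + 'v set \<times> nat) point"
    have "real (k V) \<le> real (card F)" using chips[OF JVJ] JV(2)[OF V] by (simp add: F_def)
    also have "\<dots> = (\<Sum>p\<in>?I ` F. 1)"
      by (simp add: card_image inj_on_def)
    also have "\<dots> \<le> (\<Sum>p\<in>?I ` F. ?f p * of_int (Poly_Mapping.lookup R p))"
    proof (intro sum_mono)
      fix p assume "p \<in> ?I ` F"
      then obtain e where e: "e \<in> F" "p = Interior e (\<tau> e)" by blast
      have "?f p = 1" unfolding e(2) by (rule f1[OF Freg[OF e(1)] FA[OF e(1)]])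
      moreover have "1 \<le> Poly_Mapping.lookup R p"
        using \<tau>[OF e(1)] R(1) unfolding e(2)[symmetric] effective_def in_keys_iff
        by (metis int_one_le_iff_zero_less order_less_le)
      ultimately show "1 \<le> ?f p * of_int (Poly_Mapping.lookup R p)" by simp
    qed
    also have "\<dots> \<le> wsum ?f R"
      unfolding wsum_def using R(1) \<tau> by (intro sum_mono2) (auto simp: effective_def)
    finally have 2: "real (k V) \<le> wsum ?f R" .
    have "wsum (\<lambda>p. if p \<in> collapsing_points G s V then 1 else 0) Y = wsum ?f X + wsum ?f R"
      by (simp add: Y_def)
    then show ?thesis using 1 2 by simp
  qed
  ultimately show ?thesis by (intro exI[of _ Y]) auto
qed

end


section \<open>Limits of effective representatives\<close>

lemma common_convergent_subsequence:
  fixes X :: "nat \<Rightarrow> 'i \<Rightarrow> real"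
  assumes "finite I" "\<And>i. i \<in> I \<Longrightarrow> bounded (range (\<lambda>n. X n i))"
  shows "\<exists>k l. strict_mono (k :: nat \<Rightarrow> nat) \<and> (\<forall>i\<in>I. (\<lambda>n. X (k n) i) \<longlonglongrightarrow> l i)"
  using assms
proof (induction I rule: finite_induct)
  case empty
  show ?case by (intro exI[of _ id]) (simp add: strict_mono_def)
next
  case (insert j I)
  then obtain k :: "nat \<Rightarrow> nat" and l where k: "strict_mono k" "\<And>i. i \<in> I \<Longrightarrow> (\<lambda>n. X (k n) i) \<longlonglongrightarrow> l i" by auto
  have "bounded (range (\<lambda>n. X (k n) j))"
    by (rule bounded_subset[of "range (\<lambda>n. X n j)"]) (use insert.prems in auto)
  then obtain lj k' where k': "strict_mono (k' :: nat \<Rightarrow> nat)" "((\<lambda>n. X (k n) j) \<circ> k') \<longlonglongrightarrow> lj"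
    using bounded_imp_convergent_subsequence by blast
  have "(\<lambda>n. X ((k \<circ> k') n) i) \<longlonglongrightarrow> (l(j := lj)) i" if "i \<in> insert j I" for i
  proof (cases "i = j")
    case True
    then show ?thesis using k'(2) by (simp add: comp_def)
  next
    case False
    then have "(\<lambda>n. X (k n) i) \<longlonglongrightarrow> l i" using that k(2) by blast
    from LIMSEQ_subseq_LIMSEQ[OF this k'(1)] False show ?thesis by (simp add: comp_def)
  qed
  then show ?case using strict_mono_o[OF k(1) k'(1)] by blast
qed

lemma constant_subsequence:
  assumes "finite (range f)"
  shows "\<exists>k. strict_mono (k :: nat \<Rightarrow> nat) \<and> (\<forall>n. f (k n) = f (k 0))"
proof -
  obtain y where y: "infinite (f -` {y})"
    using inf_img_fin_domE[OF assms] by (metis infinite_UNIV_nat)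
  define k where "k = enumerate (f -` {y})"
  have "strict_mono k" unfolding k_def using strict_mono_enumerate[OF y] .
  moreover have "f (k n) = y" for n using enumerate_in_set[OF y, of n] by (simp add: k_def)
  ultimately show ?thesis by auto
qed

lemma convergent_integers_eventually_constant:
  fixes X :: "nat \<Rightarrow> int"
  assumes "(\<lambda>n. real_of_int (X n)) \<longlonglongrightarrow> l"
  shows "\<exists>N. \<forall>n\<ge>N. X n = X N"
proof -
  have "Cauchy (\<lambda>n. real_of_int (X n))" using assms by (rule LIMSEQ_imp_Cauchy)
  then obtain N where "\<And>m n. m \<ge> N \<Longrightarrow> n \<ge> N \<Longrightarrow> dist (real_of_int (X m)) (real_of_int (X n)) < 1"
    unfolding Cauchy_def by (meson zero_less_one)
  then have "\<bar>real_of_int (X n) - real_of_int (X N)\<bar> < 1" if "n \<ge> N" for n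
    using that by (auto simp: dist_real_def)
  then have "X n = X N" if "n \<ge> N" for n
    using that by (metis abs_less_iff less_irrefl linorder_neqE_linordered_idom of_int_1 of_int_diff of_int_less_iff
        diff_gt_0_iff_gt int_one_le_iff_zero_less minus_diff_eq order.strict_trans2 not_less)
  then show ?thesis by blast
qed

text \<open>Testing the gradient \<open>S n (m n - B n - Z n)\<close> against the cycle \<open>x = m n - m 0 - Z n\<close> bounds the
  energy \<open>\<Sum> S n x\<^sup>2\<close>. Hence the slopes \<open>m n\<close> stay bounded on the edges whose lengths do not
  tend to \<open>0\<close>, and on the other edges \<open>S n (m n)\<close> tends to \<open>0\<close>.\<close>

lemma (in fin_digraph) limit_of_gradients:
  fixes S Z B :: "nat \<Rightarrow> 'b \<Rightarrow> real" and m :: "nat \<Rightarrow> 'b \<Rightarrow> int" and \<phi> :: "nat \<Rightarrow> 'a \<Rightarrow> real"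
  assumes S0: "\<And>n e. e \<in> arcs G \<Longrightarrow> 0 \<le> S n e" and s0: "\<And>e. e \<in> arcs G \<Longrightarrow> 0 \<le> s e"
    and S_half: "\<And>n e. e \<in> arcs G \<Longrightarrow> s e / 2 \<le> S n e"
    and S: "\<And>e. e \<in> arcs G \<Longrightarrow> (\<lambda>n. S n e) \<longlonglongrightarrow> s e"
    and Z: "\<And>e. e \<in> arcs G \<Longrightarrow> (\<lambda>n. Z n e) \<longlonglongrightarrow> z e"
    and B: "\<And>e. e \<in> arcs G \<Longrightarrow> (\<lambda>n. B n e) \<longlonglongrightarrow> b e"
    and ZH: "\<And>n. Z n \<in> H1R G"
    and grad: "\<And>n e. e \<in> arcs G \<Longrightarrow> \<phi> n (head G e) - \<phi> n (tail G e) = S n e * (of_int (m n e) - B n e - Z n e)"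
    and net: "\<And>n v. v \<in> verts G \<Longrightarrow> net_inflow G (m n) v = h v"
  shows "\<exists>\<psi> m'. (\<forall>v\<in>verts G. net_inflow G m' v = h v) \<and>
    (\<forall>e\<in>arcs G. \<psi> (head G e) - \<psi> (tail G e) = s e * (of_int (m' e) - b e - z e))"
proof -
  \<comment> \<open>A cycle, since \<open>m n\<close> and \<open>m 0\<close> have the same net
    inflow \<open>h\<close>. In terms of \<open>x\<close> the gradient is
    \<open>S n e * (x n e - (B n e - m 0 e))\<close>, whose second part converges.\<close>
  define x where "x = (\<lambda>n e. if e \<in> arcs G then of_int (m n e) - of_int (m 0 e) - Z n e else 0)"
  have xH: "x n \<in> H1R G" for n
  proof -
    have "net_inflow G (x n) v = 0" if v: "v \<in> verts G" for v
    proof -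
      have "net_inflow G (x n) v = net_inflow G (\<lambda>e. of_int (m n e) - of_int (m 0 e) - Z n e) v"
        by (rule net_inflow_cong) (simp add: x_def)
      then show ?thesis
        using net[OF v] ZH[of n] v by (simp add: net_inflow_diff net_inflow_of_int H1R_iff)
    qed
    then show ?thesis by (simp add: H1R_iff x_def)
  qed
  \<comment> \<open>The mixed term of the energy is split by \<open>amgm\<close>; half of the energy
    is absorbed on the left and the other half is \<open>Q n / 2\<close>, which is bounded because
    \<open>Q\<close> converges.\<close>
  define Q where "Q = (\<lambda>n. \<Sum>e\<in>arcs G. S n e * (B n e - of_int (m 0 e))\<^sup>2)"
  have amgm: "a * c \<le> a\<^sup>2 / 2 + c\<^sup>2 / 2" for a c :: real
    using zero_le_power2[of "a - c"] by (simp add: power2_diff)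
  have energy: "(\<Sum>e\<in>arcs G. S n e * (x n e)\<^sup>2) \<le> Q n" for n
  proof -
    have "0 = (\<Sum>e\<in>arcs G. (\<phi> n (head G e) - \<phi> n (tail G e)) * x n e)"
      using potential_cycle_orthogonal[OF xH, of "\<phi> n"] by simp
    also have "\<dots> = (\<Sum>e\<in>arcs G. S n e * (x n e)\<^sup>2 - S n e * ((B n e - of_int (m 0 e)) * x n e))"
      by (intro sum.cong refl) (simp add: grad x_def power2_eq_square algebra_simps)
    finally have 1: "(\<Sum>e\<in>arcs G. S n e * (x n e)\<^sup>2) = (\<Sum>e\<in>arcs G. S n e * ((B n e - of_int (m 0 e)) * x n e))"
      by (simp add: sum_subtractf)
    have "(\<Sum>e\<in>arcs G. S n e * ((B n e - of_int (m 0 e)) * x n e)) \<le>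
        (\<Sum>e\<in>arcs G. S n e * ((B n e - of_int (m 0 e))\<^sup>2 / 2 + (x n e)\<^sup>2 / 2))"
      by (intro sum_mono mult_left_mono S0 amgm)
    also have "\<dots> = Q n / 2 + (\<Sum>e\<in>arcs G. S n e * (x n e)\<^sup>2) / 2"
      by (simp add: Q_def sum_divide_distrib sum.distrib[symmetric] distrib_left)
    finally show ?thesis using 1 by simp
  qed
  have "Q \<longlonglongrightarrow> (\<Sum>e\<in>arcs G. s e * (b e - of_int (m 0 e))\<^sup>2)"
    unfolding Q_def by (intro tendsto_intros S B)
  then have "Bseq Q" by (rule convergent_imp_Bseq[OF convergentI])
  then obtain C where C: "0 < C" "\<And>n. \<bar>Q n\<bar> \<le> C" by (auto simp: Bseq_def)
  have xC: "S n e * (x n e)\<^sup>2 \<le> C" if e: "e \<in> arcs G" for n e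
  proof -
    have "S n e * (x n e)\<^sup>2 \<le> (\<Sum>e\<in>arcs G. S n e * (x n e)\<^sup>2)"
      by (rule member_le_sum[OF e]) (auto simp: S0)
    then show ?thesis using energy[of n] C(2)[of n] by linarith
  qed
  let ?P = "{e \<in> arcs G. 0 < s e}"
  have "\<exists>k l. strict_mono (k :: nat \<Rightarrow> nat) \<and> (\<forall>e\<in>?P. (\<lambda>n. real_of_int (m (k n) e)) \<longlonglongrightarrow> l e)"
  proof (rule common_convergent_subsequence)
    fix e assume e: "e \<in> ?P"
    have "Bseq (\<lambda>n. Z n e)" using e Z by (intro convergent_imp_Bseq convergentI) auto
    then obtain CZ where CZ: "\<And>n. \<bar>Z n e\<bar> \<le> CZ" by (auto simp: Bseq_def)
    have "\<bar>x n e\<bar> \<le> sqrt (2 * C / s e)" for n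
    proof (rule real_le_rsqrt)
      \<comment> \<open>\<open>S_half\<close> keeps the weight of the energy on this edge away from
        0 for all \<open>n\<close>.\<close>
      have "s e / 2 * (x n e)\<^sup>2 \<le> S n e * (x n e)\<^sup>2"
        using S_half[of e n] e by (intro mult_right_mono) auto
      also have "\<dots> \<le> C" using xC e by simp
      finally show "\<bar>x n e\<bar>\<^sup>2 \<le> 2 * C / s e" using e by (simp add: field_simps)
    qed
    then have "\<bar>real_of_int (m n e)\<bar> \<le> sqrt (2 * C / s e) + \<bar>real_of_int (m 0 e)\<bar> + CZ" for n
      using CZ[of n] e abs_triangle_ineq[of "x n e + of_int (m 0 e)" "Z n e"] abs_triangle_ineq[of "x n e" "of_int (m 0 e)"]
      by (smt (verit) x_def mem_Collect_eq)
    then show "bounded (range (\<lambda>n. real_of_int (m n e)))"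
      unfolding bounded_iff by (auto intro!: exI)
  qed simp
  then obtain k l where k: "strict_mono (k :: nat \<Rightarrow> nat)" "\<And>e. e \<in> ?P \<Longrightarrow> (\<lambda>n. real_of_int (m (k n) e)) \<longlonglongrightarrow> l e"
    by blast
  have "\<forall>e\<in>?P. \<exists>N. \<forall>n\<ge>N. m (k n) e = m (k N) e"
    using convergent_integers_eventually_constant[OF k(2)] by blast
  from bchoice[OF this] obtain N where N: "\<And>e n. e \<in> ?P \<Longrightarrow> N e \<le> n \<Longrightarrow> m (k n) e = m (k (N e)) e" by blast
  define M where "M = (\<Sum>e\<in>?P. N e)"
  have NM: "N e \<le> M" if "e \<in> ?P" for e unfolding M_def using that by (intro member_le_sum) auto
  \<comment> \<open>Taking all slopes from one index keeps the net inflow equal to \<open>h\<close>.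
    By the choice of \<open>M\<close> they are the eventual values where \<open>0 < s e\<close>;
    elsewhere the limit equation multiplies them by 0.\<close>
  define m' where "m' = m (k M)"
  have m': "m (k n) e = m' e" if "e \<in> ?P" "M \<le> n" for e n
    using N[OF that(1), of n] N[OF that(1), of M] NM[OF that(1)] that(2) by (simp add: m'_def)
  have lim_sub: "(\<lambda>n. X (k n)) \<longlonglongrightarrow> a" if "X \<longlonglongrightarrow> a" for X :: "nat \<Rightarrow> real" and a
    using LIMSEQ_subseq_LIMSEQ[OF that k(1)] by (simp add: comp_def)
  define y where "y = (\<lambda>e. s e * (of_int (m' e) - b e - z e))"
  have lim: "(\<lambda>n. S (k n) e * (of_int (m (k n) e) - B (k n) e - Z (k n) e)) \<longlonglongrightarrow> y e" if e: "e \<in> arcs G" for e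
  proof (cases "0 < s e")
    case True
    have "(\<lambda>n. S (k n) e * (of_int (m' e) - B (k n) e - Z (k n) e)) \<longlonglongrightarrow> y e"
      unfolding y_def by (intro tendsto_intros lim_sub S B Z e)
    then show ?thesis
    proof (rule Lim_transform_eventually)
      show "\<forall>\<^sub>F n in sequentially. S (k n) e * (of_int (m' e) - B (k n) e - Z (k n) e) =
          S (k n) e * (of_int (m (k n) e) - B (k n) e - Z (k n) e)"
        using True e by (intro eventually_sequentiallyI[of M]) (simp add: m')
    qed
  next
    case False
    then have se: "s e = 0" using s0[OF e] by simp
    \<comment> \<open>Here the slopes may be unbounded, but the square of
      \<open>S n e * x n e\<close> is at most \<open>S n e * C\<close>.\<close>
    have "(\<lambda>n. S n e * x n e) \<longlonglongrightarrow> 0"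
    proof (rule tendsto_rabs_zero_cancel, rule tendsto_sandwich[OF _ _ tendsto_const])
      have "(\<lambda>n. sqrt (S n e * C)) \<longlonglongrightarrow> sqrt (s e * C)"
        by (intro tendsto_intros S e)
      then show "(\<lambda>n. sqrt (S n e * C)) \<longlonglongrightarrow> 0" by (simp add: se)
      show "\<forall>\<^sub>F n in sequentially. \<bar>S n e * x n e\<bar> \<le> sqrt (S n e * C)"
      proof (intro always_eventually allI real_le_rsqrt)
        fix n
        have "(S n e * x n e)\<^sup>2 = S n e * (S n e * (x n e)\<^sup>2)" by (simp add: power2_eq_square)
        also have "\<dots> \<le> S n e * C" by (intro mult_left_mono xC S0 e)
        finally show "\<bar>S n e * x n e\<bar>\<^sup>2 \<le> S n e * C" by simp
      qed
    qed simp
    moreover have "(\<lambda>n. S n e * (of_int (m 0 e) - B n e)) \<longlonglongrightarrow> s e * (of_int (m 0 e) - b e)"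
      by (intro tendsto_intros S B e)
    ultimately have "(\<lambda>n. S n e * x n e + S n e * (of_int (m 0 e) - B n e)) \<longlonglongrightarrow> 0 + s e * (of_int (m 0 e) - b e)"
      by (rule tendsto_add)
    moreover have "S n e * x n e + S n e * (of_int (m 0 e) - B n e) = S n e * (of_int (m n e) - B n e - Z n e)" for n
      using e by (simp add: x_def algebra_simps)
    ultimately have "(\<lambda>n. S n e * (of_int (m n e) - B n e - Z n e)) \<longlonglongrightarrow> 0" by (simp add: se)
    from lim_sub[OF this] show ?thesis by (simp add: y_def se)
  qed
  \<comment> \<open>Being a gradient passes to the limit in the form of orthogonality to cycles;
    convergence of the potentials \<open>\<phi> n\<close> is not claimed.\<close>
  have "(\<Sum>e\<in>arcs G. y e * u e) = 0" if u: "u \<in> H1R G" for u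
  proof (rule LIMSEQ_unique)
    show "(\<lambda>n. \<Sum>e\<in>arcs G. S (k n) e * (of_int (m (k n) e) - B (k n) e - Z (k n) e) * u e) \<longlonglongrightarrow> (\<Sum>e\<in>arcs G. y e * u e)"
      by (intro tendsto_sum tendsto_mult_right lim)
    have "(\<Sum>e\<in>arcs G. S (k n) e * (of_int (m (k n) e) - B (k n) e - Z (k n) e) * u e) = 0" for n
      using potential_cycle_orthogonal[OF u, of "\<phi> (k n)"] by (simp add: grad cong: sum.cong)
    then show "(\<lambda>n. \<Sum>e\<in>arcs G. S (k n) e * (of_int (m (k n) e) - B (k n) e - Z (k n) e) * u e) \<longlonglongrightarrow> 0"
      by simp
  qed
  from orthogonal_to_cycles_potential[OF this] obtain \<psi> where
    "\<forall>e\<in>arcs G. y e = \<psi> (head G e) - \<psi> (tail G e)" by blast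
  moreover have "\<forall>v\<in>verts G. net_inflow G m' v = h v" by (simp add: m'_def net)
  ultimately show ?thesis unfolding y_def by (intro exI[of _ \<psi>] exI[of _ m']) simp
qed

section \<open>Limits of effective divisors\<close>

definition point_type :: "('v, 'e) point \<Rightarrow> 'v + 'e" where
  "point_type p = (case p of Vertex v \<Rightarrow> Inl v | Interior e t \<Rightarrow> Inr e)"

definition point_coord :: "('v, 'e) point \<Rightarrow> real" where
  "point_coord p = (case p of Vertex v \<Rightarrow> 0 | Interior e t \<Rightarrow> t)"

definition make_point :: "'v + 'e \<Rightarrow> real \<Rightarrow> ('v, 'e) point" where
  "make_point T t = (case T of Inl v \<Rightarrow> Vertex v | Inr e \<Rightarrow> Interior e t)"

lemma make_point_type_coord: "make_point (point_type p) (point_coord p) = p"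
  by (cases p) (auto simp: make_point_def point_type_def point_coord_def)

text \<open>There are finitely many types of points, so along a subsequence every chip keeps its
  vertex or edge, and its coordinate converges in the compact interval {0..1}. The values of
  \<open>head_degree\<close> depend on types only and stay constant, while the moments are
  continuous in the coordinates. The clause on \<open>\<omega>\<close> exports the constancy of
  types, for counting chips later.\<close>

lemma (in fin_digraph) limit_lifted_rel:
  fixes S Z :: "nat \<Rightarrow> 'b \<Rightarrow> real" and Y :: "nat \<Rightarrow> ('a, 'b) divisor"
  assumes S0: "\<And>n. S n \<in> length_cone G" and s0: "s \<in> length_cone G"
    and S_half: "\<And>n e. e \<in> arcs G \<Longrightarrow> s e / 2 \<le> S n e"
    and S: "\<And>e. e \<in> arcs G \<Longrightarrow> (\<lambda>n. S n e) \<longlonglongrightarrow> s e"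
    and Z: "\<And>e. e \<in> arcs G \<Longrightarrow> (\<lambda>n. Z n e) \<longlonglongrightarrow> z e"
    and ZH: "\<And>n. Z n \<in> H1R G"
    and Y: "\<And>n. effective (Y n)" "\<And>n. divisor_degree (Y n) = int N" "\<And>n. Poly_Mapping.keys (Y n) \<subseteq> closed_points G"
    and rel: "\<And>n. lifted_rel G (S n) (Y n + F) (\<lambda>e. S n e * Z n e)"
  shows "\<exists>Y' n0. effective Y' \<and> Poly_Mapping.keys Y' \<subseteq> closed_points G \<and>
    (\<forall>\<omega>. (\<forall>e t t'. \<omega> (Interior e t) = \<omega> (Interior e t')) \<longrightarrow> wsum \<omega> Y' = wsum \<omega> (Y n0)) \<and>
    lifted_rel G s (Y' + F) (\<lambda>e. s e * z e)"
proof -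
  have "\<forall>n. \<exists>c. (\<forall>i<N. c i \<in> Poly_Mapping.keys (Y n)) \<and> Y n = (\<Sum>i<N. frag_of (c i))"
    using effective_eq_sum_points[OF Y(1,2)] by blast
  then obtain c where c: "\<And>n i. i < N \<Longrightarrow> c n i \<in> Poly_Mapping.keys (Y n)" "\<And>n. Y n = (\<Sum>i<N. frag_of (c n i))"
    by metis
  have c_closed: "c n i \<in> closed_points G" if "i < N" for n i using c(1)[OF that] Y(3) by blast
  define f where "f = (\<lambda>n. restrict (\<lambda>i. point_type (c n i)) {..<N})"
  have "point_type p \<in> Inl ` verts G \<union> Inr ` arcs G" if "p \<in> closed_points G" for p
    using that by (auto simp: closed_points_def point_type_def)
  then have "range f \<subseteq> {..<N} \<rightarrow>\<^sub>E (Inl ` verts G \<union> Inr ` arcs G)"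
    using c_closed unfolding f_def by (intro image_subsetI) (simp add: restrict_PiE_iff)
  then have "finite (range f)" by (rule finite_subset) (auto intro!: finite_PiE)
  from constant_subsequence[OF this] obtain k1 :: "nat \<Rightarrow> nat"
    where k1: "strict_mono k1" "\<And>n. f (k1 n) = f (k1 0)" by blast
  have "\<exists>k l. strict_mono (k :: nat \<Rightarrow> nat) \<and> (\<forall>i\<in>{..<N}. (\<lambda>n. point_coord (c (k1 (k n)) i)) \<longlonglongrightarrow> l i)"
  proof (rule common_convergent_subsequence)
    fix i assume "i \<in> {..<N}"
    then have "\<bar>point_coord (c (k1 n) i)\<bar> \<le> 1" for n
      using c_closed[of i "k1 n"] by (auto simp: closed_points_def point_coord_def)
    then show "bounded (range (\<lambda>n. point_coord (c (k1 n) i)))"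
      unfolding bounded_iff by (auto intro!: exI[of _ 1])
  qed simp
  then obtain k2 \<tau> where k2: "strict_mono k2" "\<And>i. i < N \<Longrightarrow> (\<lambda>n. point_coord (c (k1 (k2 n)) i)) \<longlonglongrightarrow> \<tau> i" by blast
  define k where "k = k1 \<circ> k2"
  have k: "strict_mono k" unfolding k_def using k1(1) k2(1) by (rule strict_mono_o)
  define T where "T = (\<lambda>i. point_type (c (k1 0) i))"
  define t where "t = (\<lambda>n i. point_coord (c (k n) i))"
  have ck: "c (k n) i = make_point (T i) (t n i)" if "i < N" for n i
  proof -
    have "f (k n) i = f (k1 0) i" using k1(2)[of "k2 n"] by (simp add: k_def)
    then have "point_type (c (k n) i) = T i" using that by (simp add: f_def T_def)
    then show ?thesis using make_point_type_coord[of "c (k n) i"] by (simp add: t_def)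
  qed
  have t: "(\<lambda>n. t n i) \<longlonglongrightarrow> \<tau> i" if "i < N" for i using k2(2)[OF that] by (simp add: t_def k_def)
  define Y' where "Y' = (\<Sum>i<N. frag_of (make_point (T i) (\<tau> i)))"
  have Yk: "Y (k n) = (\<Sum>i<N. frag_of (make_point (T i) (t n i)))" for n
    unfolding c(2)[of "k n"] by (intro sum.cong) (auto simp: ck)
  have closed: "make_point (T i) (\<tau> i) \<in> closed_points G" if i: "i < N" for i
  proof (cases "T i")
    case (Inl v)
    then show ?thesis using c_closed[OF i, of "k 0"] ck[OF i, of 0] by (simp add: make_point_def closed_points_def)
  next
    case (Inr e)
    then have e: "e \<in> arcs G" "0 \<le> t n i" "t n i \<le> 1" for n
      using c_closed[OF i, of "k n"] ck[OF i, of n] by (auto simp: make_point_def closed_points_def)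
    have "0 \<le> \<tau> i" "\<tau> i \<le> 1"
      using LIMSEQ_le_const[OF t[OF i], of 0] LIMSEQ_le_const2[OF t[OF i], of 1] e by auto
    then show ?thesis using e Inr by (auto simp: make_point_def closed_points_def)
  qed
  have keysY': "Poly_Mapping.keys Y' \<subseteq> closed_points G"
    unfolding Y'_def using closed by (intro keys_sum_subset) auto
  have type: "wsum \<omega> Y' = wsum \<omega> (Y (k n))" if "\<forall>e t t'. \<omega> (Interior e t) = \<omega> (Interior e t')" for \<omega> n
  proof -
    have "\<omega> (make_point (T i) a) = \<omega> (make_point (T i) b)" for i a b
      using that by (cases "T i") (auto simp: make_point_def)
    then show ?thesis unfolding Y'_def Yk by (auto intro!: sum.cong)
  qed
  define B where "B = (\<lambda>n e. edge_moment (\<lambda>e t. 1 - t) e (Y (k n) + F))"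
  define b where "b = (\<lambda>e. edge_moment (\<lambda>e t. 1 - t) e (Y' + F))"
  have mom: "edge_moment (\<lambda>e t. l e * (1 - t)) e D = l e * edge_moment (\<lambda>e t. 1 - t) e D" for l e and D :: "('a, 'b) divisor"
    unfolding edge_moment_def wsum_weight_mult[symmetric] by (intro wsum_cong) (auto split: point.split)
  have "\<forall>n. \<exists>\<phi>m. (\<forall>e\<in>arcs G. fst \<phi>m (head G e) - fst \<phi>m (tail G e) =
       of_int (snd \<phi>m e) * S (k n) e - edge_moment (\<lambda>e t. S (k n) e * (1 - t)) e (Y (k n) + F) - S (k n) e * Z (k n) e) \<and>
     (\<forall>v\<in>verts G. head_degree G v (Y (k n) + F) = of_int (net_inflow G (snd \<phi>m :: 'b \<Rightarrow> int) v))"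
    using rel[of "k _"] unfolding abel_rel_def by auto
  from choice[OF this] obtain \<phi>m :: "nat \<Rightarrow> ('a \<Rightarrow> real) \<times> ('b \<Rightarrow> int)" where
    \<phi>m: "\<And>n e. e \<in> arcs G \<Longrightarrow> fst (\<phi>m n) (head G e) - fst (\<phi>m n) (tail G e) =
       of_int (snd (\<phi>m n) e) * S (k n) e - edge_moment (\<lambda>e t. S (k n) e * (1 - t)) e (Y (k n) + F) - S (k n) e * Z (k n) e"
    "\<And>n v. v \<in> verts G \<Longrightarrow> head_degree G v (Y (k n) + F) = of_int (net_inflow G (snd (\<phi>m n)) v)" by blast
  have hd: "head_degree G v (Y' + F) = head_degree G v (Y (k n) + F)" for n v
    using type[of "\<lambda>p. if head_point G p = v then 1 else 0" n] by (simp add: head_degree_def)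
  have lim_sub: "(\<lambda>n. X (k n)) \<longlonglongrightarrow> a" if "X \<longlonglongrightarrow> a" for X :: "nat \<Rightarrow> real" and a
    using LIMSEQ_subseq_LIMSEQ[OF that k] by (simp add: comp_def)
  have "\<exists>\<psi> m'. (\<forall>v\<in>verts G. net_inflow G m' v = \<lfloor>head_degree G v (Y' + F)\<rfloor>) \<and>
    (\<forall>e\<in>arcs G. \<psi> (head G e) - \<psi> (tail G e) = s e * (of_int (m' e) - b e - z e))"
  proof (rule limit_of_gradients[of "\<lambda>n. S (k n)" s "\<lambda>n. Z (k n)" z B b "\<lambda>n. fst (\<phi>m n)" "\<lambda>n. snd (\<phi>m n)"])
    fix e assume e: "e \<in> arcs G"
    show "(\<lambda>n. B n e) \<longlonglongrightarrow> b e"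
    proof -
      have 1: "(\<lambda>n. edge_moment (\<lambda>e t. 1 - t) e (frag_of (make_point (T i) (t n i)))) \<longlonglongrightarrow>
          edge_moment (\<lambda>e t. 1 - t) e (frag_of (make_point (T i) (\<tau> i)))" if "i < N" for i
        using t[OF that] by (cases "T i") (auto simp: make_point_def intro!: tendsto_intros)
      show ?thesis
        unfolding B_def b_def Yk Y'_def edge_moment_linear by (intro tendsto_intros 1) auto
    qed
  next
    fix n e assume e: "e \<in> arcs G"
    show "fst (\<phi>m n) (head G e) - fst (\<phi>m n) (tail G e) = S (k n) e * (of_int (snd (\<phi>m n) e) - B n e - Z (k n) e)"
      unfolding \<phi>m(1)[OF e] mom B_def by (simp add: algebra_simps)
  next
    fix n v assume "v \<in> verts G"
    then show "net_inflow G (snd (\<phi>m n)) v = \<lfloor>head_degree G v (Y' + F)\<rfloor>"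
      using \<phi>m(2)[of v n] hd[of v n] by simp
  qed (use S0 s0 S_half ZH in \<open>auto simp: length_cone_def intro: lim_sub S Z\<close>)
  then obtain \<psi> m' where \<psi>: "\<And>v. v \<in> verts G \<Longrightarrow> net_inflow G m' v = \<lfloor>head_degree G v (Y' + F)\<rfloor>"
    "\<And>e. e \<in> arcs G \<Longrightarrow> \<psi> (head G e) - \<psi> (tail G e) = s e * (of_int (m' e) - b e - z e)" by blast
  have "lifted_rel G s (Y' + F) (\<lambda>e. s e * z e)"
  proof (rule abel_relI[of _ \<psi> m'])
    fix e assume e: "e \<in> arcs G"
    show "\<psi> (head G e) - \<psi> (tail G e) = of_int (m' e) * s e - edge_moment (\<lambda>e t. s e * (1 - t)) e (Y' + F) - s e * z e"
      unfolding \<psi>(2)[OF e] mom b_def by (simp add: algebra_simps)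
  next
    fix v assume "v \<in> verts G"
    then show "head_degree G v (Y' + F) = of_int (net_inflow G m' v)"
      using \<psi>(1)[of v] head_degree_Ints[of G v "Y' + F"] by (simp add: of_int_floor_cancel)
  qed
  moreover have "effective Y'" unfolding Y'_def by (intro effective_sum) simp
  ultimately show ?thesis using keysY' type[of _ 0] by blast
qed


section \<open>Closedness of the Brill--Noether locus\<close>

text \<open>\<open>in_locus G w \<epsilon> q d r s z\<close>: the class on \<open>\<Gamma>\<^sub>s\<close> with Abel--Jacobi coordinates \<open>z\<close>, relative to the
  base point \<open>q\<close>, has rank at least \<open>r\<close>.\<close>

definition in_locus :: "('v, 'e) pre_digraph \<Rightarrow> ('v \<Rightarrow> nat) \<Rightarrow> real \<Rightarrow> ('v, 'e) point \<Rightarrow> int \<Rightarrow> nat \<Rightarrow>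
    ('e \<Rightarrow> real) \<Rightarrow> ('e \<Rightarrow> real) \<Rightarrow> bool" where
  "in_locus G w \<epsilon> q d r s z \<longleftrightarrow> (\<exists>D\<in>divisors (curve_at G w s). divisor_degree D = d \<and>
     int r \<le> divisor_rank \<epsilon> (curve_at G w s) D \<and>
     curve_rel (curve_at G w s) (D - frag_cmul d (frag_of (contract_point G s q))) (\<lambda>e. s e * z e))"

lemma half_open_points_subset: "half_open_points G \<subseteq> closed_points G"
  by (auto simp: half_open_points_def closed_points_def)

lemma (in contraction) divisors_push_contract:
  assumes "Poly_Mapping.keys E \<subseteq> closed_points G"
  shows "push (contract_point G s) E \<in> divisors (curve_at G w s)"
proof -
  have "q \<in> points (curve_at G w s)" if q: "q \<in> Poly_Mapping.keys (push (contract_point G s) E)" for q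
  proof -
    obtain p where "p \<in> Poly_Mapping.keys E" "q = contract_point G s p"
      using q keys_push[of "contract_point G s" E] by blast
    then show ?thesis using assms contract_point_in_points by blast
  qed
  then show ?thesis by (auto simp: divisors_def)
qed

lemma (in contraction) contract_collapsing_point:
  assumes "p \<in> closed_points G" "p \<in> collapsing_points G s V" "V \<in> verts Gs"
  shows "contract_point G s p = Vertex V"
  using assms cls_eq_class_iff[OF assms(3)]
  by (auto simp: closed_points_def collapsing_points_def contract_point_simps)

lemma (in contraction) curve_rel_degree_eq:
  assumes "curve_rel (curve_at G w s) (D - E) y" "D \<in> divisors (curve_at G w s)" "E \<in> divisors (curve_at G w s)"
  shows "divisor_degree D = divisor_degree E"
proof -
  interpret M: metric_graph "curve_at G w s" by (rule metric_graph_curve_at)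
  have "divisor_degree (D - E) = 0"
    using M.abel_rel_degree[OF assms(1)] divisors_diff[OF assms(2,3)] M.head_point_in_verts by (auto simp: divisors_def)
  then have "real_of_int (divisor_degree D) = of_int (divisor_degree E)"
    using divisor_degree_wsum[of "D - E"] by (simp add: divisor_degree_wsum)
  then show ?thesis by linarith
qed

lemma divisor_degree_linear:
  "divisor_degree (D + E) = divisor_degree D + divisor_degree E"
  "divisor_degree (frag_cmul c D) = c * divisor_degree D"
  "divisor_degree (frag_of p) = 1"
proof -
  have "real_of_int (divisor_degree (D + E)) = of_int (divisor_degree D + divisor_degree E)"
    "real_of_int (divisor_degree (frag_cmul c D)) = of_int (c * divisor_degree D)"
    by (simp_all add: divisor_degree_wsum)
  then show "divisor_degree (D + E) = divisor_degree D + divisor_degree E"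
    "divisor_degree (frag_cmul c D) = c * divisor_degree D" by linarith+
  show "divisor_degree (frag_of p) = 1" by (simp add: divisor_degree_def)
qed

text \<open>The moving parts \<open>Y n\<close> supplied by \<open>effective_lift\<close> have a
  limit \<open>Y'\<close> on \<open>G\<close>. Contraction by \<open>s\<close> sends all chips on
  collapsing points of \<open>V\<close> to \<open>V\<close>, and their number is the same for
  \<open>Y'\<close> as for one of the \<open>Y n\<close>.\<close>

lemma limit_effective_representative:
  fixes G :: "('v, 'e) pre_digraph"
  assumes G: "fin_digraph G" "verts G \<noteq> {}" and q: "q \<in> half_open_points G" and \<epsilon>: "0 < \<epsilon>"
    and S0: "\<And>n. S n \<in> length_cone G" and s0: "s \<in> length_cone G"
    and S_half: "\<And>n e. e \<in> arcs G \<Longrightarrow> s e / 2 \<le> S n e"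
    and S: "\<And>e. e \<in> arcs G \<Longrightarrow> (\<lambda>n. S n e) \<longlonglongrightarrow> s e"
    and Z: "\<And>e. e \<in> arcs G \<Longrightarrow> (\<lambda>n. Z n e) \<longlonglongrightarrow> z e"
    and ZH: "\<And>n. Z n \<in> H1R G"
    and locus: "\<And>n. in_locus G w \<epsilon> q d r (S n) (Z n)"
    and E: "E \<in> divisors (curve_at G w s)" "effective E"
    and k: "\<And>V. V \<in> verts (contracted_graph G s) \<Longrightarrow> k V \<le> curve_weight (curve_at G w s) V"
    and r: "divisor_degree E + int (\<Sum>V\<in>verts (contracted_graph G s). k V) = int r"
  shows "\<exists>D'\<in>divisors (curve_at G w s).
    curve_rel (curve_at G w s) (D' - frag_cmul d (frag_of (contract_point G s q))) (\<lambda>e. s e * z e) \<and>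
    effective (D' - E - (\<Sum>V\<in>verts (contracted_graph G s). frag_cmul (2 * int (k V)) (frag_of (Vertex V))))"
proof -
  interpret lim: contraction G s by (intro contraction.intro G s0)
  define E' where "E' = push (lift_point s) E"
  define F where "F = E' - frag_cmul d (frag_of q)"
  have E': "Poly_Mapping.keys E' \<subseteq> half_open_points G" "effective E'" "divisor_degree E' = divisor_degree E"
    unfolding E'_def using E by (auto intro: effective_push simp: divisor_degree_push dest!: lim.keys_push_lift)
  \<comment> \<open>A degree independent of \<open>n\<close>. The truncation by \<open>nat\<close>
    is harmless, because effectivity of \<open>Y\<close> forces \<open>d\<close> to be at least the
    degree of \<open>E\<close>.\<close>
  define N where "N = nat (d - divisor_degree E)"
  have "\<exists>Y. effective Y \<and> Poly_Mapping.keys Y \<subseteq> half_open_points G \<and> divisor_degree Y = int N \<and>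
      (\<forall>V\<in>verts lim.Gs. 2 * real (k V) \<le> wsum (\<lambda>p. if p \<in> collapsing_points G s V then 1 else 0) Y) \<and>
      lifted_rel G (S n) (Y + F) (\<lambda>e. S n e * Z n e)" for n
  proof -
    interpret wd: weighted_degeneration G s "S n" w \<epsilon>
    proof unfold_locales
      show "S n \<in> length_cone G" by (rule S0)
      fix e assume "e \<in> arcs G" "S n e = 0"
      then show "s e = 0" using S_half[of e n] lim.s_nonneg[of e] by simp
    qed (rule \<epsilon>)
    obtain D where D: "D \<in> divisors (curve_at G w (S n))" "divisor_degree D = d" "int r \<le> divisor_rank \<epsilon> (curve_at G w (S n)) D"
      "curve_rel (curve_at G w (S n)) (D - frag_cmul d (frag_of (contract_point G (S n) q))) (\<lambda>e. S n e * Z n e)"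
      using locus[of n] unfolding in_locus_def by blast
    have rE: "divisor_degree E' + int (\<Sum>V\<in>verts lim.Gs. k V) = int r" using r E'(3) by simp
    obtain Y where Y: "effective Y" "Poly_Mapping.keys Y \<subseteq> half_open_points G"
      "\<forall>V\<in>verts lim.Gs. 2 * real (k V) \<le> wsum (\<lambda>p. if p \<in> collapsing_points G s V then 1 else 0) Y"
      "curve_rel (curve_at G w (S n)) (push (contract_point G (S n)) (Y + E') - D) (\<lambda>_. 0)"
      using wd.effective_lift[OF D(1,3) E'(1,2) k rE G(2)] by blast
    have keysYE: "Poly_Mapping.keys (Y + E') \<subseteq> half_open_points G"
      using Poly_Mapping.keys_add[of Y E'] Y(2) E'(1) by blast
    have "divisor_degree (push (contract_point G (S n)) (Y + E')) = divisor_degree D"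
      using keysYE half_open_points_subset by (intro wd.gen.curve_rel_degree_eq[OF Y(4)] wd.gen.divisors_push_contract D(1)) blast
    then have deg: "divisor_degree Y + divisor_degree E = d"
      by (simp add: divisor_degree_push divisor_degree_linear E'(3) D(2))
    have "0 \<le> wsum (\<lambda>_. 1) Y" by (rule effective_wsum_nonneg[OF Y(1)]) simp
    then have "0 \<le> divisor_degree Y" by (simp add: divisor_degree_wsum[symmetric])
    then have "divisor_degree Y = int N" using deg by (simp add: N_def)
    moreover have "lifted_rel G (S n) (Y + F) (\<lambda>e. S n e * Z n e)"
    proof -
      have keysF: "Poly_Mapping.keys (Y + F) \<subseteq> half_open_points G"
      proof -
        have "Poly_Mapping.keys (Y + E' - frag_cmul d (frag_of q)) \<subseteq> half_open_points G"
          using keys_cmul[of d "frag_of q"] q by (intro keys_diff_subset keysYE) auto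
        then show ?thesis by (simp add: F_def add_diff_eq)
      qed
      have "push (contract_point G (S n)) (Y + F) =
          (push (contract_point G (S n)) (Y + E') - D) + (D - frag_cmul d (frag_of (contract_point G (S n) q)))"
        by (simp add: F_def frag_extend_add frag_extend_diff frag_extend_cmul)
      with abel_rel_add[OF Y(4) D(4)]
      have "curve_rel (curve_at G w (S n)) (push (contract_point G (S n)) (Y + F)) (\<lambda>e. S n e * Z n e)"
        by simp
      then show ?thesis using wd.gen.lifted_rel_iff_curve_rel[OF keysF] by blast
    qed
    ultimately show ?thesis using Y(1-3) by blast
  qed
  then have "\<forall>n. \<exists>Y. effective Y \<and> Poly_Mapping.keys Y \<subseteq> half_open_points G \<and> divisor_degree Y = int N \<and>
      (\<forall>V\<in>verts lim.Gs. 2 * real (k V) \<le> wsum (\<lambda>p. if p \<in> collapsing_points G s V then 1 else 0) Y) \<and>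
      lifted_rel G (S n) (Y + F) (\<lambda>e. S n e * Z n e)" ..
  from choice[OF this] obtain Y where
    Y: "\<And>n. effective (Y n)" "\<And>n. Poly_Mapping.keys (Y n) \<subseteq> half_open_points G" "\<And>n. divisor_degree (Y n) = int N"
    "\<And>n V. V \<in> verts lim.Gs \<Longrightarrow> 2 * real (k V) \<le> wsum (\<lambda>p. if p \<in> collapsing_points G s V then 1 else 0) (Y n)"
    "\<And>n. lifted_rel G (S n) (Y n + F) (\<lambda>e. S n e * Z n e)" by blast
  have closed: "Poly_Mapping.keys (Y n) \<subseteq> closed_points G" for n
    using Y(2) half_open_points_subset by blast
  obtain Y' n0 where Y': "effective Y'" "Poly_Mapping.keys Y' \<subseteq> closed_points G"
    "\<And>\<omega>. (\<forall>e t t'. \<omega> (Interior e t) = \<omega> (Interior e t')) \<Longrightarrow> wsum \<omega> Y' = wsum \<omega> (Y n0)"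
    "lifted_rel G s (Y' + F) (\<lambda>e. s e * z e)"
    using lim.limit_lifted_rel[OF S0 s0 S_half S Z ZH Y(1,3) closed Y(5)] by blast
  define D' where "D' = push (contract_point G s) Y' + E"
  have keysF: "Poly_Mapping.keys (Y' + F) \<subseteq> closed_points G"
  proof -
    have "Poly_Mapping.keys (Y' + E') \<subseteq> closed_points G"
      using Poly_Mapping.keys_add[of Y' E'] Y'(2) E'(1) half_open_points_subset by blast
    then have "Poly_Mapping.keys (Y' + E' - frag_cmul d (frag_of q)) \<subseteq> closed_points G"
      using keys_cmul[of d "frag_of q"] q half_open_points_subset by (intro keys_diff_subset) auto
    then show ?thesis by (simp add: F_def add_diff_eq)
  qed
  have "push (contract_point G s) (Y' + F) = D' - frag_cmul d (frag_of (contract_point G s q))"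
    using lim.push_contract_lift[OF E(1)]
    by (simp add: F_def D'_def E'_def frag_extend_add frag_extend_diff frag_extend_cmul)
  then have rel: "curve_rel (curve_at G w s) (D' - frag_cmul d (frag_of (contract_point G s q))) (\<lambda>e. s e * z e)"
    using lim.lifted_rel_imp_curve_rel[OF keysF Y'(4)] by metis
  have D': "D' \<in> divisors (curve_at G w s)"
    unfolding D'_def by (intro divisors_add lim.divisors_push_contract Y'(2) E(1))
  have "effective (push (contract_point G s) Y' - (\<Sum>V\<in>verts lim.Gs. frag_cmul (2 * int (k V)) (frag_of (Vertex V))))"
    unfolding effective_def
  proof
    fix p :: "('v set, 'e) point"
    have finV: "finite (verts lim.Gs)" by (rule fin_digraph.finite_verts[OF lim.fin_Gs])
    have l: "Poly_Mapping.lookup (\<Sum>V\<in>verts lim.Gs. frag_cmul (2 * int (k V)) (frag_of (Vertex V))) p =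
        (\<Sum>V\<in>verts lim.Gs. if p = Vertex V then 2 * int (k V) else 0)"
      unfolding lookup_sum by (intro sum.cong) auto
    show "0 \<le> Poly_Mapping.lookup (push (contract_point G s) Y' - (\<Sum>V\<in>verts lim.Gs. frag_cmul (2 * int (k V)) (frag_of (Vertex V)))) p"
    proof (cases "\<exists>V\<in>verts lim.Gs. p = Vertex V")
      case True
      then obtain V where V: "V \<in> verts lim.Gs" "p = Vertex V" by blast
      have "(\<Sum>X\<in>verts lim.Gs. if p = Vertex X then 2 * int (k X) else 0) = (\<Sum>X\<in>verts lim.Gs. if X = V then 2 * int (k V) else 0)"
        unfolding V(2) by (intro sum.cong) auto
      also have "\<dots> = 2 * int (k V)" using V(1) finV by (simp del: lim.contracted_graph_simps)
      finally have l': "Poly_Mapping.lookup (\<Sum>V\<in>verts lim.Gs. frag_cmul (2 * int (k V)) (frag_of (Vertex V))) p = 2 * int (k V)"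
        unfolding l .
      let ?\<omega> = "\<lambda>p. if p \<in> collapsing_points G s V then 1 else (0::real)"
      have "2 * real (k V) \<le> wsum ?\<omega> (Y n0)" by (rule Y(4)[OF V(1)])
      also have "\<dots> = wsum ?\<omega> Y'" by (rule Y'(3)[symmetric]) (simp add: collapsing_points_def)
      also have "\<dots> \<le> wsum (\<lambda>p'. if contract_point G s p' = p then 1 else 0) Y'"
        unfolding wsum_def
      proof (intro sum_mono mult_right_mono)
        fix p' assume "p' \<in> Poly_Mapping.keys Y'"
        then have "p' \<in> closed_points G" using Y'(2) by blast
        then show "?\<omega> p' \<le> (if contract_point G s p' = p then 1 else 0)"
          using lim.contract_collapsing_point[of p' V] V by auto
        show "0 \<le> real_of_int (Poly_Mapping.lookup Y' p')" using Y'(1) by (simp add: effective_def)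
      qed
      also have "\<dots> = of_int (Poly_Mapping.lookup (push (contract_point G s) Y') p)"
        by (rule of_int_lookup_push[symmetric])
      finally have "2 * int (k V) \<le> Poly_Mapping.lookup (push (contract_point G s) Y') p" by linarith
      then show ?thesis unfolding lookup_minus l' by simp
    next
      case False
      then have "(\<Sum>V\<in>verts lim.Gs. if p = Vertex V then 2 * int (k V) else 0) = 0"
        by (intro sum.neutral) auto
      then show ?thesis
        unfolding lookup_minus l using effective_push[OF Y'(1), of "contract_point G s"] by (simp add: effective_def)
    qed
  qed
  then have "effective (D' - E - (\<Sum>V\<in>verts lim.Gs. frag_cmul (2 * int (k V)) (frag_of (Vertex V))))"
    by (simp only: D'_def add_diff_cancel_right')
  with D' rel show ?thesis by blast
qed

text \<open>All representatives obtained from \<open>limit_effective_representative\<close>, for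
  whatever \<open>E\<close> and \<open>k\<close>, have the same coordinates \<open>z\<close>, hence
  are linearly equivalent to each other. This is the input of
  \<open>divisor_rank_geI\<close>.\<close>

lemma in_locus_limit:
  assumes G: "fin_digraph G" "verts G \<noteq> {}" and q: "q \<in> half_open_points G" and \<epsilon>: "0 < \<epsilon>"
    and S0: "\<And>n. S n \<in> length_cone G" and s0: "s \<in> length_cone G"
    and S_half: "\<And>n e. e \<in> arcs G \<Longrightarrow> s e / 2 \<le> S n e"
    and S: "\<And>e. e \<in> arcs G \<Longrightarrow> (\<lambda>n. S n e) \<longlonglongrightarrow> s e"
    and Z: "\<And>e. e \<in> arcs G \<Longrightarrow> (\<lambda>n. Z n e) \<longlonglongrightarrow> z e"
    and ZH: "\<And>n. Z n \<in> H1R G"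
    and locus: "\<And>n. in_locus G w \<epsilon> q d r (S n) (Z n)"
  shows "in_locus G w \<epsilon> q d r s z"
proof -
  interpret lim: contraction G s by (intro contraction.intro G s0)
  interpret W: weighted_curve "curve_at G w s" \<epsilon>
    by (intro weighted_curve.intro lim.metric_graph_curve_at weighted_curve_axioms.intro \<epsilon>)
  have ex: "\<exists>D'\<in>divisors (curve_at G w s).
      curve_rel (curve_at G w s) (D' - frag_cmul d (frag_of (contract_point G s q))) (\<lambda>e. s e * z e) \<and>
      effective (D' - E - (\<Sum>V\<in>verts (contracted_graph G s). frag_cmul (2 * int (k V)) (frag_of (Vertex V))))"
    if "E \<in> divisors (curve_at G w s)" "effective E"
      "\<And>V. V \<in> verts (contracted_graph G s) \<Longrightarrow> k V \<le> curve_weight (curve_at G w s) V"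
      "divisor_degree E + int (\<Sum>V\<in>verts (contracted_graph G s). k V) = int r" for E k
    by (rule limit_effective_representative[OF G q \<epsilon> S0 s0 S_half S Z ZH locus that])
  obtain v where v: "v \<in> verts G" using G(2) by blast
  then have p: "Vertex (lim.cls v) \<in> points (curve_at G w s)"
    using lim.cls_in_verts by (simp add: points_def)
  \<comment> \<open>The test with \<open>k = 0\<close> and all \<open>r\<close> chips at one vertex
    yields a representative \<open>D\<close> of the limit class, to which the others are
    compared.\<close>
  have "frag_cmul (int r) (frag_of (Vertex (lim.cls v))) \<in> divisors (curve_at G w s)"
    using p by (intro divisors_cmul) simp
  from ex[OF this, of "\<lambda>_. 0"] obtain D where D: "D \<in> divisors (curve_at G w s)"
    "curve_rel (curve_at G w s) (D - frag_cmul d (frag_of (contract_point G s q))) (\<lambda>e. s e * z e)"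
    by (auto simp: effective_cmul divisor_degree_linear)
  have cq: "frag_cmul d (frag_of (contract_point G s q)) \<in> divisors (curve_at G w s)"
    using lim.contract_point_in_points q half_open_points_subset[of G] by (intro divisors_cmul) auto
  have "divisor_degree D = d"
    using lim.curve_rel_degree_eq[OF D(2,1) cq] by (simp add: divisor_degree_linear)
  moreover have "int r \<le> divisor_rank \<epsilon> (curve_at G w s) D"
  proof (rule W.divisor_rank_geI)
    show "verts (curve_graph (curve_at G w s)) \<noteq> {}" using v lim.cls_in_verts by auto
    show "D \<in> divisors (curve_at G w s)" by fact
    fix k E
    assume k: "\<And>V. V \<in> verts (curve_graph (curve_at G w s)) \<Longrightarrow> k V \<le> curve_weight (curve_at G w s) V"
      and E: "E \<in> divisors (curve_at G w s)" "effective E"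
      and deg: "divisor_degree E + int (\<Sum>V\<in>verts (curve_graph (curve_at G w s)). k V) = int r"
    obtain D' where D': "D' \<in> divisors (curve_at G w s)"
      "curve_rel (curve_at G w s) (D' - frag_cmul d (frag_of (contract_point G s q))) (\<lambda>e. s e * z e)"
      "effective (D' - E - (\<Sum>V\<in>verts lim.Gs. frag_cmul (2 * int (k V)) (frag_of (Vertex V))))"
      using ex[OF E k[unfolded lim.curve_at_simps] deg[unfolded lim.curve_at_simps]] by blast
    have "curve_rel (curve_at G w s) (D' - D) (\<lambda>_. 0)"
      using abel_rel_diff[OF D'(2) D(2)] by simp
    then show "\<exists>D'\<in>divisors (curve_at G w s). curve_rel (curve_at G w s) (D' - D) (\<lambda>_. 0) \<and>
        effective (D' - E - (\<Sum>V\<in>verts (curve_graph (curve_at G w s)). frag_cmul (2 * int (k V)) (frag_of (Vertex V))))"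
      using D' unfolding lim.curve_at_simps by blast
  qed
  ultimately show ?thesis unfolding in_locus_def using D by blast
qed

section \<open>Topology of the universal spaces\<close>

lemma topspace_final_topology:
  assumes "\<And>x. x \<in> topspace X \<Longrightarrow> f x \<in> Y"
  shows "topspace (final_topology X f Y) = Y"
proof
  show "topspace (final_topology X f Y) \<subseteq> Y"
    unfolding topspace_def by (auto simp: openin_final_topology)
  have "{x \<in> topspace X. f x \<in> Y} = topspace X" using assms by blast
  then have "openin (final_topology X f Y) Y" by (simp add: openin_final_topology)
  then show "Y \<subseteq> topspace (final_topology X f Y)" by (rule openin_subset)
qed

lemma open_coordinate_box:
  assumes "finite A"
  shows "open {x :: 'e \<Rightarrow> real. \<forall>e\<in>A. lo e < x e \<and> x e < hi e}"
proof -
  have "open ((\<lambda>x :: 'e \<Rightarrow> real. x e) -` {lo e<..<hi e})" for e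
    by (rule open_vimage) (simp_all add: continuous_on_product_coordinates)
  then have "open (\<Inter>e\<in>A. (\<lambda>x :: 'e \<Rightarrow> real. x e) -` {lo e<..<hi e})"
    using assms by (intro open_INT) auto
  moreover have "(\<Inter>e\<in>A. (\<lambda>x :: 'e \<Rightarrow> real. x e) -` {lo e<..<hi e}) = {x. \<forall>e\<in>A. lo e < x e \<and> x e < hi e}"
    by auto
  ultimately show ?thesis by simp
qed

theorem theorem4p1:
  fixes G :: "('v, 'e) pre_digraph" and w :: "'v \<Rightarrow> nat"
    and p :: "('v set, 'e) point" and d r :: nat and \<epsilon> :: real
  assumes "fin_digraph G" and "Digraph_Component.connected G"
    and "p \<in> points (curve_at G w (ones G))"
    and "0 < \<epsilon>"
  shows "closedin (universal_Pic G w p (int d)) (brill_noether_locus \<epsilon> G w (int d) (int r))"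
proof -
  interpret fin_digraph G by fact
  interpret one: contraction G "ones G" by (intro contraction.intro assms(1) ones_cone)
  \<comment> \<open>A fixed point of \<open>G\<close> that contracts to the base point
    \<open>rescale G s p\<close> for every \<open>s\<close> in the cone.\<close>
  define q where "q = lift_point (ones G) p"
  have q: "q \<in> half_open_points G" unfolding q_def by (rule one.lift_point_half_open[OF assms(3)])
  have ne: "verts G \<noteq> {}" using assms(2) by (auto simp: connected_def strongly_connected_def)
  have H1: "H1R one.Gs = H1R G" by (rule H1R_contracted_ones[OF assms(1)])
  have H1Z: "H1Z one.Gs = H1Z G" unfolding H1Z_def H1 ..
  let ?f = "Pic_to_jacobian G w p (int d)" and ?W = "brill_noether_locus \<epsilon> G w (int d) (int r)"
    and ?A = "universal_Pic_set G w (int d)"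
  let ?T = "torus_topology one.Gs" and ?\<pi> = "H1_class one.Gs"
    and ?\<alpha> = "\<lambda>(s, x). (s, rescale_torus G s x)"
  define Y where "Y = (SIGMA s : length_cone G. torus (contracted_graph G s))"
  let ?F = "\<lambda>s. frag_cmul (int d) (frag_of (contract_point G s q)) :: ('v set, 'e) divisor"
  have con: "contraction G s" if "s \<in> length_cone G" for s
    using that assms(1) by (intro contraction.intro)
  have F: "?F s \<in> divisors (curve_at G w s)" if s: "s \<in> length_cone G" for s
    using contraction.contract_point_in_points[OF con[OF s]] q half_open_points_subset[of G] by (intro divisors_cmul) auto
  have f_class: "?f (s, lin_equiv (curve_at G w s) `` {D}) = (s, H1_class (contracted_graph G s) z)"
    if s: "s \<in> length_cone G" and D: "D \<in> divisors (curve_at G w s)"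
      and z: "z \<in> H1R (contracted_graph G s)" "curve_rel (curve_at G w s) (D - ?F s) (\<lambda>e. s e * z e)" for s D z
  proof -
    interpret c: contraction G s by (rule con[OF s])
    interpret M: metric_graph "curve_at G w s" by (rule c.metric_graph_curve_at)
    show ?thesis
      using M.abel_jacobi_eq[OF D F[OF s], of z] z rescale_eq_contract_lift[OF assms(3) s]
      by (simp add: Pic_to_jacobian_def q_def)
  qed
  have f_ex: "\<exists>z\<in>H1R (contracted_graph G s). curve_rel (curve_at G w s) (D - ?F s) (\<lambda>e. s e * z e)"
    if s: "s \<in> length_cone G" and D: "D \<in> divisors (curve_at G w s)" "divisor_degree D = int d" for s D
  proof -
    interpret c: contraction G s by (rule con[OF s])
    have "divisor_degree (D - ?F s + ?F s) = divisor_degree (D - ?F s) + divisor_degree (?F s)"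
      by (rule divisor_degree_linear(1))
    then have "divisor_degree (D - ?F s) = 0"
      using D(2) by (simp add: divisor_degree_linear)
    from c.curve_at_rel_exists[OF assms(2) divisors_diff[OF D(1) F[OF s]] this]
    show ?thesis by blast
  qed
  have W_A: "?W \<subseteq> ?A"
    by (auto simp: brill_noether_locus_def universal_Pic_set_def Pic_def intro!: quotientI)
  have f_Y: "?f x \<in> Y" if "x \<in> ?A" for x
  proof -
    from that obtain s D where x: "x = (s, lin_equiv (curve_at G w s) `` {D})" and s: "s \<in> length_cone G"
      and D: "D \<in> divisors (curve_at G w s)" "divisor_degree D = int d"
      by (auto simp: universal_Pic_set_def Pic_def elim!: quotientE)
    from f_ex[OF s D] obtain z where z: "z \<in> H1R (contracted_graph G s)"
      "curve_rel (curve_at G w s) (D - ?F s) (\<lambda>e. s e * z e)" by blast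
    show ?thesis unfolding x f_class[OF s D(1) z] using s z by (simp add: Y_def torus_def)
  qed
  \<comment> \<open>Injectivity of the Abel-Jacobi map on classes: \<open>?W\<close> is saturated
    for \<open>?f\<close>, so its complement in \<open>?A\<close> is a full preimage, as the
    pullback topology requires.\<close>
  have W_iff: "x \<in> ?W \<longleftrightarrow> ?f x \<in> ?f ` ?W" if x: "x \<in> ?A" for x
  proof
    assume "?f x \<in> ?f ` ?W"
    then obtain x' where x': "x' \<in> ?W" "?f x = ?f x'" by auto
    from x obtain s D where xs: "x = (s, lin_equiv (curve_at G w s) `` {D})" and s: "s \<in> length_cone G"
      and D: "D \<in> divisors (curve_at G w s)" "divisor_degree D = int d"
      by (auto simp: universal_Pic_set_def Pic_def elim!: quotientE)
    from x'(1) obtain s' D' where xs': "x' = (s', lin_equiv (curve_at G w s') `` {D'})" and s': "s' \<in> length_cone G"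
      and D': "D' \<in> divisors (curve_at G w s')" "divisor_degree D' = int d"
      by (auto simp: brill_noether_locus_def)
    from f_ex[OF s D] obtain z where z: "z \<in> H1R (contracted_graph G s)"
      "curve_rel (curve_at G w s) (D - ?F s) (\<lambda>e. s e * z e)" by blast
    from f_ex[OF s' D'] obtain z' where z': "z' \<in> H1R (contracted_graph G s')"
      "curve_rel (curve_at G w s') (D' - ?F s') (\<lambda>e. s' e * z' e)" by blast
    have eq: "s' = s" "H1_class (contracted_graph G s) z = H1_class (contracted_graph G s) z'"
      using x'(2) unfolding xs xs' f_class[OF s D(1) z] f_class[OF s' D'(1) z'] by auto
    interpret c: contraction G s by (rule con[OF s])
    interpret M: metric_graph "curve_at G w s" by (rule c.metric_graph_curve_at)
    have "curve_rel (curve_at G w s) (D' - ?F s) (\<lambda>e. s e * z e)"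
      using M.curve_rel_class_eq_iff[of z' z "D' - ?F s"] z z' eq by simp
    from abel_rel_diff[OF this z(2)] have DD': "curve_rel (curve_at G w s) (D' - D) (\<lambda>_. 0)" by simp
    have "lin_equiv (curve_at G w s) `` {D} = lin_equiv (curve_at G w s) `` {D'}"
    proof -
      have "curve_rel (curve_at G w s) (X - D) (\<lambda>_. 0) \<longleftrightarrow> curve_rel (curve_at G w s) (X - D') (\<lambda>_. 0)" for X
        using abel_rel_add[OF DD', of "X - D'" "\<lambda>_. 0"] abel_rel_diff[OF _ DD', of "X - D" "\<lambda>_. 0"] by auto
      then show ?thesis using D(1) D'(1) eq(1) by (auto simp: M.lin_equiv_iff_curve_rel)
    qed
    then show "x \<in> ?W" using x'(1) unfolding xs xs' eq(1) by simp
  qed blast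
  have \<alpha>_class: "?\<alpha> (s, ?\<pi> z) = (s, H1_class (contracted_graph G s) (rescale_H1 s z))"
    if s: "s \<in> length_cone G" and z: "z \<in> H1R G" for s z
  proof -
    interpret c: contraction G s by (rule con[OF s])
    have "H1_class c.Gs (rescale_H1 s y) = H1_class c.Gs (rescale_H1 s z)" if yz: "y \<in> ?\<pi> z" for y
    proof -
      obtain h where h: "h \<in> H1Z G" "y = z + h" using yz by (auto simp: H1_class_def H1Z)
      have "rescale_H1 s y - rescale_H1 s z = rescale_H1 s h"
        by (auto simp: rescale_H1_def h fun_eq_iff)
      then show ?thesis using c.rescale_H1_H1Z[OF h(1)] by (simp add: H1_class_eq_iff)
    qed
    moreover have "z \<in> ?\<pi> z" using H1Z_0[of G] by (force simp: H1_class_def H1Z)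
    ultimately have "rescale_torus G s (?\<pi> z) = H1_class c.Gs (rescale_H1 s z)"
      unfolding rescale_torus_def by (intro SUP_eq_const) blast+
    then show ?thesis by simp
  qed
  \<comment> \<open>Membership in terms of the real coordinates \<open>(s, z)\<close>. Since
    \<open>z\<close> enters only through \<open>s e * z e\<close>, its values on contracted edges do
    not influence the condition.\<close>
  have locus_iff: "?\<alpha> (s, ?\<pi> z) \<in> ?f ` ?W \<longleftrightarrow> in_locus G w \<epsilon> q (int d) r s z"
    if s: "s \<in> length_cone G" and z: "z \<in> H1R G" for s z
  proof -
    interpret c: contraction G s by (rule con[OF s])
    interpret M: metric_graph "curve_at G w s" by (rule c.metric_graph_curve_at)
    have zH: "rescale_H1 s z \<in> H1R c.Gs" by (rule c.rescale_H1_H1R[OF z])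
    have rescale: "curve_rel (curve_at G w s) D (\<lambda>e. s e * rescale_H1 s z e) \<longleftrightarrow> curve_rel (curve_at G w s) D (\<lambda>e. s e * z e)" for D
      by (rule abel_rel_cong) (simp add: rescale_H1_def)
    show ?thesis
    proof
      assume "?\<alpha> (s, ?\<pi> z) \<in> ?f ` ?W"
      then obtain s' D where D: "?\<alpha> (s, ?\<pi> z) = ?f (s', lin_equiv (curve_at G w s') `` {D})" "s' \<in> length_cone G"
        "D \<in> divisors (curve_at G w s')" "divisor_degree D = int d" "int r \<le> divisor_rank \<epsilon> (curve_at G w s') D"
        by (auto simp: brill_noether_locus_def)
      have s': "s' = s" using D(1) by (simp add: Pic_to_jacobian_def)
      from f_ex[OF D(2-4)] obtain y where y: "y \<in> H1R c.Gs" "curve_rel (curve_at G w s) (D - ?F s) (\<lambda>e. s e * y e)"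
        unfolding s' by blast
      have "H1_class c.Gs (rescale_H1 s z) = H1_class c.Gs y"
        using D(1) f_class[OF s D(3)[unfolded s'] y] unfolding \<alpha>_class[OF s z] s' by simp
      then have "curve_rel (curve_at G w s) (D - ?F s) (\<lambda>e. s e * rescale_H1 s z e)"
        using M.curve_rel_class_eq_iff[of y "rescale_H1 s z"] y zH by simp
      then show "in_locus G w \<epsilon> q (int d) r s z"
        using D(3-5) unfolding in_locus_def rescale s' by blast
    next
      assume "in_locus G w \<epsilon> q (int d) r s z"
      then obtain D where D: "D \<in> divisors (curve_at G w s)" "divisor_degree D = int d"
        "int r \<le> divisor_rank \<epsilon> (curve_at G w s) D" "curve_rel (curve_at G w s) (D - ?F s) (\<lambda>e. s e * z e)"
        unfolding in_locus_def by blast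
      have "?\<alpha> (s, ?\<pi> z) = ?f (s, lin_equiv (curve_at G w s) `` {D})"
        unfolding \<alpha>_class[OF s z] using f_class[OF s D(1) zH] D(4) rescale by simp
      moreover have "(s, lin_equiv (curve_at G w s) `` {D}) \<in> ?W"
        using s D(1-3) by (auto simp: brill_noether_locus_def)
      ultimately show "?\<alpha> (s, ?\<pi> z) \<in> ?f ` ?W" by blast
    qed
  qed
  have \<alpha>_Y: "?\<alpha> (s, x) \<in> Y" if sx: "s \<in> length_cone G" "x \<in> torus one.Gs" for s x
  proof -
    obtain z where z: "z \<in> H1R G" "x = ?\<pi> z" using sx(2) by (auto simp: torus_def H1)
    have "rescale_H1 s z \<in> H1R (contracted_graph G s)"
      by (rule contraction.rescale_H1_H1R[OF con[OF sx(1)] z(1)])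
    then show ?thesis using sx(1) unfolding z(2) \<alpha>_class[OF sx(1) z(1)] by (simp add: Y_def torus_def)
  qed
  have topT: "topspace ?T = torus one.Gs"
    unfolding torus_topology_def by (rule topspace_final_topology) (simp add: torus_def)
  let ?P = "prod_topology (top_of_set (length_cone G)) ?T"
  have J: "universal_jacobian G = final_topology ?P ?\<alpha> Y"
    by (simp add: universal_jacobian_def Y_def)
  have topJ: "topspace (universal_jacobian G) = Y"
    unfolding J by (rule topspace_final_topology) (use \<alpha>_Y in \<open>auto simp: topT\<close>)
  \<comment> \<open>By the definition of the final topology, closedness amounts to openness of this
    preimage in the product of the cone with the torus.\<close>
  have "openin ?P {x \<in> topspace ?P. ?\<alpha> x \<in> Y - ?f ` ?W}"
    unfolding openin_prod_topology_alt
  proof (intro allI impI)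
    fix s x assume "(s, x) \<in> {x \<in> topspace ?P. ?\<alpha> x \<in> Y - ?f ` ?W}"
    then have s: "s \<in> length_cone G" and x: "x \<in> torus one.Gs" and notW: "?\<alpha> (s, x) \<notin> ?f ` ?W"
      by (auto simp: topT)
    obtain z where z: "z \<in> H1R G" "x = ?\<pi> z" using x by (auto simp: torus_def H1)
    have not_locus: "\<not> in_locus G w \<epsilon> q (int d) r s z"
      using notW locus_iff[OF s z(1)] unfolding z(2) by blast
    \<comment> \<open>The second clause provides the hypothesis \<open>S_half\<close> of
      \<open>in_locus_limit\<close>: where \<open>s e\<close> is positive, nearby lengths exceed
      half of it. The first and third clauses give convergence of lengths and coordinates.\<close>
    define near where "near = (\<lambda>\<delta> s' z'. (\<forall>e\<in>arcs G. s e - \<delta> < s' e \<and> s' e < s e + \<delta>) \<and>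
      (\<forall>e\<in>{e\<in>arcs G. 0 < s e}. s e / 2 < s' e \<and> s' e < s e + \<delta>) \<and>
      (\<forall>e\<in>arcs G. z e - \<delta> < z' e \<and> z' e < z e + \<delta>))"
    \<comment> \<open>Otherwise, choosing a point of the locus for every \<open>n\<close> gives a
      sequence converging to \<open>(s, z)\<close>, which would then lie in the locus. Sequences
      suffice because only the finitely many coordinates in \<open>arcs G\<close> are
      involved.\<close>
    have "\<exists>n. \<forall>s'\<in>length_cone G. \<forall>z'\<in>H1R G. near (1 / real (Suc n)) s' z' \<longrightarrow> \<not> in_locus G w \<epsilon> q (int d) r s' z'"
    proof (rule ccontr)
      assume "\<not> ?thesis"
      then have "\<forall>n. \<exists>sz. fst sz \<in> length_cone G \<and> snd sz \<in> H1R G \<and> near (1 / real (Suc n)) (fst sz) (snd sz) \<and>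
          in_locus G w \<epsilon> q (int d) r (fst sz) (snd sz)"
        unfolding split_paired_Ex fst_conv snd_conv by blast
      from choice[OF this] obtain SZ where SZ: "\<And>n. fst (SZ n) \<in> length_cone G" "\<And>n. snd (SZ n) \<in> H1R G"
        "\<And>n. near (1 / real (Suc n)) (fst (SZ n)) (snd (SZ n))" "\<And>n. in_locus G w \<epsilon> q (int d) r (fst (SZ n)) (snd (SZ n))"
        by blast
      have conv: "X \<longlonglongrightarrow> a" if "\<And>n. a - 1 / real (Suc n) < X n \<and> X n < a + 1 / real (Suc n)" for X and a :: real
      proof (rule tendsto_sandwich[of "\<lambda>n. a - 1 / real (Suc n)" _ _ "\<lambda>n. a + 1 / real (Suc n)"])
        have 0: "(\<lambda>n. 1 / real (Suc n)) \<longlonglongrightarrow> 0" by (rule LIMSEQ_Suc[OF lim_1_over_n])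
        show "(\<lambda>n. a - 1 / real (Suc n)) \<longlonglongrightarrow> a" using tendsto_diff[OF tendsto_const 0, of a] by simp
        show "(\<lambda>n. a + 1 / real (Suc n)) \<longlonglongrightarrow> a" using tendsto_add[OF tendsto_const 0, of a] by simp
      qed (use that in \<open>auto intro!: always_eventually less_imp_le\<close>)
      have "in_locus G w \<epsilon> q (int d) r s z"
      proof (rule in_locus_limit[of G q \<epsilon> "\<lambda>n. fst (SZ n)" s "\<lambda>n. snd (SZ n)"])
        fix n e assume e: "e \<in> arcs G"
        show "s e / 2 \<le> fst (SZ n) e"
        proof (cases "0 < s e")
          case True
          then show ?thesis using SZ(3)[of n] e by (auto simp: near_def intro: less_imp_le)
        next
          case False
          moreover have "0 \<le> fst (SZ n) e" using SZ(1)[of n] e by (simp add: length_cone_def)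
          ultimately show ?thesis by simp
        qed
      next
        fix e assume e: "e \<in> arcs G"
        show "(\<lambda>n. fst (SZ n) e) \<longlonglongrightarrow> s e" by (rule conv) (use SZ(3) e in \<open>simp add: near_def\<close>)
        show "(\<lambda>n. snd (SZ n) e) \<longlonglongrightarrow> z e" by (rule conv) (use SZ(3) e in \<open>simp add: near_def\<close>)
      qed (use assms(1,4) ne q s SZ in simp_all)
      with not_locus show False by blast
    qed
    then obtain n where n: "\<And>s' z'. s' \<in> length_cone G \<Longrightarrow> z' \<in> H1R G \<Longrightarrow> near (1 / real (Suc n)) s' z' \<Longrightarrow>
        \<not> in_locus G w \<epsilon> q (int d) r s' z'" by blast
    define \<delta> where "\<delta> = 1 / real (Suc n)"
    have \<delta>: "0 < \<delta>" by (simp add: \<delta>_def)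
    define U where "U = length_cone G \<inter> ({s'. \<forall>e\<in>arcs G. s e - \<delta> < s' e \<and> s' e < s e + \<delta>} \<inter>
      {s'. \<forall>e\<in>{e\<in>arcs G. 0 < s e}. s e / 2 < s' e \<and> s' e < s e + \<delta>})"
    \<comment> \<open>\<open>box h\<close> is the box around \<open>z\<close> translated by
      \<open>- h\<close>. The image \<open>V\<close> of \<open>box 0\<close> in the torus is open
      because its preimage in \<open>H1R G\<close> is the union of the translates by integral
      cycles.\<close>
    define box where "box = (\<lambda>h. {z'. \<forall>e\<in>arcs G. (z e - \<delta>) - h e < z' e \<and> z' e < (z e + \<delta>) - h e})"
    define V where "V = ?\<pi> ` (H1R G \<inter> box 0)"
    have "openin (top_of_set (length_cone G)) U"
      unfolding U_def by (intro openin_open_Int open_Int open_coordinate_box) auto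
    moreover have "openin ?T V"
      unfolding torus_topology_def openin_final_topology
    proof
      show "V \<subseteq> torus one.Gs" by (auto simp: V_def torus_def H1)
      have "{y \<in> topspace (top_of_set (H1R one.Gs)). ?\<pi> y \<in> V} = H1R G \<inter> (\<Union>h\<in>H1Z G. box h)"
      proof (intro equalityI subsetI)
        fix y assume "y \<in> {y \<in> topspace (top_of_set (H1R one.Gs)). ?\<pi> y \<in> V}"
        then obtain u where y: "y \<in> H1R G" and u: "u \<in> H1R G" "u \<in> box 0" "?\<pi> y = ?\<pi> u"
          by (auto simp: V_def H1)
        have "u - y \<in> H1Z G" using u(3) by (metis H1_class_eq_iff H1Z)
        moreover have "y \<in> box (u - y)" using u(2) by (auto simp: box_def)
        ultimately show "y \<in> H1R G \<inter> (\<Union>h\<in>H1Z G. box h)" using y by blast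
      next
        fix y assume "y \<in> H1R G \<inter> (\<Union>h\<in>H1Z G. box h)"
        then obtain h where y: "y \<in> H1R G" "h \<in> H1Z G" "y \<in> box h" by blast
        have "y + h \<in> H1R G" using y(1,2) by (intro H1R_add) (auto simp: H1Z_def)
        moreover have "y + h \<in> box 0" using y(3) by (auto simp: box_def algebra_simps)
        moreover have "?\<pi> y = ?\<pi> (y + h)"
          unfolding H1_class_eq_iff H1Z using H1Z_minus[OF y(2)] by simp
        ultimately show "y \<in> {y \<in> topspace (top_of_set (H1R one.Gs)). ?\<pi> y \<in> V}"
          using y(1) by (auto simp: V_def H1)
      qed
      also have "openin (top_of_set (H1R one.Gs)) \<dots>"
        unfolding H1 box_def by (intro openin_open_Int open_UN ballI open_coordinate_box) simp
      finally show "openin (top_of_set (H1R one.Gs)) {y \<in> topspace (top_of_set (H1R one.Gs)). ?\<pi> y \<in> V}" .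
    qed
    moreover have "s \<in> U" using s \<delta> by (auto simp: U_def)
    moreover have "x \<in> V" using z \<delta> by (auto simp: V_def box_def)
    moreover have "U \<times> V \<subseteq> {x \<in> topspace ?P. ?\<alpha> x \<in> Y - ?f ` ?W}"
    proof
      fix y assume "y \<in> U \<times> V"
      then obtain s' x' where y: "y = (s', x')" and s': "s' \<in> U" and x': "x' \<in> V" by blast
      then obtain z' where z': "z' \<in> H1R G" "z' \<in> box 0" "x' = ?\<pi> z'" by (auto simp: V_def)
      have sc: "s' \<in> length_cone G" using s' by (simp add: U_def)
      have xt: "x' \<in> torus one.Gs" using z' by (simp add: torus_def H1)
      have "near \<delta> s' z'" using s' z'(2) by (auto simp: near_def U_def box_def)
      then have "?\<alpha> (s', x') \<notin> ?f ` ?W"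
        using n[OF sc z'(1)] locus_iff[OF sc z'(1)] unfolding z'(3) \<delta>_def by blast
      then show "y \<in> {x \<in> topspace ?P. ?\<alpha> x \<in> Y - ?f ` ?W}"
        using sc xt \<alpha>_Y[OF sc xt] unfolding y by (simp add: topT)
    qed
    ultimately show "\<exists>U V. openin (top_of_set (length_cone G)) U \<and> openin ?T V \<and> s \<in> U \<and> x \<in> V \<and>
        U \<times> V \<subseteq> {x \<in> topspace ?P. ?\<alpha> x \<in> Y - ?f ` ?W}" by blast
  qed
  then have "openin (universal_jacobian G) (Y - ?f ` ?W)"
    unfolding J openin_final_topology by blast
  moreover have top: "topspace (universal_Pic G w p (int d)) = ?A"
    unfolding universal_Pic_def topspace_pullback_topology topJ using f_Y by blast
  moreover have "?A - ?W = ?f -` (Y - ?f ` ?W) \<inter> ?A"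
    using f_Y W_iff by blast
  ultimately show ?thesis
    unfolding closedin_def top using W_A by (auto simp: universal_Pic_def openin_pullback_topology)
qed

end
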